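(* Let $(M^3,g,\mathcal{F})$ be a spin Riemannian flow, given by a unit vector field $\xi$, carrying a non-zero $(\alpha,\beta)$-transversal Killing spinor for real $\alpha$ and $\beta$. Assume that $\kappa=0$. Let $J$ be the canonical almost-Hermitian structure on $Q$, let $b:M\to\mathbb{R}$ be the function with $h=bJ$, and let $db_{|_Q}$ be the orthogonal projection of $\mathrm{grad}(b)$ onto $Q$. (i) For every $Z\in\Gamma(Q)$ one has $$\begin{aligned}\mathrm{Scal}_M&=2\bigl(4\beta^2-b^2-4\alpha b\bigr),\\ \mathrm{Ric}_M(\xi)&=2b^2\xi-J(db_{|_Q}),\\ \mathrm{Ric}_M(Z)&=2(2\beta^2-b^2-2\alpha b)Z-g\bigl(J(db_{|_Q}),Z\bigr)\xi.\end{aligned}$$ (ii) One has $\nabla_\xi db_{|_Q}=0$ and $\mathrm{div}^M(J(db_{|_Q}))=-8\alpha\beta(3b+2\alpha)$. (iii) If furthermore $M$ is compact, then $\alpha\beta=0$ and $\xi(b)=0$.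
   Context: Manifolds are connected. A Riemannian flow $(M^{3},g,\mathcal{F})$ is a Riemannian $3$-manifold with the foliation tangent to a smooth unit vector field $\xi$ such that $(\mathcal{L}_\xi g)(Z,W)=0$ for all $Z,W\perp\xi$. Put $Q=\xi^\perp$, $h(Z)=\nabla^M_Z\xi$ for $Z\in Q$ (skew-symmetric on $Q$), $\kappa=\nabla^M_\xi\xi\in\Gamma(Q)$, $\Omega(Z,W)=g(h(Z),W)$ on $Q$ extended by $\Omega(\xi,\cdot)=0$. The connection $\nabla$ on $Q$ is $\nabla_\xi Z=[\xi,Z]^Q$, $\nabla_XZ=(\nabla^M_XZ)^Q$ for $X\in\Gamma(Q)$. $M$ is oriented and $Q$ is oriented so that $\{Z,W\}$ is positive iff $\{\xi,Z,W\}$ is positive; $J$ is the rotation $J(e_1)=e_2$, $J(e_2)=-e_1$ in any positively oriented local orthonormal basis $\{e_1,e_2\}$ of $Q$, and $h=bJ$ for a smooth function $b$. On the spinor bundle $\Sigma M$, with Clifford multiplication "$\cdot$" ($X\cdot X=-|X|^2$; $e_i\wedge e_j$ acts as $e_i\cdot e_j\cdot$; normalized so that $-\xi\cdot e_1\cdot e_2\cdot=\mathrm{Id}$), the transversal connection is $\nabla_\xi\varphi=\nabla^M_\xi\varphi-\frac12\Omega\cdot\varphi-\frac12\xi\cdot\kappa\cdot\varphi$, $\nabla_Z\varphi=\nabla^M_Z\varphi-\frac12\xi\cdot h(Z)\cdot\varphi$ for $Z\in\Gamma(Q)$. An $(\alpha,\beta)$-transversal Killing spinor is a smooth section $\psi$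 of $\Sigma M$ with $\nabla_\xi\psi=\alpha\,\xi\cdot\psi$ and $\nabla_Z\psi=\beta\,\xi\cdot Z\cdot\psi$ for all $Z\in\Gamma(Q)$. $\mathrm{Ric}_M$ is the Ricci endomorphism of $(M,g)$. Sign convention: $\mathrm{div}^M(X)=-\mathrm{trace}(Y\mapsto\nabla^M_YX)$. *)

theory Defs
  imports "HOL-Analysis.Analysis"
begin

section \<open>Oriented smooth 3-manifolds\<close>

primrec Ck_on :: "nat \<Rightarrow> 'v::euclidean_space set \<Rightarrow> ('v \<Rightarrow> 'w::real_normed_vector) \<Rightarrow> bool" where
  "Ck_on 0 S f \<longleftrightarrow> continuous_on S f"
| "Ck_on (Suc k) S f \<longleftrightarrow>
     (\<forall>x\<in>S. f differentiable (at x)) \<and> (\<forall>v. Ck_on k S (\<lambda>x. frechet_derivative f (at x) v))"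

definition smooth_on :: "'v::euclidean_space set \<Rightarrow> ('v \<Rightarrow> 'w::real_normed_vector) \<Rightarrow> bool" where
  "smooth_on S f \<longleftrightarrow> (\<forall>k. Ck_on k S f)"

type_synonym 'a chart = "'a set \<times> ('a \<Rightarrow> real^3)"

text \<open>A manifold is a whole type, with the topology of its type class. An oriented manifold is one
  with an atlas all of whose transition maps preserve the orientation of \<open>\<real>\<^sup>3\<close>. The atlas need not be
  maximal.\<close>

definition oriented_atlas :: "'a::topological_space chart set \<Rightarrow> bool" where
  "oriented_atlas A \<longleftrightarrow>
     (\<Union>(fst ` A) = UNIV) \<and>
     (\<forall>(U,\<phi>)\<in>A. open U \<and> open (\<phi> ` U) \<and> homeomorphism U (\<phi> ` U) \<phi> (the_inv_into U \<phi>)) \<and>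
     (\<forall>(U,\<phi>)\<in>A. \<forall>(V,\<theta>)\<in>A.
        smooth_on (\<phi> ` (U \<inter> V)) (\<theta> \<circ> the_inv_into U \<phi>) \<and>
        (\<forall>x\<in>\<phi> ` (U \<inter> V). det (matrix (frechet_derivative (\<theta> \<circ> the_inv_into U \<phi>) (at x))) > 0))"

definition smooth_fun :: "'a::topological_space chart set \<Rightarrow> 'a set \<Rightarrow> ('a \<Rightarrow> real) \<Rightarrow> bool" where
  "smooth_fun A U f \<longleftrightarrow> (\<forall>(V,\<phi>)\<in>A. smooth_on (\<phi> ` (U \<inter> V)) (f \<circ> the_inv_into V \<phi>))"

definition smooth_near :: "'a::topological_space chart set \<Rightarrow> 'a \<Rightarrow> ('a \<Rightarrow> real) \<Rightarrow> bool" where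
  "smooth_near A p f \<longleftrightarrow> (\<exists>U. open U \<and> p \<in> U \<and> smooth_fun A U f)"

definition smooth_cfun :: "'a::topological_space chart set \<Rightarrow> 'a set \<Rightarrow> ('a \<Rightarrow> complex) \<Rightarrow> bool" where
  "smooth_cfun A U f \<longleftrightarrow> smooth_fun A U (\<lambda>p. Re (f p)) \<and> smooth_fun A U (\<lambda>p. Im (f p))"


section \<open>Tangent vectors and vector fields\<close>

text \<open>Tangent vectors are derivations of germs of smooth functions. The type below is the ambient
  real vector space of all functionals on functions; the tangent space at a point is cut out of it
  as a subspace.\<close>

typedef 'a tvec = "UNIV :: (('a \<Rightarrow> real) \<Rightarrow> real) set"
  morphisms act Tvec
  by simp

setup_lifting type_definition_tvec

instantiation tvec :: (type) real_vector
begin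

lift_definition zero_tvec :: "'a tvec" is "\<lambda>f. 0" .
lift_definition plus_tvec :: "'a tvec \<Rightarrow> 'a tvec \<Rightarrow> 'a tvec" is "\<lambda>v w f. v f + w f" .
lift_definition minus_tvec :: "'a tvec \<Rightarrow> 'a tvec \<Rightarrow> 'a tvec" is "\<lambda>v w f. v f - w f" .
lift_definition uminus_tvec :: "'a tvec \<Rightarrow> 'a tvec" is "\<lambda>v f. - v f" .
lift_definition scaleR_tvec :: "real \<Rightarrow> 'a tvec \<Rightarrow> 'a tvec" is "\<lambda>r v f. r * v f" .

instance
  by standard (transfer; simp add: algebra_simps fun_eq_iff)+

end

text \<open>A derivation at \<open>p\<close> is only meaningful on functions smooth near \<open>p\<close>; requiring the value
  \<open>0\<close> on all other functions makes equality of tangent vectors the equality of the type.\<close>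

definition tangent_space :: "'a::topological_space chart set \<Rightarrow> 'a \<Rightarrow> 'a tvec set" where
  "tangent_space A p = {v.
     (\<forall>f h. smooth_near A p f \<longrightarrow> smooth_near A p h \<longrightarrow>
        act v (\<lambda>q. f q + h q) = act v f + act v h \<and>
        act v (\<lambda>q. f q * h q) = f p * act v h + h p * act v f) \<and>
     (\<forall>f r. smooth_near A p f \<longrightarrow> act v (\<lambda>q. r * f q) = r * act v f) \<and>
     (\<forall>f. \<not> smooth_near A p f \<longrightarrow> act v f = 0)}"

text \<open>Smooth vector fields on \<open>U\<close>; their values outside \<open>U\<close> are irrelevant.\<close>

definition vector_fields ::
  "'a::topological_space chart set \<Rightarrow> 'a set \<Rightarrow> ('a \<Rightarrow> 'a tvec) set" where
  "vector_fields A U = {X.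
     (\<forall>p\<in>U. X p \<in> tangent_space A p) \<and>
     (\<forall>V f. open V \<longrightarrow> V \<subseteq> U \<longrightarrow> smooth_fun A V f \<longrightarrow> smooth_fun A V (\<lambda>p. act (X p) f))}"

definition lie_bracket ::
  "'a::topological_space chart set \<Rightarrow> ('a \<Rightarrow> 'a tvec) \<Rightarrow> ('a \<Rightarrow> 'a tvec) \<Rightarrow> 'a \<Rightarrow> 'a tvec" where
  "lie_bracket A X Y p = Tvec (\<lambda>f. if smooth_near A p f
     then act (X p) (\<lambda>q. act (Y q) f) - act (Y p) (\<lambda>q. act (X q) f) else 0)"


section \<open>Riemannian geometry\<close>

text \<open>\<open>nabla M p v Y\<close> is \<open>\<nabla>\<^sup>M\<^sub>v Y\<close> for a tangent vector \<open>v\<close> at \<open>p\<close> and a vector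
  field \<open>Y\<close> that is smooth near \<open>p\<close>.\<close>

record 'a riem3 =
  atlas :: "'a chart set"
  rmetric :: "'a \<Rightarrow> 'a tvec \<Rightarrow> 'a tvec \<Rightarrow> real"
  nabla :: "'a \<Rightarrow> 'a tvec \<Rightarrow> ('a \<Rightarrow> 'a tvec) \<Rightarrow> 'a tvec"

abbreviation tangent :: "('a::topological_space, 'm) riem3_scheme \<Rightarrow> 'a \<Rightarrow> 'a tvec set" where
  "tangent M \<equiv> tangent_space (atlas M)"

abbreviation vfields :: "('a::topological_space, 'm) riem3_scheme \<Rightarrow> 'a set \<Rightarrow> ('a \<Rightarrow> 'a tvec) set" where
  "vfields M \<equiv> vector_fields (atlas M)"

abbreviation bracket ::
  "('a::topological_space, 'm) riem3_scheme \<Rightarrow> ('a \<Rightarrow> 'a tvec) \<Rightarrow> ('a \<Rightarrow> 'a tvec) \<Rightarrow> 'a \<Rightarrow> 'a tvec" where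
  "bracket M \<equiv> lie_bracket (atlas M)"

definition riemannian_metric :: "('a::topological_space, 'm) riem3_scheme \<Rightarrow> bool" where
  "riemannian_metric M \<longleftrightarrow>
     (\<forall>p. \<forall>u\<in>tangent M p. \<forall>v\<in>tangent M p. \<forall>w\<in>tangent M p. \<forall>r.
        rmetric M p (u + v) w = rmetric M p u w + rmetric M p v w \<and>
        rmetric M p (r *\<^sub>R u) w = r * rmetric M p u w \<and>
        rmetric M p u v = rmetric M p v u \<and>
        (u \<noteq> 0 \<longrightarrow> rmetric M p u u > 0)) \<and>
     (\<forall>U. open U \<longrightarrow> (\<forall>X\<in>vfields M U. \<forall>Y\<in>vfields M U.
        smooth_fun (atlas M) U (\<lambda>p. rmetric M p (X p) (Y p))))"

text \<open>The Levi-Civita connection: the affine connection that is metric and torsion-free.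
  These conditions determine \<open>nabla M p v Y\<close> for every \<open>v\<close> tangent at \<open>p\<close> and every \<open>Y\<close> smooth near \<open>p\<close>;
  locality in \<open>Y\<close> follows from the Leibniz rule.\<close>

definition levi_civita :: "('a::topological_space, 'm) riem3_scheme \<Rightarrow> bool" where
  "levi_civita M \<longleftrightarrow>
     (\<forall>U. open U \<longrightarrow> (\<forall>X\<in>vfields M U. \<forall>Y\<in>vfields M U.
        (\<lambda>p. nabla M p (X p) Y) \<in> vfields M U \<and>
        (\<forall>p\<in>U. nabla M p (X p) Y - nabla M p (Y p) X = bracket M X Y p) \<and>
        (\<forall>p\<in>U. \<forall>v\<in>tangent M p.
           nabla M p v (\<lambda>q. X q + Y q) = nabla M p v X + nabla M p v Y \<and>
           act v (\<lambda>q. rmetric M q (X q) (Y q))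
             = rmetric M p (nabla M p v X) (Y p) + rmetric M p (X p) (nabla M p v Y)))) \<and>
     (\<forall>U. open U \<longrightarrow> (\<forall>X\<in>vfields M U. \<forall>p\<in>U. \<forall>v\<in>tangent M p.
        (\<forall>w\<in>tangent M p. nabla M p (v + w) X = nabla M p v X + nabla M p w X) \<and>
        (\<forall>r. nabla M p (r *\<^sub>R v) X = r *\<^sub>R nabla M p v X) \<and>
        (\<forall>f. smooth_fun (atlas M) U f \<longrightarrow>
           nabla M p v (\<lambda>q. f q *\<^sub>R X q) = act v f *\<^sub>R X p + f p *\<^sub>R nabla M p v X)))"

definition oriented_riemannian_3manifold ::
  "('a::{t2_space,second_countable_topology}, 'm) riem3_scheme \<Rightarrow> bool" where
  "oriented_riemannian_3manifold M \<longleftrightarrow>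
     connected (UNIV :: 'a set) \<and> oriented_atlas (atlas M) \<and> riemannian_metric M \<and> levi_civita M"

definition orthonormal_frame ::
  "('a::topological_space, 'm) riem3_scheme \<Rightarrow> 'a \<Rightarrow> 'a tvec^3 \<Rightarrow> bool" where
  "orthonormal_frame M p e \<longleftrightarrow>
     (\<forall>i. e$i \<in> tangent M p) \<and> (\<forall>i j. rmetric M p (e$i) (e$j) = (if i = j then 1 else 0))"

definition positive_frame ::
  "('a::topological_space, 'm) riem3_scheme \<Rightarrow> 'a \<Rightarrow> 'a tvec^3 \<Rightarrow> bool" where
  "positive_frame M p e \<longleftrightarrow>
     (\<forall>(U,\<phi>)\<in>atlas M. p \<in> U \<longrightarrow> det (\<chi> i j. act (e$i) (\<lambda>q. \<phi> q $ j)) > 0)"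

text \<open>Trace of an endomorphism of the tangent space at \<open>p\<close>.\<close>

definition tangent_trace ::
  "('a::topological_space, 'm) riem3_scheme \<Rightarrow> 'a \<Rightarrow> ('a tvec \<Rightarrow> 'a tvec) \<Rightarrow> real" where
  "tangent_trace M p L =
     (THE t. \<forall>e. orthonormal_frame M p e \<longrightarrow> t = (\<Sum>i\<in>UNIV. rmetric M p (L (e$i)) (e$i)))"

definition gradient :: "('a::topological_space, 'm) riem3_scheme \<Rightarrow> ('a \<Rightarrow> real) \<Rightarrow> 'a \<Rightarrow> 'a tvec" where
  "gradient M f p = (THE w. w \<in> tangent M p \<and> (\<forall>v\<in>tangent M p. rmetric M p w v = act v f))"

text \<open>Note the sign.\<close>

definition divergence :: "('a::topological_space, 'm) riem3_scheme \<Rightarrow> ('a \<Rightarrow> 'a tvec) \<Rightarrow> 'a \<Rightarrow> real" where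
  "divergence M X p = - tangent_trace M p (\<lambda>v. nabla M p v X)"

definition curvature_fields ::
  "('a::topological_space, 'm) riem3_scheme \<Rightarrow> ('a \<Rightarrow> 'a tvec) \<Rightarrow> ('a \<Rightarrow> 'a tvec) \<Rightarrow> ('a \<Rightarrow> 'a tvec)
     \<Rightarrow> 'a \<Rightarrow> 'a tvec" where
  "curvature_fields M X Y Z p =
     nabla M p (X p) (\<lambda>q. nabla M q (Y q) Z) - nabla M p (Y p) (\<lambda>q. nabla M q (X q) Z)
       - nabla M p (bracket M X Y p) Z"

text \<open>The same tensor on tangent vectors, through arbitrary local extensions to vector fields.\<close>

definition curvature ::
  "('a::topological_space, 'm) riem3_scheme \<Rightarrow> 'a \<Rightarrow> 'a tvec \<Rightarrow> 'a tvec \<Rightarrow> 'a tvec \<Rightarrow> 'a tvec" where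
  "curvature M p u v w =
     (THE r. \<forall>U X Y Z. open U \<longrightarrow> p \<in> U \<longrightarrow>
        X \<in> vfields M U \<longrightarrow> Y \<in> vfields M U \<longrightarrow> Z \<in> vfields M U \<longrightarrow>
        X p = u \<longrightarrow> Y p = v \<longrightarrow> Z p = w \<longrightarrow> r = curvature_fields M X Y Z p)"

definition ricci :: "('a::topological_space, 'm) riem3_scheme \<Rightarrow> 'a \<Rightarrow> 'a tvec \<Rightarrow> 'a tvec" where
  "ricci M p v = (THE r. r \<in> tangent M p \<and>
     (\<forall>w\<in>tangent M p. rmetric M p r w = tangent_trace M p (\<lambda>u. curvature M p u v w)))"

definition scalar_curvature :: "('a::topological_space, 'm) riem3_scheme \<Rightarrow> 'a \<Rightarrow> real" where
  "scalar_curvature M p = tangent_trace M p (ricci M p)"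


section \<open>Riemannian flows\<close>

record 'a flow3 = "'a riem3" +
  xi :: "'a \<Rightarrow> 'a tvec"

definition normal_plane :: "'a::topological_space flow3 \<Rightarrow> 'a \<Rightarrow> 'a tvec set" where
  "normal_plane M p = {v \<in> tangent M p. rmetric M p v (xi M p) = 0}"

definition normal_sections :: "'a::topological_space flow3 \<Rightarrow> 'a set \<Rightarrow> ('a \<Rightarrow> 'a tvec) set" where
  "normal_sections M U = {Z \<in> vfields M U. \<forall>p\<in>U. Z p \<in> normal_plane M p}"

definition proj_normal :: "'a flow3 \<Rightarrow> 'a \<Rightarrow> 'a tvec \<Rightarrow> 'a tvec" where
  "proj_normal M p v = v - rmetric M p v (xi M p) *\<^sub>R xi M p"

definition lie_metric ::
  "'a::topological_space flow3 \<Rightarrow> ('a \<Rightarrow> 'a tvec) \<Rightarrow> ('a \<Rightarrow> 'a tvec) \<Rightarrow> 'a \<Rightarrow> real" where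
  "lie_metric M Z W p = act (xi M p) (\<lambda>q. rmetric M q (Z q) (W q))
     - rmetric M p (bracket M (xi M) Z p) (W p) - rmetric M p (Z p) (bracket M (xi M) W p)"

definition riemannian_flow :: "'a::{t2_space,second_countable_topology} flow3 \<Rightarrow> bool" where
  "riemannian_flow M \<longleftrightarrow>
     oriented_riemannian_3manifold M \<and>
     xi M \<in> vfields M UNIV \<and> (\<forall>p. rmetric M p (xi M p) (xi M p) = 1) \<and>
     (\<forall>U. open U \<longrightarrow> (\<forall>Z\<in>normal_sections M U. \<forall>W\<in>normal_sections M U. \<forall>p\<in>U.
        lie_metric M Z W p = 0))"

definition flow_h :: "'a flow3 \<Rightarrow> 'a \<Rightarrow> 'a tvec \<Rightarrow> 'a tvec" where
  "flow_h M p z = nabla M p z (xi M)"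

definition flow_kappa :: "'a flow3 \<Rightarrow> 'a \<Rightarrow> 'a tvec" where
  "flow_kappa M p = nabla M p (xi M p) (xi M)"

definition flow_Omega :: "'a flow3 \<Rightarrow> 'a \<Rightarrow> 'a tvec \<Rightarrow> 'a tvec \<Rightarrow> real" where
  "flow_Omega M p v w = rmetric M p (flow_h M p (proj_normal M p v)) (proj_normal M p w)"

text \<open>The rotation of the normal plane \<open>Q\<close>: \<open>e\<^sub>1 \<mapsto> e\<^sub>2\<close>, \<open>e\<^sub>2 \<mapsto> - e\<^sub>1\<close> in every positive
  orthonormal basis of \<open>Q\<close>.\<close>

definition flow_J :: "'a::topological_space flow3 \<Rightarrow> 'a \<Rightarrow> 'a tvec \<Rightarrow> 'a tvec" where
  "flow_J M p z = (THE w. \<forall>e1 e2.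
     orthonormal_frame M p (vector [xi M p, e1, e2]) \<longrightarrow>
     positive_frame M p (vector [xi M p, e1, e2]) \<longrightarrow>
     w = rmetric M p z e1 *\<^sub>R e2 - rmetric M p z e2 *\<^sub>R e1)"

text \<open>The transversal connection on \<open>Q\<close>, for a direction split as \<open>v = g(v,\<xi>) \<xi> + v\<^sup>Q\<close>.\<close>

definition nabla_normal ::
  "'a::topological_space flow3 \<Rightarrow> 'a \<Rightarrow> 'a tvec \<Rightarrow> ('a \<Rightarrow> 'a tvec) \<Rightarrow> 'a tvec" where
  "nabla_normal M p v Z =
     rmetric M p v (xi M p) *\<^sub>R proj_normal M p (bracket M (xi M) Z p)
       + proj_normal M p (nabla M p (proj_normal M p v) Z)"

definition normal_gradient :: "'a::topological_space flow3 \<Rightarrow> ('a \<Rightarrow> real) \<Rightarrow> 'a \<Rightarrow> 'a tvec" where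
  "normal_gradient M f p = proj_normal M p (gradient M f p)"


section \<open>Spin structures and spinors\<close>

text \<open>Clifford multiplication of \<open>\<real>\<^sup>3\<close> on \<open>\<complex>\<^sup>2\<close>: \<open>x\<close> acts as \<open>- \<i> (x\<^sub>1 \<sigma>\<^sub>1 + x\<^sub>2 \<sigma>\<^sub>2 + x\<^sub>3 \<sigma>\<^sub>3)\<close>
  with the Pauli matrices \<open>\<sigma>\<^sub>k\<close>. Of the two irreducible representations of the Clifford algebra this
  is the one in which \<open>- e\<^sub>1 \<cdot> e\<^sub>2 \<cdot> e\<^sub>3\<close> is the identity for positive orthonormal bases.\<close>

definition clifford :: "real^3 \<Rightarrow> complex^2^2" where
  "clifford x = vector [vector [Complex 0 (- x$3), Complex (- x$2) (- x$1)],
                        vector [Complex (x$2) (- x$1), Complex 0 (x$3)]]"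

lemma clifford_square: "clifford x ** clifford x = - mat (of_real ((norm x)\<^sup>2))"
  by (simp add: vec_eq_iff forall_2 matrix_matrix_mult_def sum_2 clifford_def mat_def complex_eq_iff
      norm_vec_def L2_set_def sum_3 power2_eq_square[symmetric] add_nonneg_nonneg)

lemma clifford_volume:
  "- (clifford (axis 1 1) ** clifford (axis 2 1) ** clifford (axis 3 1)) = mat 1"
  by (simp add: vec_eq_iff forall_2 matrix_matrix_mult_def sum_2 clifford_def mat_def complex_eq_iff
      axis_def)

text \<open>\<open>Spin(3)\<close> in this representation.\<close>

definition SU2 :: "(complex^2^2) set" where
  "SU2 = {s. s ** (\<chi> i j. cnj (s$j$i)) = mat 1 \<and> det s = 1}"

text \<open>A spin structure in the form of a cocycle: an open cover with positive orthonormal frames, and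
  lifts of the \<open>SO(3)\<close>-valued changes of frame to \<open>Spin(3)\<close>. If \<open>x\<close> and \<open>y\<close> are the coordinates of the
  same tangent vector in the frames \<open>i\<close> and \<open>j\<close>, then the lift \<open>s\<close> from \<open>j\<close> to \<open>i\<close> has to
  satisfy \<open>s \<cdot> y \<cdot> s\<^sup>-\<^sup>1 = x\<close> in the Clifford algebra.\<close>

record ('a, 'i) spin3 =
  spin_dom :: "'i \<Rightarrow> 'a set"
  spin_frame :: "'i \<Rightarrow> 'a \<Rightarrow> 'a tvec^3"
  spin_lift :: "'i \<Rightarrow> 'i \<Rightarrow> 'a \<Rightarrow> complex^2^2"

text \<open>\<open>cmult M S i p v\<close> is Clifford multiplication by the tangent vector \<open>v\<close> at \<open>p\<close> in the
  trivialization \<open>i\<close>.\<close>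

definition cmult :: "'a flow3 \<Rightarrow> ('a, 'i) spin3 \<Rightarrow> 'i \<Rightarrow> 'a \<Rightarrow> 'a tvec \<Rightarrow> complex^2^2" where
  "cmult M S i p v = clifford (\<chi> k. rmetric M p v (spin_frame S i p $ k))"

definition spin_structure :: "'a::topological_space flow3 \<Rightarrow> ('a, 'i) spin3 \<Rightarrow> bool" where
  "spin_structure M S \<longleftrightarrow>
     (\<Union>i. spin_dom S i) = UNIV \<and>
     (\<forall>i. open (spin_dom S i) \<and>
        (\<forall>k. (\<lambda>p. spin_frame S i p $ k) \<in> vfields M (spin_dom S i)) \<and>
        (\<forall>p\<in>spin_dom S i. orthonormal_frame M p (spin_frame S i p) \<and>
           positive_frame M p (spin_frame S i p))) \<and>
     (\<forall>i j. (\<forall>k l. smooth_cfun (atlas M) (spin_dom S i \<inter> spin_dom S j)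
                      (\<lambda>p. spin_lift S i j p $ k $ l)) \<and>
        (\<forall>p\<in>spin_dom S i \<inter> spin_dom S j. spin_lift S i j p \<in> SU2 \<and>
           (\<forall>v\<in>tangent M p. cmult M S i p v ** spin_lift S i j p
                             = spin_lift S i j p ** cmult M S j p v))) \<and>
     (\<forall>i j k. \<forall>p\<in>spin_dom S i \<inter> spin_dom S j \<inter> spin_dom S k.
        spin_lift S i j p ** spin_lift S j k p = spin_lift S i k p)"

text \<open>Smooth sections of the spinor bundle, given by their representations in the trivializations.\<close>

definition spinor_fields ::
  "'a::topological_space flow3 \<Rightarrow> ('a, 'i) spin3 \<Rightarrow> ('i \<Rightarrow> 'a \<Rightarrow> complex^2) set" where
  "spinor_fields M S = {\<psi>.
     (\<forall>i k. smooth_cfun (atlas M) (spin_dom S i) (\<lambda>p. \<psi> i p $ k)) \<and>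
     (\<forall>i j. \<forall>p\<in>spin_dom S i \<inter> spin_dom S j. \<psi> i p = spin_lift S i j p *v \<psi> j p)}"

definition act_spinor :: "'a tvec \<Rightarrow> ('a \<Rightarrow> complex^2) \<Rightarrow> complex^2" where
  "act_spinor v \<phi> = (\<chi> k. Complex (act v (\<lambda>q. Re (\<phi> q $ k))) (act v (\<lambda>q. Im (\<phi> q $ k))))"

text \<open>The spinorial Levi-Civita connection,
  \<open>\<nabla>\<^sup>M\<^sub>v \<phi> = v(\<phi>) + 1/4 \<Sum>\<^sub>j\<^sub>k g(\<nabla>\<^sup>M\<^sub>v e\<^sub>j, e\<^sub>k) e\<^sub>j \<cdot> e\<^sub>k \<cdot> \<phi>\<close>, in the trivialization \<open>i\<close>.\<close>

definition nabla_spin ::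
  "'a flow3 \<Rightarrow> ('a, 'i) spin3 \<Rightarrow> 'i \<Rightarrow> 'a \<Rightarrow> 'a tvec \<Rightarrow> ('i \<Rightarrow> 'a \<Rightarrow> complex^2) \<Rightarrow> complex^2" where
  "nabla_spin M S i p v \<phi> = act_spinor v (\<phi> i) + (1/4) *\<^sub>R
     (\<Sum>j\<in>UNIV. \<Sum>k\<in>UNIV.
        rmetric M p (nabla M p v (\<lambda>q. spin_frame S i q $ j)) (spin_frame S i p $ k) *\<^sub>R
        (cmult M S i p (spin_frame S i p $ j) *v (cmult M S i p (spin_frame S i p $ k) *v \<phi> i p)))"

text \<open>A 2-form \<open>\<omega>\<close> acts as \<open>\<Sum>\<^sub>j\<^sub>k (1/2) \<omega>(e\<^sub>j, e\<^sub>k) e\<^sub>j \<cdot> e\<^sub>k\<close>, that is, as the sum over \<open>j < k\<close>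
  without the factor.\<close>

definition cmult_form ::
  "'a flow3 \<Rightarrow> ('a, 'i) spin3 \<Rightarrow> 'i \<Rightarrow> 'a \<Rightarrow> ('a tvec \<Rightarrow> 'a tvec \<Rightarrow> real) \<Rightarrow> complex^2 \<Rightarrow> complex^2" where
  "cmult_form M S i p \<omega> \<phi> = (1/2) *\<^sub>R (\<Sum>j\<in>UNIV. \<Sum>k\<in>UNIV.
     \<omega> (spin_frame S i p $ j) (spin_frame S i p $ k) *\<^sub>R
     (cmult M S i p (spin_frame S i p $ j) *v (cmult M S i p (spin_frame S i p $ k) *v \<phi>)))"

definition nabla_spin_xi ::
  "'a flow3 \<Rightarrow> ('a, 'i) spin3 \<Rightarrow> 'i \<Rightarrow> 'a \<Rightarrow> ('i \<Rightarrow> 'a \<Rightarrow> complex^2) \<Rightarrow> complex^2" where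
  "nabla_spin_xi M S i p \<phi> = nabla_spin M S i p (xi M p) \<phi>
     - (1/2) *\<^sub>R cmult_form M S i p (flow_Omega M p) (\<phi> i p)
     - (1/2) *\<^sub>R (cmult M S i p (xi M p) *v (cmult M S i p (flow_kappa M p) *v \<phi> i p))"

definition nabla_spin_normal ::
  "'a flow3 \<Rightarrow> ('a, 'i) spin3 \<Rightarrow> 'i \<Rightarrow> 'a \<Rightarrow> 'a tvec \<Rightarrow> ('i \<Rightarrow> 'a \<Rightarrow> complex^2) \<Rightarrow> complex^2" where
  "nabla_spin_normal M S i p z \<phi> = nabla_spin M S i p z \<phi>
     - (1/2) *\<^sub>R (cmult M S i p (xi M p) *v (cmult M S i p (flow_h M p z) *v \<phi> i p))"

definition transversal_killing_spinor ::
  "'a::topological_space flow3 \<Rightarrow> ('a, 'i) spin3 \<Rightarrow> real \<Rightarrow> real \<Rightarrow> ('i \<Rightarrow> 'a \<Rightarrow> complex^2) \<Rightarrow> bool" where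
  "transversal_killing_spinor M S \<alpha> \<beta> \<psi> \<longleftrightarrow>
     \<psi> \<in> spinor_fields M S \<and>
     (\<forall>i. \<forall>p\<in>spin_dom S i.
        nabla_spin_xi M S i p \<psi> = \<alpha> *\<^sub>R (cmult M S i p (xi M p) *v \<psi> i p) \<and>
        (\<forall>z\<in>normal_plane M p.
           nabla_spin_normal M S i p z \<psi>
             = \<beta> *\<^sub>R (cmult M S i p (xi M p) *v (cmult M S i p z *v \<psi> i p))))"

end

(* The proof works in the frames of the spin structure. There the Levi-Civita connection becomes an
   so(3) = R^3-valued form, and the Killing equation (with kappa = 0) reads
   D_v psi = (A v) psi, where A v = - (b/2) v + (alpha + b) g(xi, v) xi + beta xi x v is a vector
   acting by Clifford multiplication. Hence |psi| is constant, psi vanishes nowhere, and the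
   integrability condition [X, Y] psi = X (Y psi) - Y (X psi) determines the whole curvature tensor
   from A, b and db. Comparing it with the first Bianchi identity and with the curvature computed
   from D_v xi = b xi x v gives xi(b) = 4 alpha beta and alpha beta = 0. So alpha beta = 0 = xi(b)
   without compactness, and both sides in (ii) vanish: the first because xi is Killing, the
   second because the Hessian of b is symmetric. *)

theory Submission
  imports Defs
begin

section \<open>Calculus of smooth maps on open sets\<close>

text \<open>Dimension three is the reason why one spinor suffices. The volume element acts as a
  scalar, so the Clifford product of two vectors is their cross product, again a vector, minus their
  inner product. Two-forms, the connection form and the curvature all turn into real vectors, and a
  real vector is determined by its action on one non-zero spinor. The curvature becomes an operator
  on \<open>m = x \<times> y\<close>, and the first Bianchi identity says that this operator is
  symmetric. The antisymmetric part that the spinor produces is a multiple of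
  \<open>n \<times> m\<close>, with \<open>n\<close> the coordinates of \<xi> and the factor
  \<open>4 * \<alpha> * \<beta> - \<xi>(b)\<close>. The obstacle lies below this. Tangent vectors
  are abstract derivations, so Hadamard's lemma is needed before a frame is known to span. Moreover
  \<open>curvature\<close>, \<open>ricci\<close>, \<open>tangent_trace\<close> and
  \<open>flow_J\<close> are definite descriptions, which have a known value only once some formula
  is shown to be independent of extensions or frames. For the curvature this independence comes from
  the integrability condition, whose final form involves the fields only through their values at the
  point.\<close>

lemma Ck_on_cong:
  assumes "open S" and "\<And>x. x \<in> S \<Longrightarrow> f x = g x"
  shows "Ck_on k S f \<longleftrightarrow> Ck_on k S g"
  using assms(2)
proof (induction k arbitrary: f g)
  case 0
  then show ?case by (simp cong: continuous_on_cong)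
next
  case (Suc k)
  have diff: "f differentiable at x \<longleftrightarrow> g differentiable at x" if "x \<in> S" for x
    using Suc.prems that \<open>open S\<close>
    by (metis (no_types, lifting) differentiable_def has_derivative_transform_within_open)
  show ?case
  proof (cases "\<forall>x\<in>S. f differentiable at x")
    case True
    have "frechet_derivative f (at x) v = frechet_derivative g (at x) v" if "x \<in> S" for x v
      using frechet_derivative_transform_within_open[of f x S g] True Suc.prems that \<open>open S\<close>
      by auto
    then have "Ck_on k S (\<lambda>x. frechet_derivative f (at x) v) \<longleftrightarrow>
        Ck_on k S (\<lambda>x. frechet_derivative g (at x) v)" for v
      by (intro Suc.IH) auto
    then show ?thesis using diff by simp
  next
    case False
    then show ?thesis using diff by auto
  qed
qed

lemma Ck_on_subset: "Ck_on k S f \<Longrightarrow> T \<subseteq> S \<Longrightarrow> Ck_on k T f"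
  by (induction k arbitrary: f) (auto intro: continuous_on_subset)

lemma Ck_on_SucD: "Ck_on (Suc k) S f \<Longrightarrow> Ck_on k S f"
proof (induction k arbitrary: f)
  case 0
  then show ?case
    by (auto intro!: continuous_at_imp_continuous_on differentiable_imp_continuous_within)
next
  case (Suc k)
  then show ?case by (metis Ck_on.simps(2))
qed

lemma Ck_on_le: "Ck_on k S f \<Longrightarrow> j \<le> k \<Longrightarrow> Ck_on j S f"
  by (induction k) (auto simp: le_Suc_eq dest: Ck_on_SucD simp del: Ck_on.simps)

text \<open>\<open>Ck_on\<close> is phrased with \<open>frechet_derivative\<close>; uniqueness of
  the derivative lets any explicitly computed one stand in for it.\<close>

lemma Ck_on_SucI:
  assumes "open S" and "\<And>x. x \<in> S \<Longrightarrow> (f has_derivative f' x) (at x)"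
    and "\<And>v. Ck_on k S (\<lambda>x. f' x v)"
  shows "Ck_on (Suc k) S f"
proof -
  have "frechet_derivative f (at x) = f' x" if "x \<in> S" for x
    using assms(2)[OF that] by (rule frechet_derivative_at[symmetric])
  then have "Ck_on k S (\<lambda>x. frechet_derivative f (at x) v) \<longleftrightarrow> Ck_on k S (\<lambda>x. f' x v)" for v
    using \<open>open S\<close> by (intro Ck_on_cong) auto
  then show ?thesis
    using assms by (auto simp: differentiable_def)
qed

lemma Ck_on_Suc_has_derivative:
  assumes "Ck_on (Suc k) S f" "x \<in> S"
  shows "(f has_derivative frechet_derivative f (at x)) (at x)"
  using assms by (simp add: frechet_derivative_works)

lemma Ck_on_const: "open S \<Longrightarrow> Ck_on k S (\<lambda>x. c)"
proof (induction k arbitrary: c)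
  case (Suc k)
  show ?case
    by (rule Ck_on_SucI[where f' = "\<lambda>x v. 0"]) (use Suc in auto)
qed simp

lemma Ck_on_bounded_linear_compose:
  assumes "open S" "bounded_linear L" "Ck_on k S f"
  shows "Ck_on k S (\<lambda>x. L (f x))"
  using assms(3)
proof (induction k arbitrary: f)
  case 0
  then show ?case
    using assms(2) by (auto intro: linear_continuous_on_compose continuous_intros
        bounded_linear.continuous_on)
next
  case (Suc k)
  show ?case
  proof (rule Ck_on_SucI[OF \<open>open S\<close>])
    show "((\<lambda>x. L (f x)) has_derivative (\<lambda>v. L (frechet_derivative f (at x) v))) (at x)"
      if "x \<in> S" for x
      by (rule bounded_linear.has_derivative[OF assms(2) Ck_on_Suc_has_derivative[OF Suc.prems that]])
  qed (use Suc in auto)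
qed

lemma Ck_on_id: "open S \<Longrightarrow> Ck_on k S (\<lambda>x. x)"
  by (cases k) (auto intro!: Ck_on_SucI Ck_on_const)

lemma Ck_on_bounded_linear:
  "open S \<Longrightarrow> bounded_linear L \<Longrightarrow> Ck_on k S L"
  by (rule Ck_on_bounded_linear_compose[OF _ _ Ck_on_id])

lemma Ck_on_add:
  assumes "open S" "Ck_on k S f" "Ck_on k S g"
  shows "Ck_on k S (\<lambda>x. f x + g x)"
  using assms(2,3)
proof (induction k arbitrary: f g)
  case 0
  then show ?case by (auto intro: continuous_intros)
next
  case (Suc k)
  show ?case
    by (rule Ck_on_SucI[OF \<open>open S\<close> has_derivative_add[OF
          Ck_on_Suc_has_derivative[OF Suc.prems(1)] Ck_on_Suc_has_derivative[OF Suc.prems(2)]]])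
      (use Suc in auto)
qed

lemma Ck_on_mult:
  fixes f g :: "'v::euclidean_space \<Rightarrow> real"
  assumes "open S" "Ck_on k S f" "Ck_on k S g"
  shows "Ck_on k S (\<lambda>x. f x * g x)"
  using assms(2,3)
proof (induction k arbitrary: f g)
  case 0
  then show ?case by (auto intro: continuous_intros)
next
  case (Suc k)
  show ?case
    by (rule Ck_on_SucI[OF \<open>open S\<close> has_derivative_mult[OF
          Ck_on_Suc_has_derivative[OF Suc.prems(1)] Ck_on_Suc_has_derivative[OF Suc.prems(2)]]])
      (use Suc Ck_on_SucD[OF Suc.prems(1)] Ck_on_SucD[OF Suc.prems(2)] in
        \<open>auto intro!: Ck_on_add[OF \<open>open S\<close>] Suc.IH\<close>)
qed

lemma Ck_on_sum:
  assumes "open S" "\<And>i. i \<in> I \<Longrightarrow> Ck_on k S (f i)"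
  shows "Ck_on k S (\<lambda>x. \<Sum>i\<in>I. f i x)"
  using assms(2)
  by (induction I rule: infinite_finite_induct) (auto intro!: Ck_on_const Ck_on_add \<open>open S\<close>)

text \<open>The chain rule differentiates \<open>g\<close> in a direction that varies with the
  point, while \<open>Ck_on\<close> speaks of fixed directions only. Expanding that direction in
  \<open>Basis\<close> gives a finite sum of products to which the induction hypothesis
  applies.\<close>

lemma Ck_on_compose:
  fixes g :: "'w::euclidean_space \<Rightarrow> real"
  assumes "open S" "open T" "f ` S \<subseteq> T" "Ck_on k S f" "Ck_on k T g"
  shows "Ck_on k S (\<lambda>x. g (f x))"
  using assms(4,5)
proof (induction k arbitrary: g)
  case 0
  then show ?case using assms(3)
    by (auto intro: continuous_on_compose2)
next
  case (Suc k)
  have der: "((\<lambda>x. g (f x)) has_derivative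
      (\<lambda>v. frechet_derivative g (at (f x)) (frechet_derivative f (at x) v))) (at x)"
    if "x \<in> S" for x
  proof -
    have "f x \<in> T" using that assms(3) by auto
    from has_derivative_compose[OF Ck_on_Suc_has_derivative[OF Suc.prems(1) that]
      Ck_on_Suc_has_derivative[OF Suc.prems(2) this]]
    show ?thesis .
  qed
  have "Ck_on k S (\<lambda>x. frechet_derivative g (at (f x)) (frechet_derivative f (at x) v))" for v
  proof -
    have "linear (frechet_derivative g (at (f x)))" if "x \<in> S" for x
      using Ck_on_Suc_has_derivative[OF Suc.prems(2), of "f x"] that assms(3)
      by (auto dest!: has_derivative_linear)
    then have "frechet_derivative g (at (f x)) (frechet_derivative f (at x) v) =
       (\<Sum>b\<in>Basis. (frechet_derivative f (at x) v \<bullet> b) * frechet_derivative g (at (f x)) b)"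
      if "x \<in> S" for x
      using that by (subst euclidean_representation[symmetric]) (simp add: linear_sum linear_scale)
    moreover have "Ck_on k S (\<lambda>x. \<Sum>b\<in>Basis. (frechet_derivative f (at x) v \<bullet> b) *
        frechet_derivative g (at (f x)) b)"
      using Suc.prems
      by (intro Ck_on_sum Ck_on_mult \<open>open S\<close> Ck_on_bounded_linear_compose[of _ "\<lambda>y. y \<bullet> _"]
          bounded_linear_inner_left Suc.IH[OF Ck_on_SucD]) auto
    ultimately show ?thesis
      using Ck_on_cong[OF \<open>open S\<close>] by (metis (no_types, lifting))
  qed
  with der show ?case
    by (rule Ck_on_SucI[OF \<open>open S\<close>])
qed

lemma smooth_on_cong:
  "open S \<Longrightarrow> (\<And>x. x \<in> S \<Longrightarrow> f x = g x) \<Longrightarrow> smooth_on S f \<longleftrightarrow> smooth_on S g"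
  unfolding smooth_on_def using Ck_on_cong by blast

lemma smooth_on_subset: "smooth_on S f \<Longrightarrow> T \<subseteq> S \<Longrightarrow> smooth_on T f"
  unfolding smooth_on_def using Ck_on_subset by blast

lemma smooth_on_has_derivative:
  "smooth_on S f \<Longrightarrow> x \<in> S \<Longrightarrow> (f has_derivative frechet_derivative f (at x)) (at x)"
  unfolding smooth_on_def using Ck_on_Suc_has_derivative by blast

lemma smooth_on_frechet_derivative:
  "smooth_on S f \<Longrightarrow> smooth_on S (\<lambda>x. frechet_derivative f (at x) v)"
  unfolding smooth_on_def by (metis Ck_on.simps(2))

lemma smooth_on_continuous: "smooth_on S f \<Longrightarrow> continuous_on S f"
  unfolding smooth_on_def by (metis Ck_on.simps(1))

text \<open>Hadamard's lemma: along the segments from the centre, \<open>f x - f c\<close> is the integral of the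
  derivative, and the averages of the partial derivatives over these segments are smooth. The weights
  \<open>t\<^sup>m\<close> make the class of averaged functions closed under differentiation.\<close>

definition ray_average :: "'v::euclidean_space \<Rightarrow> nat \<Rightarrow> ('v \<Rightarrow> real) \<Rightarrow> 'v \<Rightarrow> real" where
  "ray_average c m f x = integral {0..1} (\<lambda>t. t ^ m * f (c + t *\<^sub>R (x - c)))"

lemma ray_in_ball:
  fixes c :: "'v::real_normed_vector"
  assumes "x \<in> ball c r" "t \<in> {0..1::real}"
  shows "c + t *\<^sub>R (x - c) \<in> ball c r"
proof -
  have "dist c (c + t *\<^sub>R (x - c)) = t * dist c x"
    using assms by (simp add: dist_norm norm_minus_commute[of c x])
  also have "\<dots> \<le> 1 * dist c x"
    using assms by (intro mult_right_mono) auto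
  finally show ?thesis using assms by simp
qed

lemma continuous_on_ray:
  fixes c :: "'v::real_normed_vector"
  assumes "continuous_on (ball c r) f"
  shows "continuous_on (ball c r \<times> {0..1::real}) (\<lambda>(x, t). f (c + t *\<^sub>R (x - c)))"
proof -
  have "continuous_on (ball c r \<times> {0..1::real}) (\<lambda>z. f (c + snd z *\<^sub>R (fst z - c)))"
    by (rule continuous_on_compose2[OF assms])
      (use ray_in_ball[of _ c r] in \<open>auto simp del: mem_ball intro!: continuous_intros\<close>)
  then show ?thesis by (simp add: case_prod_unfold)
qed

lemma continuous_on_ray_fixed:
  fixes c :: "'v::real_normed_vector"
  assumes "continuous_on (ball c r) f" "x \<in> ball c r"
  shows "continuous_on {0..1::real} (\<lambda>t. f (c + t *\<^sub>R (x - c)))"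
  by (rule continuous_on_compose2[OF assms(1)])
    (use ray_in_ball[OF assms(2)] in \<open>auto simp del: mem_ball intro!: continuous_intros\<close>)

lemma continuous_on_ray_average:
  assumes "continuous_on (ball c r) f"
  shows "continuous_on (ball c r) (ray_average c m f)"
proof -
  have "continuous_on (ball c r \<times> cbox 0 (1::real)) (\<lambda>(x, t). t ^ m * f (c + t *\<^sub>R (x - c)))"
    using continuous_on_ray[OF assms] by (auto simp: case_prod_unfold intro!: continuous_intros)
  from integral_continuous_on_param[OF this] show ?thesis
    by (simp add: ray_average_def[abs_def])
qed

lemma ray_average_has_derivative:
  assumes f: "Ck_on (Suc 0) (ball c r) f" and x0: "x0 \<in> ball c r"
  shows "(ray_average c m f has_derivative
    (\<lambda>v. ray_average c (Suc m) (\<lambda>x. frechet_derivative f (at x) v) x0)) (at x0)"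
proof -
  \<comment> \<open>The rule for parameter integrals asks for a derivative that is continuous as a
    bounded linear map; in finite dimension continuity on each vector suffices. The additional
    factor \<open>t\<close> comes from differentiating the segment with respect to
    \<open>x\<close>.\<close>
  define D where "D x t = t ^ Suc m *\<^sub>R Blinfun (frechet_derivative f (at (c + t *\<^sub>R (x - c))))"
    for x :: 'a and t :: real
  have fder: "(f has_derivative frechet_derivative f (at y)) (at y)" if "y \<in> ball c r" for y
    using Ck_on_Suc_has_derivative[OF f that] .
  have bl: "bounded_linear (frechet_derivative f (at y))" if "y \<in> ball c r" for y
    using fder[OF that] by (rule has_derivative_bounded_linear)
  have D_apply: "blinfun_apply (D x t) v
      = t ^ Suc m * frechet_derivative f (at (c + t *\<^sub>R (x - c))) v"
    if "x \<in> ball c r" "t \<in> {0..1}" for x t v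
    unfolding D_def using bl[OF ray_in_ball[OF that]]
    by (simp add: scaleR_blinfun.rep_eq bounded_linear_Blinfun_apply)
  have cont_f: "continuous_on (ball c r) f" using Ck_on_SucD[OF f] by simp
  have cont: "continuous_on (ball c r \<times> cbox 0 1) (\<lambda>(x, t). D x t)"
  proof (rule continuous_on_blinfun_componentwise)
    fix v :: 'a
    have "continuous_on (ball c r) (\<lambda>y. frechet_derivative f (at y) v)"
      using f by simp
    then have "continuous_on (ball c r \<times> {0..1})
        (\<lambda>(x, t). t ^ Suc m * frechet_derivative f (at (c + t *\<^sub>R (x - c))) v)"
      using continuous_on_ray[of c r "\<lambda>y. frechet_derivative f (at y) v"]
      by (auto simp: case_prod_unfold intro!: continuous_intros)
    then show "continuous_on (ball c r \<times> cbox 0 1)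
        (\<lambda>z. blinfun_apply (case z of (x, t) \<Rightarrow> D x t) v)"
      unfolding cbox_interval
      by (rule continuous_on_eq) (auto simp: D_apply simp del: mem_ball power_Suc)
  qed
  have "((\<lambda>x. integral (cbox 0 1) ((\<lambda>x t. t ^ m * f (c + t *\<^sub>R (x - c))) x)) has_derivative
      integral (cbox 0 1) (D x0)) (at x0 within ball c r)"
  proof (rule leibniz_rule[OF _ _ cont x0 convex_ball])
    fix x t assume "x \<in> ball c r" and "t \<in> cbox 0 (1::real)"
    then have t: "t \<in> {0..1}" and y: "c + t *\<^sub>R (x - c) \<in> ball c r"
      using ray_in_ball by auto
    have "((\<lambda>x. c + t *\<^sub>R (x - c)) has_derivative (\<lambda>v. t *\<^sub>R v)) (at x)"
      by (auto intro!: derivative_eq_intros)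
    from has_derivative_compose[OF this fder[OF y]]
    have "((\<lambda>x. t ^ m * f (c + t *\<^sub>R (x - c))) has_derivative
        (\<lambda>v. t ^ m * frechet_derivative f (at (c + t *\<^sub>R (x - c))) (t *\<^sub>R v))) (at x)"
      by (rule has_derivative_mult_right)
    also have "(\<lambda>v. t ^ m * frechet_derivative f (at (c + t *\<^sub>R (x - c))) (t *\<^sub>R v)) = blinfun_apply (D x t)"
      using D_apply[OF \<open>x \<in> ball c r\<close> t] linear_scale[OF bounded_linear.linear[OF bl[OF y]]]
      by (auto simp: fun_eq_iff)
    finally show "((\<lambda>x. t ^ m * f (c + t *\<^sub>R (x - c))) has_derivative blinfun_apply (D x t))
        (at x within ball c r)"
      by (rule has_derivative_at_withinI)
  next
    fix x assume "x \<in> ball c r"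
    then have "continuous_on (cbox 0 1) (\<lambda>t. t ^ m * f (c + t *\<^sub>R (x - c)))"
      using continuous_on_ray_fixed[OF cont_f] by (auto intro!: continuous_intros)
    then show "(\<lambda>t. t ^ m * f (c + t *\<^sub>R (x - c))) integrable_on cbox 0 1"
      by (rule integrable_continuous)
  qed
  moreover have "blinfun_apply (integral (cbox 0 1) (D x0)) v
      = ray_average c (Suc m) (\<lambda>x. frechet_derivative f (at x) v) x0" for v
  proof -
    have "continuous_on (cbox 0 1) (D x0)"
    proof -
      have "continuous_on (cbox 0 1) (\<lambda>t. (\<lambda>(x, t). D x t) (x0, t))"
        by (rule continuous_on_compose2[OF cont]) (use x0 in \<open>auto intro!: continuous_intros\<close>)
      then show ?thesis by simp
    qed
    then have "D x0 integrable_on cbox 0 1" by (rule integrable_continuous)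
    then have "blinfun_apply (integral (cbox 0 1) (D x0)) v
        = integral (cbox 0 1) (\<lambda>t. blinfun_apply (D x0 t) v)"
      by (rule blinfun_apply_integral)
    also have "\<dots> = ray_average c (Suc m) (\<lambda>x. frechet_derivative f (at x) v) x0"
      unfolding ray_average_def by (intro integral_cong[unfolded cbox_interval] | simp only: cbox_interval)+
         (simp add: D_apply[OF x0])
    finally show ?thesis .
  qed
  then have "blinfun_apply (integral (cbox 0 1) (D x0))
      = (\<lambda>v. ray_average c (Suc m) (\<lambda>x. frechet_derivative f (at x) v) x0)"
    by (rule ext)
  moreover have "ray_average c m f = (\<lambda>x. integral {0..1} (\<lambda>t. t ^ m * f (c + t *\<^sub>R (x - c))))"
    by (simp add: fun_eq_iff ray_average_def)
  ultimately show ?thesis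
    by (simp only: at_within_open[OF x0 open_ball] cbox_interval)
qed

lemma Ck_on_ray_average:
  "Ck_on k (ball c r) f \<Longrightarrow> Ck_on k (ball c r) (ray_average c m f)"
proof (induction k arbitrary: f m)
  case 0
  then show ?case by (simp add: continuous_on_ray_average)
next
  case (Suc k)
  have "Ck_on (Suc 0) (ball c r) f"
    using Suc.prems by (rule Ck_on_le) simp
  with Suc show ?case
    by (intro Ck_on_SucI[OF open_ball ray_average_has_derivative]) auto
qed

lemma hadamard:
  assumes f: "smooth_on (ball c r) f" and x: "x \<in> ball c r"
  shows "f x = f c + (\<Sum>i\<in>Basis. ((x - c) \<bullet> i) * ray_average c 0 (\<lambda>y. frechet_derivative f (at y) i) x)"
proof -
  define f' where "f' t = frechet_derivative f (at (c + t *\<^sub>R (x - c)))" for t :: real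
  have fder: "(f has_derivative f' t) (at (c + t *\<^sub>R (x - c)))" if "t \<in> {0..1}" for t
    unfolding f'_def using smooth_on_has_derivative[OF f ray_in_ball[OF x that]] .
  have "((\<lambda>t. f (c + t *\<^sub>R (x - c))) has_vector_derivative f' t (x - c)) (at t within {0..1})"
    if "t \<in> {0..1}" for t
  proof -
    have "((\<lambda>t. c + t *\<^sub>R (x - c)) has_derivative (\<lambda>h. h *\<^sub>R (x - c))) (at t)"
      by (auto intro!: derivative_eq_intros)
    from has_derivative_compose[OF this fder[OF that]]
    have "((\<lambda>t. f (c + t *\<^sub>R (x - c))) has_derivative (\<lambda>h. f' t (h *\<^sub>R (x - c)))) (at t)" .
    moreover have "f' t (h *\<^sub>R (x - c)) = h *\<^sub>R f' t (x - c)" for h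
      using linear_scale[OF has_derivative_linear[OF fder[OF that]]] .
    ultimately show ?thesis
      by (simp add: has_vector_derivative_def has_derivative_at_withinI)
  qed
  then have "((\<lambda>t. f' t (x - c)) has_integral f (c + 1 *\<^sub>R (x - c)) - f (c + 0 *\<^sub>R (x - c))) {0..1}"
    by (intro fundamental_theorem_of_calculus) auto
  then have int: "integral {0..1} (\<lambda>t. f' t (x - c)) = f x - f c"
    by (simp add: integral_unique)
  have rep: "f' t (x - c) = (\<Sum>i\<in>Basis. ((x - c) \<bullet> i) * f' t i)" if "t \<in> {0..1}" for t
    using has_derivative_linear[OF fder[OF that]]
    by (subst euclidean_representation[symmetric, of "x - c"]) (simp add: linear_sum linear_scale)
  have "(\<lambda>t. f' t i) integrable_on {0..1}" for i
  proof -
    have "continuous_on (ball c r) (\<lambda>y. frechet_derivative f (at y) i)"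
      using f by (intro smooth_on_continuous smooth_on_frechet_derivative)
    from continuous_on_ray_fixed[OF this x]
    show ?thesis unfolding f'_def by (rule integrable_continuous_interval)
  qed
  then have "integral {0..1} (\<lambda>t. f' t (x - c))
      = (\<Sum>i\<in>Basis. ((x - c) \<bullet> i) * integral {0..1} (\<lambda>t. f' t i))"
    by (subst integral_cong[OF rep]) (auto simp: integral_sum integrable_on_mult_right)
  then show ?thesis
    using int by (simp add: ray_average_def f'_def)
qed

lemma smooth_on_ray_average: "smooth_on (ball c r) f \<Longrightarrow> smooth_on (ball c r) (ray_average c m f)"
  unfolding smooth_on_def using Ck_on_ray_average by blast

text \<open>A weight \<open>t ^ m\<close> would divide the value by m + 1. Exponent 0 makes the
  coefficients in \<open>hadamard\<close> equal to the partial derivatives at the centre.\<close>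

lemma ray_average_center: "ray_average c 0 f c = f c"
  by (simp add: ray_average_def)

section \<open>Smooth functions and tangent vectors in an atlas\<close>

lemma sum_Basis_axis:
  fixes f :: "real^'n \<Rightarrow> 'b::comm_monoid_add"
  shows "(\<Sum>i\<in>Basis. f i) = (\<Sum>j\<in>UNIV. f (axis j 1))"
proof -
  have "(Basis :: (real^'n) set) = range (\<lambda>j. axis j 1)"
    by (auto simp: Basis_vec_def)
  moreover have "inj (\<lambda>j::'n. axis j (1::real))"
    by (auto intro!: injI simp: axis_eq_axis)
  ultimately show ?thesis by (metis (no_types, lifting) sum.reindex_cong)
qed

lemma smooth_fun_subset: "smooth_fun A U f \<Longrightarrow> W \<subseteq> U \<Longrightarrow> smooth_fun A W f"
  unfolding smooth_fun_def by (fast intro: smooth_on_subset)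

locale atlas3 =
  fixes A :: "'a::topological_space chart set"
  assumes atlas: "oriented_atlas A"
begin

lemma chart_cover: "\<exists>V \<phi>. (V, \<phi>) \<in> A \<and> p \<in> V"
proof -
  have "p \<in> \<Union>(fst ` A)"
    using atlas by (simp add: oriented_atlas_def)
  then show ?thesis by auto
qed

lemma chart_homeomorphism:
  "(V, \<phi>) \<in> A \<Longrightarrow> homeomorphism V (\<phi> ` V) \<phi> (the_inv_into V \<phi>)"
  using atlas unfolding oriented_atlas_def by auto

lemma chart_open: "(V, \<phi>) \<in> A \<Longrightarrow> open V"
  using atlas unfolding oriented_atlas_def by auto

lemma chart_inverse: "(V, \<phi>) \<in> A \<Longrightarrow> q \<in> V \<Longrightarrow> the_inv_into V \<phi> (\<phi> q) = q"
  using chart_homeomorphism by (rule homeomorphism_apply1)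

lemma chart_open_image:
  assumes "(V, \<phi>) \<in> A" "open U"
  shows "open (\<phi> ` (U \<inter> V))"
proof -
  have "openin (top_of_set V) (U \<inter> V)"
    using assms(2) by (metis Int_commute openin_open_Int)
  from homeomorphism_imp_open_map[OF chart_homeomorphism[OF assms(1)] this]
  have "openin (top_of_set (\<phi> ` V)) (\<phi> ` (U \<inter> V))" .
  moreover have "open (\<phi> ` V)"
    using atlas assms(1) unfolding oriented_atlas_def by auto
  ultimately show ?thesis by (metis openin_open_eq)
qed

lemma transition_smooth:
  assumes "(V, \<phi>) \<in> A" "(W, \<theta>) \<in> A"
  shows "smooth_on (\<theta> ` (W \<inter> V)) (\<phi> \<circ> the_inv_into W \<theta>)"
  using atlas assms unfolding oriented_atlas_def by blast

lemma smooth_funI: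
  assumes "\<And>W \<theta>. (W, \<theta>) \<in> A \<Longrightarrow> smooth_on (\<theta> ` (U \<inter> W)) (f \<circ> the_inv_into W \<theta>)"
  shows "smooth_fun A U f"
  using assms unfolding smooth_fun_def by auto

lemma smooth_funD:
  "smooth_fun A U f \<Longrightarrow> (W, \<theta>) \<in> A \<Longrightarrow> smooth_on (\<theta> ` (U \<inter> W)) (f \<circ> the_inv_into W \<theta>)"
  unfolding smooth_fun_def by auto

lemma smooth_fun_cong:
  assumes "open U" "\<And>q. q \<in> U \<Longrightarrow> f q = g q"
  shows "smooth_fun A U f \<longleftrightarrow> smooth_fun A U g"
proof -
  have "smooth_on (\<theta> ` (U \<inter> W)) (f \<circ> the_inv_into W \<theta>) \<longleftrightarrow>
      smooth_on (\<theta> ` (U \<inter> W)) (g \<circ> the_inv_into W \<theta>)" if "(W, \<theta>) \<in> A" for W \<theta>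
    using assms that by (intro smooth_on_cong chart_open_image) (auto simp: chart_inverse)
  then show ?thesis unfolding smooth_fun_def by auto
qed

lemma smooth_fun_const: "open U \<Longrightarrow> smooth_fun A U (\<lambda>q. c)"
  by (rule smooth_funI) (auto simp: smooth_on_def o_def intro!: Ck_on_const chart_open_image)

lemma smooth_fun_add:
  "open U \<Longrightarrow> smooth_fun A U f \<Longrightarrow> smooth_fun A U g \<Longrightarrow> smooth_fun A U (\<lambda>q. f q + g q)"
  by (rule smooth_funI)
    (auto simp: smooth_on_def o_def intro!: Ck_on_add chart_open_image dest!: smooth_funD)

lemma smooth_fun_mult:
  "open U \<Longrightarrow> smooth_fun A U f \<Longrightarrow> smooth_fun A U g \<Longrightarrow> smooth_fun A U (\<lambda>q. f q * g q)"
  by (rule smooth_funI)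
    (auto simp: smooth_on_def o_def intro!: Ck_on_mult chart_open_image dest!: smooth_funD)

lemma smooth_fun_minus: "open U \<Longrightarrow> smooth_fun A U f \<Longrightarrow> smooth_fun A U (\<lambda>q. - f q)"
  using smooth_fun_mult[OF _ smooth_fun_const, of U f "-1"] by simp

lemma smooth_fun_diff:
  "open U \<Longrightarrow> smooth_fun A U f \<Longrightarrow> smooth_fun A U g \<Longrightarrow> smooth_fun A U (\<lambda>q. f q - g q)"
  using smooth_fun_add[OF _ _ smooth_fun_minus, of U f g] by simp

lemma smooth_fun_sum:
  "open U \<Longrightarrow> (\<And>i. i \<in> I \<Longrightarrow> smooth_fun A U (f i)) \<Longrightarrow> smooth_fun A U (\<lambda>q. \<Sum>i\<in>I. f i q)"
  by (induction I rule: infinite_finite_induct) (auto intro!: smooth_fun_const smooth_fun_add)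

lemmas smooth_fun_intros =
  smooth_fun_const smooth_fun_add smooth_fun_mult smooth_fun_minus smooth_fun_diff smooth_fun_sum

text \<open>Seen in any other chart, the function is \<open>G\<close> after a transition map. This
  makes coordinates and Hadamard coefficients, which live in one chart, smooth in the sense of the
  whole atlas.\<close>

lemma smooth_fun_pullback:
  assumes "(V, \<phi>) \<in> A" "open U" "U \<subseteq> V" "smooth_on S G" "open S" "\<phi> ` U \<subseteq> S"
  shows "smooth_fun A U (\<lambda>q. G (\<phi> q))"
proof (rule smooth_funI)
  fix W \<theta> assume W: "(W, \<theta>) \<in> A"
  have "smooth_on (\<theta> ` (U \<inter> W)) (\<phi> \<circ> the_inv_into W \<theta>)"
    by (rule smooth_on_subset[OF transition_smooth[OF assms(1) W]]) (use assms(3) in auto)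
  moreover have "(\<phi> \<circ> the_inv_into W \<theta>) ` (\<theta> ` (U \<inter> W)) \<subseteq> S"
    using assms(6) W by (auto simp: chart_inverse)
  ultimately have "smooth_on (\<theta> ` (U \<inter> W)) (\<lambda>y. G ((\<phi> \<circ> the_inv_into W \<theta>) y))"
    using assms(4) unfolding smooth_on_def
    by (blast intro: Ck_on_compose[OF chart_open_image[OF W assms(2)] assms(5)])
  then show "smooth_on (\<theta> ` (U \<inter> W)) ((\<lambda>q. G (\<phi> q)) \<circ> the_inv_into W \<theta>)"
    by (simp add: o_def)
qed

lemma smooth_fun_coordinate:
  assumes "(V, \<phi>) \<in> A" "open U" "U \<subseteq> V"
  shows "smooth_fun A U (\<lambda>q. \<phi> q $ j)"
proof (rule smooth_fun_pullback[OF assms])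
  show "smooth_on UNIV (\<lambda>x::real^3. x $ j)"
    unfolding smooth_on_def by (auto intro!: Ck_on_bounded_linear bounded_linear_vec_nth)
qed auto

lemma smooth_nearI: "open U \<Longrightarrow> p \<in> U \<Longrightarrow> smooth_fun A U f \<Longrightarrow> smooth_near A p f"
  unfolding smooth_near_def by blast

lemma smooth_near_cong:
  assumes "smooth_near A p f" "open W" "p \<in> W" "\<And>q. q \<in> W \<Longrightarrow> f q = g q"
  shows "smooth_near A p g"
proof -
  obtain U where "open U" "p \<in> U" "smooth_fun A U f"
    using assms(1) unfolding smooth_near_def by blast
  then have "smooth_fun A (U \<inter> W) f" using smooth_fun_subset by blast
  then have "smooth_fun A (U \<inter> W) g"
    using smooth_fun_cong[of "U \<inter> W" f g] assms(2,4) \<open>open U\<close> by auto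
  then show ?thesis
    using assms(2,3) \<open>open U\<close> \<open>p \<in> U\<close> by (auto intro!: smooth_nearI[of "U \<inter> W"])
qed

lemma smooth_near_binary:
  assumes "smooth_near A p f" "smooth_near A p g"
    and "\<And>U. open U \<Longrightarrow> smooth_fun A U f \<Longrightarrow> smooth_fun A U g \<Longrightarrow> smooth_fun A U h"
  shows "smooth_near A p h"
proof -
  obtain U W where "open U" "p \<in> U" "smooth_fun A U f" "open W" "p \<in> W" "smooth_fun A W g"
    using assms(1,2) unfolding smooth_near_def by blast
  then show ?thesis
    by (intro smooth_nearI[of "U \<inter> W"] assms(3) smooth_fun_subset[of _ _ _ "U \<inter> W"]) auto
qed

lemma smooth_near_const: "smooth_near A p (\<lambda>q. c)"
  by (rule smooth_nearI[OF open_UNIV]) (auto intro: smooth_fun_const)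

lemma smooth_near_add:
  "smooth_near A p f \<Longrightarrow> smooth_near A p g \<Longrightarrow> smooth_near A p (\<lambda>q. f q + g q)"
  by (erule (1) smooth_near_binary) (rule smooth_fun_add)

lemma smooth_near_mult:
  "smooth_near A p f \<Longrightarrow> smooth_near A p g \<Longrightarrow> smooth_near A p (\<lambda>q. f q * g q)"
  by (erule (1) smooth_near_binary) (rule smooth_fun_mult)

lemma smooth_near_minus: "smooth_near A p f \<Longrightarrow> smooth_near A p (\<lambda>q. - f q)"
  using smooth_near_mult[OF smooth_near_const, of p f "-1"] by simp

lemma smooth_near_diff:
  "smooth_near A p f \<Longrightarrow> smooth_near A p g \<Longrightarrow> smooth_near A p (\<lambda>q. f q - g q)"
  by (erule (1) smooth_near_binary) (rule smooth_fun_diff)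

lemma smooth_near_sum:
  "(\<And>i. i \<in> I \<Longrightarrow> smooth_near A p (f i)) \<Longrightarrow> smooth_near A p (\<lambda>q. \<Sum>i\<in>I. f i q)"
  by (induction I rule: infinite_finite_induct) (auto intro!: smooth_near_const smooth_near_add)

lemmas smooth_near_intros = smooth_near_const smooth_near_add smooth_near_mult smooth_near_minus
  smooth_near_diff smooth_near_sum

section \<open>Tangent vectors as derivations: locality, chart coordinates, spanning\<close>

lemma act_add:
  "v \<in> tangent_space A p \<Longrightarrow> smooth_near A p f \<Longrightarrow> smooth_near A p g \<Longrightarrow>
    act v (\<lambda>q. f q + g q) = act v f + act v g"
  unfolding tangent_space_def by blast

lemma act_mult:
  "v \<in> tangent_space A p \<Longrightarrow> smooth_near A p f \<Longrightarrow> smooth_near A p g \<Longrightarrow>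
    act v (\<lambda>q. f q * g q) = f p * act v g + g p * act v f"
  unfolding tangent_space_def by blast

lemma act_scale:
  "v \<in> tangent_space A p \<Longrightarrow> smooth_near A p f \<Longrightarrow> act v (\<lambda>q. r * f q) = r * act v f"
  unfolding tangent_space_def by blast

lemma act_const: 
  assumes v: "v \<in> tangent_space A p"
  shows "act v (\<lambda>q. c) = 0"
proof -
  have "act v (\<lambda>q. 1 * 1) = 1 * act v (\<lambda>q. 1) + 1 * act v (\<lambda>q. 1)"
    using act_mult[OF v smooth_near_const smooth_near_const, of 1 1] by simp
  then have "act v (\<lambda>q. 1) = 0" by simp
  then show ?thesis
    using act_scale[OF v smooth_near_const, of c 1] by simp
qed

lemma act_minus:
  "v \<in> tangent_space A p \<Longrightarrow> smooth_near A p f \<Longrightarrow> act v (\<lambda>q. - f q) = - act v f"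
  using act_scale[of v p f "-1"] by simp

lemma act_diff:
  "v \<in> tangent_space A p \<Longrightarrow> smooth_near A p f \<Longrightarrow> smooth_near A p g \<Longrightarrow>
    act v (\<lambda>q. f q - g q) = act v f - act v g"
  using act_add[of v p f "\<lambda>q. - g q"] by (simp add: act_minus smooth_near_minus)

lemma act_sum:
  assumes "v \<in> tangent_space A p" "\<And>i. i \<in> I \<Longrightarrow> smooth_near A p (f i)"
  shows "act v (\<lambda>q. \<Sum>i\<in>I. f i q) = (\<Sum>i\<in>I. act v (f i))"
  using assms(2)
proof (induction I rule: infinite_finite_induct)
  case (insert i I)
  then have "act v (\<lambda>q. f i q + (\<Sum>i\<in>I. f i q)) = act v (f i) + act v (\<lambda>q. \<Sum>i\<in>I. f i q)"
    by (intro act_add[OF assms(1)] smooth_near_sum) auto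
  with insert show ?case by simp
qed (simp_all add: act_const[OF assms(1)])

text \<open>Derivations are local because an idempotent that is 1 at the point has derivative 0:
  Leibniz for \<open>e * e = e\<close> gives \<open>act v e = 2 * act v e\<close>, and multiplying
  by \<open>e\<close> then identifies the two functions.\<close>

lemma act_cong:
  assumes v: "v \<in> tangent_space A p" and f: "smooth_near A p f"
    and W: "open W" "p \<in> W" "\<And>q. q \<in> W \<Longrightarrow> f q = g q"
  shows "act v f = act v g"
proof -
  \<comment> \<open>The plain indicator serves as a bump function, since smoothness is demanded only
    near \<open>p\<close>, where it is constant.\<close>
  define e :: "'a \<Rightarrow> real" where "e q = (if q \<in> W then 1 else 0)" for q
  have e: "smooth_near A p e"
    by (rule smooth_near_cong[OF smooth_near_const W(1,2), of 1]) (simp add: e_def)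
  have g: "smooth_near A p g" using f W by (rule smooth_near_cong)
  have "(\<lambda>q. e q * e q) = e" by (auto simp: e_def)
  with act_mult[OF v e e] W(2) have "act v e = 0" by (simp add: e_def)
  moreover have "(\<lambda>q. e q * f q) = (\<lambda>q. e q * g q)"
    using W(3) by (auto simp: e_def)
  ultimately show ?thesis
    using act_mult[OF v e f] act_mult[OF v e g] W(2) by (simp add: e_def)
qed

lemma tangent_zero: "0 \<in> tangent_space A p"
  unfolding tangent_space_def by (simp add: zero_tvec.rep_eq)

lemma tangent_add:
  "v \<in> tangent_space A p \<Longrightarrow> w \<in> tangent_space A p \<Longrightarrow> v + w \<in> tangent_space A p"
  unfolding tangent_space_def by (auto simp: plus_tvec.rep_eq algebra_simps)

lemma tangent_scaleR: "v \<in> tangent_space A p \<Longrightarrow> r *\<^sub>R v \<in> tangent_space A p"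
  unfolding tangent_space_def by (auto simp: scaleR_tvec.rep_eq algebra_simps)

lemma tangent_minus: "v \<in> tangent_space A p \<Longrightarrow> - v \<in> tangent_space A p"
  using tangent_scaleR[of v p "-1"] by simp

lemma tangent_diff:
  "v \<in> tangent_space A p \<Longrightarrow> w \<in> tangent_space A p \<Longrightarrow> v - w \<in> tangent_space A p"
  using tangent_add[OF _ tangent_minus, of v p w] by simp

lemma tangent_sum:
  "(\<And>i. i \<in> I \<Longrightarrow> f i \<in> tangent_space A p) \<Longrightarrow> (\<Sum>i\<in>I. f i) \<in> tangent_space A p"
  by (induction I rule: infinite_finite_induct) (auto intro: tangent_zero tangent_add)

lemmas tangent_intros =
  tangent_zero tangent_add tangent_scaleR tangent_minus tangent_diff tangent_sum

text \<open>Hadamard's lemma writes \<open>f\<close> near \<open>p\<close> as a constant plus a sum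
  of products of \<open>\<phi> q $ j - \<phi> p $ j\<close> with smooth functions. The first factors
  vanish at \<open>p\<close>, so Leibniz leaves the values of the second ones there, the partial
  derivatives.\<close>

lemma act_chart:
  assumes v: "v \<in> tangent_space A p" and chart: "(V, \<phi>) \<in> A" "p \<in> V" and f: "smooth_near A p f"
  shows "act v f = (\<Sum>j\<in>UNIV. act v (\<lambda>q. \<phi> q $ j) *
    frechet_derivative (f \<circ> the_inv_into V \<phi>) (at (\<phi> p)) (axis j 1))"
proof -
  obtain U where U: "open U" "p \<in> U" "smooth_fun A U f"
    using f unfolding smooth_near_def by blast
  define F where "F = f \<circ> the_inv_into V \<phi>"
  define g where "g j = ray_average (\<phi> p) 0 (\<lambda>y. frechet_derivative F (at y) (axis j 1))" for j
  obtain r where r: "r > 0" "ball (\<phi> p) r \<subseteq> \<phi> ` (U \<inter> V)"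
    using openE[OF chart_open_image[OF chart(1) U(1)]] U(2) chart(2) by blast
  have F: "smooth_on (ball (\<phi> p) r) F"
    unfolding F_def using smooth_on_subset[OF smooth_funD[OF U(3) chart(1)] r(2)] .
  define W where "W = V \<inter> \<phi> -` ball (\<phi> p) r"
  have "continuous_on V \<phi>"
    using chart_homeomorphism[OF chart(1)] by (simp add: homeomorphism_def)
  then have "open W"
    unfolding W_def by (rule continuous_open_preimage[OF _ chart_open[OF chart(1)] open_ball])
  have W: "p \<in> W" "W \<subseteq> V" "\<phi> ` W \<subseteq> ball (\<phi> p) r"
    using chart(2) r(1) by (auto simp: W_def)
  have g: "smooth_fun A W (\<lambda>q. g j (\<phi> q))" for j
    unfolding g_def
    by (rule smooth_fun_pullback[OF chart(1) \<open>open W\<close> W(2) _ open_ball W(3)])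
      (intro smooth_on_ray_average smooth_on_frechet_derivative F)
  have near: "smooth_near A p (\<lambda>q. \<phi> q $ j)" "smooth_near A p (\<lambda>q. g j (\<phi> q))" for j
    using smooth_nearI[OF \<open>open W\<close> W(1)] smooth_fun_coordinate[OF chart(1) \<open>open W\<close> W(2)] g by auto
  have "f q = F (\<phi> p) + (\<Sum>j\<in>UNIV. (\<phi> q $ j - \<phi> p $ j) * g j (\<phi> q))" if "q \<in> W" for q
  proof -
    have "f q = F (\<phi> q)" using that W(2) chart(1) by (auto simp: F_def chart_inverse)
    also have "\<dots> = F (\<phi> p) + (\<Sum>j\<in>UNIV. (\<phi> q $ j - \<phi> p $ j) * g j (\<phi> q))"
      using hadamard[OF F, of "\<phi> q"] W(3) that
      by (auto simp: sum_Basis_axis g_def cart_eq_inner_axis[symmetric])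
    finally show ?thesis .
  qed
  then have "act v f = act v (\<lambda>q. F (\<phi> p) + (\<Sum>j\<in>UNIV. (\<phi> q $ j - \<phi> p $ j) * g j (\<phi> q)))"
    by (rule act_cong[OF v f \<open>open W\<close> W(1)])
  also have "\<dots> = (\<Sum>j\<in>UNIV. g j (\<phi> p) * act v (\<lambda>q. \<phi> q $ j))"
    by (simp add: act_add[OF v] act_sum[OF v] act_mult[OF v] act_diff[OF v] act_const[OF v]
        smooth_near_intros near)
  finally show ?thesis
    by (simp add: g_def ray_average_center F_def mult.commute)
qed

lemma tangent_eqI:
  assumes v: "v \<in> tangent_space A p" and w: "w \<in> tangent_space A p"
    and chart: "(V, \<phi>) \<in> A" "p \<in> V"
    and eq: "\<And>j. act v (\<lambda>q. \<phi> q $ j) = act w (\<lambda>q. \<phi> q $ j)"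
  shows "v = w"
proof -
  have "act v f = act w f" for f
  proof (cases "smooth_near A p f")
    case True
    then show ?thesis
      using act_chart[OF v chart True] act_chart[OF w chart True] eq by simp
  next
    case False
    then show ?thesis using v w unfolding tangent_space_def by auto
  qed
  then show ?thesis by (simp add: act_inject[symmetric] fun_eq_iff)
qed

definition chart_matrix :: "('a \<Rightarrow> real^3) \<Rightarrow> 'a tvec^3 \<Rightarrow> real^3^3" where
  "chart_matrix \<phi> e = (\<chi> i j. act (e $ i) (\<lambda>q. \<phi> q $ j))"

lemma act_tvec_sum: "act (\<Sum>i\<in>I. v i) f = (\<Sum>i\<in>I. act (v i) f)"
  by (induction I rule: infinite_finite_induct) (auto simp: zero_tvec.rep_eq plus_tvec.rep_eq)

text \<open>By \<open>act_chart\<close> a tangent vector is its triple of chart components, so the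
  coefficients solve a linear system with the transposed chart matrix. This is where the tangent
  space is seen to have dimension at most three.\<close>

lemma tangent_span:
  assumes v: "v \<in> tangent_space A p" and chart: "(V, \<phi>) \<in> A" "p \<in> V"
    and e: "\<And>i. e $ i \<in> tangent_space A p" "det (chart_matrix \<phi> e) \<noteq> 0"
  shows "\<exists>c. v = (\<Sum>i\<in>UNIV. c $ i *\<^sub>R e $ i)"
proof -
  define d :: "real^3" where "d = (\<chi> j. act v (\<lambda>q. \<phi> q $ j))"
  have "invertible (transpose (chart_matrix \<phi> e))"
    using e(2) by (simp add: invertible_det_nz det_transpose)
  then obtain B where "transpose (chart_matrix \<phi> e) ** B = mat 1"
    unfolding invertible_def by blast
  then have "transpose (chart_matrix \<phi> e) *v (B *v d) = d"
    by (simp add: matrix_vector_mul_assoc)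
  then have "(\<Sum>i\<in>UNIV. (B *v d) $ i * act (e $ i) (\<lambda>q. \<phi> q $ j)) = act v (\<lambda>q. \<phi> q $ j)" for j
    by (simp add: vec_eq_iff d_def matrix_vector_mult_def transpose_def chart_matrix_def mult.commute)
  then have "v = (\<Sum>i\<in>UNIV. (B *v d) $ i *\<^sub>R e $ i)"
    using e(1) by (intro tangent_eqI[OF v _ chart])
      (auto intro!: tangent_intros simp: act_tvec_sum scaleR_tvec.rep_eq)
  then show ?thesis by blast
qed

text \<open>A frame with invertible chart matrix that annihilates \<open>f\<close> forces all
  partial derivatives to vanish; convexity of a coordinate ball does the rest. It will be applied to
  the squared length of the spinor.\<close>

lemma locally_constant:
  assumes U: "open U" "p \<in> U" "smooth_fun A U f"
    and frame: "\<And>q V \<phi>. q \<in> U \<Longrightarrow> (V, \<phi>) \<in> A \<Longrightarrow> q \<in> V \<Longrightarrow>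
      \<exists>e. (\<forall>i. e $ i \<in> tangent_space A q \<and> act (e $ i) f = 0) \<and> det (chart_matrix \<phi> e) \<noteq> 0"
  shows "\<exists>W. open W \<and> p \<in> W \<and> W \<subseteq> U \<and> (\<forall>q\<in>W. f q = f p)"
proof -
  obtain V \<phi> where chart: "(V, \<phi>) \<in> A" "p \<in> V"
    using chart_cover by blast
  define F where "F = f \<circ> the_inv_into V \<phi>"
  obtain r where r: "r > 0" "ball (\<phi> p) r \<subseteq> \<phi> ` (U \<inter> V)"
    using openE[OF chart_open_image[OF chart(1) U(1)]] U(2) chart(2) by blast
  have F: "smooth_on (ball (\<phi> p) r) F"
    unfolding F_def using smooth_on_subset[OF smooth_funD[OF U(3) chart(1)] r(2)] .
  have zero: "(F has_derivative (\<lambda>h. 0)) (at x)" if x: "x \<in> ball (\<phi> p) r" for x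
  proof -
    obtain q where q: "q \<in> U" "q \<in> V" "x = \<phi> q" using r(2) x by blast
    obtain e where e: "\<And>i. e $ i \<in> tangent_space A q" "\<And>i. act (e $ i) f = 0"
      "det (chart_matrix \<phi> e) \<noteq> 0"
      using frame[OF q(1) chart(1) q(2)] by blast
    define D :: "real^3" where "D = (\<chi> j. frechet_derivative F (at x) (axis j 1))"
    have "chart_matrix \<phi> e *v D = 0"
      using act_chart[OF e(1) chart(1) q(2) smooth_nearI[OF U(1) q(1) U(3)]] e(2)
      by (simp add: vec_eq_iff matrix_vector_mult_def chart_matrix_def D_def F_def q(3))
    moreover obtain B where "B ** chart_matrix \<phi> e = mat 1"
      using e(3) invertible_det_nz unfolding invertible_def by blast
    ultimately have "D = 0"
      by (metis matrix_vector_mul_assoc matrix_vector_mul_lid matrix_vector_mult_0_right)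
    then have "frechet_derivative F (at x) (axis j 1) = 0" for j
      by (auto simp: D_def vec_eq_iff)
    moreover have lin: "linear (frechet_derivative F (at x))"
      using smooth_on_has_derivative[OF F x] by (rule has_derivative_linear)
    ultimately have "frechet_derivative F (at x) h = 0" for h
      by (subst euclidean_representation[symmetric])
        (simp add: linear_sum linear_scale sum_Basis_axis)
    then have "frechet_derivative F (at x) = (\<lambda>h. 0)" by auto
    with smooth_on_has_derivative[OF F x] show ?thesis by simp
  qed
  have const: "F x = F (\<phi> p)" if "x \<in> ball (\<phi> p) r" for x
    using has_derivative_zero_unique[OF convex_ball, of "\<phi> p" r F "\<phi> p" x] zero that r(1)
    by (simp add: has_derivative_at_withinI)
  define W where "W = (U \<inter> V) \<inter> \<phi> -` ball (\<phi> p) r"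
  have "continuous_on (U \<inter> V) \<phi>"
    using chart_homeomorphism[OF chart(1)] by (auto simp: homeomorphism_def intro: continuous_on_subset)
  then have "open W"
    unfolding W_def using chart_open[OF chart(1)] U(1) by (intro continuous_open_preimage) auto
  moreover have "f q = f p" if "q \<in> W" for q
    using const[of "\<phi> q"] that chart by (auto simp: W_def F_def chart_inverse)
  moreover have "p \<in> W" "W \<subseteq> U"
    using U(2) chart(2) r(1) by (auto simp: W_def)
  ultimately show ?thesis by blast
qed

section \<open>Smooth vector fields and brackets\<close>

lemma vfield_tangent: "X \<in> vector_fields A U \<Longrightarrow> p \<in> U \<Longrightarrow> X p \<in> tangent_space A p"
  unfolding vector_fields_def by blast

lemma vfield_act:
  "X \<in> vector_fields A U \<Longrightarrow> open V \<Longrightarrow> V \<subseteq> U \<Longrightarrow> smooth_fun A V f \<Longrightarrow>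
    smooth_fun A V (\<lambda>p. act (X p) f)"
  unfolding vector_fields_def by blast

lemma vfieldI:
  assumes "\<And>p. p \<in> U \<Longrightarrow> X p \<in> tangent_space A p"
    and "\<And>V f. open V \<Longrightarrow> V \<subseteq> U \<Longrightarrow> smooth_fun A V f \<Longrightarrow> smooth_fun A V (\<lambda>p. act (X p) f)"
  shows "X \<in> vector_fields A U"
  unfolding vector_fields_def using assms by simp

lemma vfield_subset: "X \<in> vector_fields A U \<Longrightarrow> W \<subseteq> U \<Longrightarrow> X \<in> vector_fields A W"
  by (rule vfieldI) (simp_all add: vfield_tangent vfield_act subset_iff)

lemma vfield_cong:
  assumes "X \<in> vector_fields A U" "\<And>q. q \<in> U \<Longrightarrow> X q = Y q"
  shows "Y \<in> vector_fields A U"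
proof (rule vfieldI)
  fix V f assume V: "open V" "V \<subseteq> U" "smooth_fun A V f"
  have "act (X q) f = act (Y q) f" if "q \<in> V" for q
    using assms(2) V(2) that by force
  then have "smooth_fun A V (\<lambda>p. act (X p) f) \<longleftrightarrow> smooth_fun A V (\<lambda>p. act (Y p) f)"
    by (rule smooth_fun_cong[OF V(1)])
  with vfield_act[OF assms(1) V] show "smooth_fun A V (\<lambda>p. act (Y p) f)" by blast
qed (use assms vfield_tangent in force)

lemma vfield_zero: "(\<lambda>q. 0) \<in> vector_fields A U"
  by (rule vfieldI) (auto simp: zero_tvec.rep_eq intro!: tangent_intros smooth_fun_const)

lemma vfield_add:
  "X \<in> vector_fields A U \<Longrightarrow> Y \<in> vector_fields A U \<Longrightarrow> (\<lambda>q. X q + Y q) \<in> vector_fields A U"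
  by (rule vfieldI) (simp_all add: plus_tvec.rep_eq tangent_add vfield_tangent
      smooth_fun_add vfield_act)

lemma vfield_scale:
  "X \<in> vector_fields A U \<Longrightarrow> smooth_fun A U f \<Longrightarrow> (\<lambda>q. f q *\<^sub>R X q) \<in> vector_fields A U"
  by (rule vfieldI) (simp_all add: scaleR_tvec.rep_eq tangent_scaleR vfield_tangent
      smooth_fun_mult vfield_act smooth_fun_subset)

lemma vfield_sum:
  "(\<And>i. i \<in> I \<Longrightarrow> X i \<in> vector_fields A U) \<Longrightarrow> (\<lambda>q. \<Sum>i\<in>I. X i q) \<in> vector_fields A U"
  by (induction I rule: infinite_finite_induct) (auto intro: vfield_zero vfield_add)

lemma act_bracket:
  "smooth_near A p f \<Longrightarrow>
    act (lie_bracket A X Y p) f = act (X p) (\<lambda>q. act (Y q) f) - act (Y p) (\<lambda>q. act (X q) f)"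
  by (simp add: lie_bracket_def Tvec_inverse)

end

unbundle cross3_syntax

section \<open>Riemannian geometry in an orthonormal frame\<close>

definition coords :: "('a, 'm) riem3_scheme \<Rightarrow> ('a \<Rightarrow> 'a tvec^3) \<Rightarrow> 'a \<Rightarrow> 'a tvec \<Rightarrow> real^3" where
  "coords M E p v = (\<chi> k. rmetric M p v (E p $ k))"

lemma coords_nth: "coords M E p v $ k = rmetric M p v (E p $ k)"
  by (simp add: coords_def)

definition frame_vec :: "('a \<Rightarrow> 'a tvec^3) \<Rightarrow> 'a \<Rightarrow> real^3 \<Rightarrow> 'a tvec" where
  "frame_vec E p x = (\<Sum>k\<in>UNIV. x $ k *\<^sub>R E p $ k)"

text \<open>The connection form with values in \<open>so(3)\<close>, identified with \<open>\<real>\<^sup>3\<close> by the cross product: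
  \<open>\<nabla>\<^sub>v E\<^sub>k = conn v \<times> E\<^sub>k\<close>.\<close>

definition conn :: "('a, 'm) riem3_scheme \<Rightarrow> ('a \<Rightarrow> 'a tvec^3) \<Rightarrow> 'a \<Rightarrow> 'a tvec \<Rightarrow> real^3" where
  "conn M E p v = vector [rmetric M p (nabla M p v (\<lambda>q. E q $ 2)) (E p $ 3),
     rmetric M p (nabla M p v (\<lambda>q. E q $ 3)) (E p $ 1),
     rmetric M p (nabla M p v (\<lambda>q. E q $ 1)) (E p $ 2)]"

definition vact :: "'a tvec \<Rightarrow> ('a \<Rightarrow> real^3) \<Rightarrow> real^3" where
  "vact v f = (\<chi> k. act v (\<lambda>q. f q $ k))"

definition (in atlas3) vsmooth_near :: "'a \<Rightarrow> ('a \<Rightarrow> real^3) \<Rightarrow> bool" where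
  "vsmooth_near p f \<longleftrightarrow> (\<forall>k. smooth_near A p (\<lambda>q. f q $ k))"

context atlas3
begin

lemma vsmooth_near_add: "vsmooth_near p f \<Longrightarrow> vsmooth_near p g \<Longrightarrow> vsmooth_near p (\<lambda>q. f q + g q)"
  by (simp add: vsmooth_near_def smooth_near_add)

lemma vsmooth_near_diff: "vsmooth_near p f \<Longrightarrow> vsmooth_near p g \<Longrightarrow> vsmooth_near p (\<lambda>q. f q - g q)"
  by (simp add: vsmooth_near_def smooth_near_diff)

lemma vsmooth_near_scale:
  "smooth_near A p r \<Longrightarrow> vsmooth_near p f \<Longrightarrow> vsmooth_near p (\<lambda>q. r q *\<^sub>R f q)"
  by (simp add: vsmooth_near_def smooth_near_mult)

lemma vsmooth_near_cross:
  "vsmooth_near p f \<Longrightarrow> vsmooth_near p g \<Longrightarrow> vsmooth_near p (\<lambda>q. f q \<times> g q)"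
  by (simp add: vsmooth_near_def forall_3 cross_components smooth_near_mult smooth_near_diff)

lemma smooth_near_inner:
  "vsmooth_near p f \<Longrightarrow> vsmooth_near p g \<Longrightarrow> smooth_near A p (\<lambda>q. f q \<bullet> g q)"
  by (simp add: vsmooth_near_def inner_vec_def smooth_near_mult smooth_near_sum)

lemma vsmooth_near_const: "vsmooth_near p (\<lambda>q. c)"
  by (simp add: vsmooth_near_def smooth_near_const)

lemmas vsmooth_near_intros = vsmooth_near_add vsmooth_near_diff vsmooth_near_scale
  vsmooth_near_cross smooth_near_inner vsmooth_near_const

lemma vact_cong:
  assumes "v \<in> tangent_space A p" "vsmooth_near p f" "open W" "p \<in> W" "\<And>q. q \<in> W \<Longrightarrow> f q = g q"
  shows "vact v f = vact v g"
  using assms unfolding vact_def vec_eq_iff vsmooth_near_def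
  by (auto intro!: act_cong[OF assms(1) _ assms(3,4)])

lemma vact_add:
  "v \<in> tangent_space A p \<Longrightarrow> vsmooth_near p f \<Longrightarrow> vsmooth_near p g \<Longrightarrow>
    vact v (\<lambda>q. f q + g q) = vact v f + vact v g"
  by (simp add: vact_def vec_eq_iff vsmooth_near_def act_add)

lemma vact_diff:
  "v \<in> tangent_space A p \<Longrightarrow> vsmooth_near p f \<Longrightarrow> vsmooth_near p g \<Longrightarrow>
    vact v (\<lambda>q. f q - g q) = vact v f - vact v g"
  by (simp add: vact_def vec_eq_iff vsmooth_near_def act_diff)

lemma vact_scale:
  "v \<in> tangent_space A p \<Longrightarrow> smooth_near A p r \<Longrightarrow> vsmooth_near p f \<Longrightarrow>
    vact v (\<lambda>q. r q *\<^sub>R f q) = act v r *\<^sub>R f p + r p *\<^sub>R vact v f"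
  by (simp add: vact_def vec_eq_iff vsmooth_near_def act_mult)

lemma vact_cross:
  "v \<in> tangent_space A p \<Longrightarrow> vsmooth_near p f \<Longrightarrow> vsmooth_near p g \<Longrightarrow>
    vact v (\<lambda>q. f q \<times> g q) = vact v f \<times> g p + f p \<times> vact v g"
  by (simp add: vact_def vec_eq_iff vsmooth_near_def forall_3 cross_components
      act_diff act_mult smooth_near_mult algebra_simps)

lemma act_inner:
  "v \<in> tangent_space A p \<Longrightarrow> vsmooth_near p f \<Longrightarrow> vsmooth_near p g \<Longrightarrow>
    act v (\<lambda>q. f q \<bullet> g q) = vact v f \<bullet> g p + f p \<bullet> vact v g"
  by (simp add: vact_def inner_vec_def vsmooth_near_def act_sum act_mult smooth_near_mult
      sum.distrib algebra_simps)

lemma vact_tvec_add: "vact (v + w) f = vact v f + vact w f"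
  by (simp add: vact_def vec_eq_iff plus_tvec.rep_eq)

lemma vact_tvec_scaleR: "vact (r *\<^sub>R v) f = r *\<^sub>R vact v f"
  by (simp add: vact_def vec_eq_iff scaleR_tvec.rep_eq)

lemma vact_bracket:
  "vsmooth_near p f \<Longrightarrow> vact (lie_bracket A X Y p) f
    = vact (X p) (\<lambda>q. vact (Y q) f) - vact (Y p) (\<lambda>q. vact (X q) f)"
  by (simp add: vact_def vec_eq_iff vsmooth_near_def act_bracket)

lemma smooth_near_act_field:
  assumes "X \<in> vector_fields A W" "open W" "p \<in> W" "smooth_near A p f"
  shows "smooth_near A p (\<lambda>q. act (X q) f)"
proof -
  obtain U where U: "open U" "p \<in> U" "smooth_fun A U f"
    using assms(4) unfolding smooth_near_def by blast
  have "smooth_fun A (U \<inter> W) (\<lambda>q. act (X q) f)"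
    using U assms by (intro vfield_act[OF assms(1)] smooth_fun_subset[OF U(3)]) auto
  then show ?thesis using U assms by (intro smooth_nearI[of "U \<inter> W"]) auto
qed

lemma vsmooth_near_vact_field:
  "X \<in> vector_fields A W \<Longrightarrow> open W \<Longrightarrow> p \<in> W \<Longrightarrow> vsmooth_near p f \<Longrightarrow>
    vsmooth_near p (\<lambda>q. vact (X q) f)"
  by (simp add: vsmooth_near_def vact_def smooth_near_act_field)

end

locale riem_frame =
  fixes M :: "('a::{t2_space,second_countable_topology}, 'm) riem3_scheme"
    and U :: "'a set" and E :: "'a \<Rightarrow> 'a tvec^3"
  assumes riem: "oriented_riemannian_3manifold M"
    and open_U: "open U"
    and E_field: "\<And>k. (\<lambda>p. E p $ k) \<in> vfields M U"
    and E_orthonormal: "\<And>p. p \<in> U \<Longrightarrow> orthonormal_frame M p (E p)"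
    and E_positive: "\<And>p. p \<in> U \<Longrightarrow> positive_frame M p (E p)"
begin

sublocale atlas3 "atlas M"
  using riem by unfold_locales (simp add: oriented_riemannian_3manifold_def)

lemma metric: "riemannian_metric M" and levi_civita: "levi_civita M"
  using riem by (simp_all add: oriented_riemannian_3manifold_def)

lemma g_add: "u \<in> tangent M p \<Longrightarrow> v \<in> tangent M p \<Longrightarrow> w \<in> tangent M p \<Longrightarrow>
    rmetric M p (u + v) w = rmetric M p u w + rmetric M p v w"
  and g_scaleR: "u \<in> tangent M p \<Longrightarrow> w \<in> tangent M p \<Longrightarrow>
    rmetric M p (r *\<^sub>R u) w = r * rmetric M p u w"
  and g_sym: "u \<in> tangent M p \<Longrightarrow> v \<in> tangent M p \<Longrightarrow> rmetric M p u v = rmetric M p v u"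
  using metric unfolding riemannian_metric_def by blast+

lemma g_smooth:
  "open W \<Longrightarrow> X \<in> vfields M W \<Longrightarrow> Y \<in> vfields M W \<Longrightarrow>
    smooth_fun (atlas M) W (\<lambda>p. rmetric M p (X p) (Y p))"
  using metric unfolding riemannian_metric_def by blast

lemma g_sum_left:
  assumes "\<And>i. i \<in> I \<Longrightarrow> f i \<in> tangent M p" "w \<in> tangent M p"
  shows "rmetric M p (\<Sum>i\<in>I. f i) w = (\<Sum>i\<in>I. rmetric M p (f i) w)"
proof -
  have "rmetric M p 0 w = 0"
    using g_scaleR[OF tangent_zero assms(2), of 0] by simp
  then show ?thesis
    using assms(1)
    by (induction I rule: infinite_finite_induct) (simp_all add: g_add assms(2) tangent_sum)
qed

lemma E_tangent: "p \<in> U \<Longrightarrow> E p $ k \<in> tangent M p"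
  using E_orthonormal unfolding orthonormal_frame_def by blast

lemma E_metric: "p \<in> U \<Longrightarrow> rmetric M p (E p $ i) (E p $ j) = (if i = j then 1 else 0)"
  using E_orthonormal unfolding orthonormal_frame_def by blast

lemma E_chart_det:
  "p \<in> U \<Longrightarrow> (V, \<phi>) \<in> atlas M \<Longrightarrow> p \<in> V \<Longrightarrow> det (chart_matrix \<phi> (E p)) > 0"
  using E_positive unfolding positive_frame_def chart_matrix_def by blast

lemma frame_vec_tangent: "p \<in> U \<Longrightarrow> frame_vec E p x \<in> tangent M p"
  unfolding frame_vec_def by (intro tangent_sum tangent_scaleR E_tangent)

lemma coords_frame_vec:
  assumes "p \<in> U"
  shows "coords M E p (frame_vec E p x) = x"
proof -
  have "rmetric M p (frame_vec E p x) (E p $ k) = x $ k" for k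
    unfolding frame_vec_def using assms
    by (subst g_sum_left) (simp_all add: tangent_scaleR E_tangent g_scaleR E_metric if_distrib cong: if_cong)
  then show ?thesis by (simp add: coords_def vec_eq_iff)
qed

text \<open>Orthonormality makes the coordinates unique; their existence comes from the chart
  determinant, which is non-zero for a positive frame.\<close>

lemma frame_vec_coords:
  assumes "p \<in> U" "v \<in> tangent M p"
  shows "frame_vec E p (coords M E p v) = v"
proof -
  obtain V \<phi> where chart: "(V, \<phi>) \<in> atlas M" "p \<in> V"
    using chart_cover by blast
  obtain c where "v = frame_vec E p c"
    using tangent_span[OF assms(2) chart E_tangent[OF assms(1)]] E_chart_det[OF assms(1) chart]
    unfolding frame_vec_def by force
  then show ?thesis using coords_frame_vec[OF assms(1)] by simp
qed

lemma coords_inject: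
  "p \<in> U \<Longrightarrow> v \<in> tangent M p \<Longrightarrow> w \<in> tangent M p \<Longrightarrow> coords M E p v = coords M E p w \<longleftrightarrow> v = w"
  by (metis frame_vec_coords)

lemma coords_add:
  "p \<in> U \<Longrightarrow> v \<in> tangent M p \<Longrightarrow> w \<in> tangent M p \<Longrightarrow>
    coords M E p (v + w) = coords M E p v + coords M E p w"
  by (simp add: coords_def vec_eq_iff g_add E_tangent)

lemma coords_scaleR:
  "p \<in> U \<Longrightarrow> v \<in> tangent M p \<Longrightarrow> coords M E p (r *\<^sub>R v) = r *\<^sub>R coords M E p v"
  by (simp add: coords_def vec_eq_iff g_scaleR E_tangent)

lemma coords_zero: "p \<in> U \<Longrightarrow> coords M E p 0 = 0"
  using coords_scaleR[OF _ tangent_zero, of p 0] by simp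

lemma coords_minus: "p \<in> U \<Longrightarrow> v \<in> tangent M p \<Longrightarrow> coords M E p (- v) = - coords M E p v"
  using coords_scaleR[of p v "-1"] by simp

lemma coords_diff:
  "p \<in> U \<Longrightarrow> v \<in> tangent M p \<Longrightarrow> w \<in> tangent M p \<Longrightarrow>
    coords M E p (v - w) = coords M E p v - coords M E p w"
  using coords_add[of p v "- w"] by (simp add: coords_minus tangent_minus)

lemma metric_coords:
  assumes "p \<in> U" "v \<in> tangent M p" "w \<in> tangent M p"
  shows "rmetric M p v w = coords M E p v \<bullet> coords M E p w"
proof -
  have "rmetric M p (frame_vec E p (coords M E p v)) w = coords M E p v \<bullet> coords M E p w"
    unfolding frame_vec_def using assms g_sym[OF assms(3) E_tangent[OF assms(1)]]
    by (subst g_sum_left) (simp_all add: tangent_scaleR E_tangent g_scaleR inner_vec_def coords_def)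
  then show ?thesis using frame_vec_coords[OF assms(1,2)] by simp
qed

lemma frame_vec_field:
  assumes "W \<subseteq> U" "\<And>k. smooth_fun (atlas M) W (\<lambda>q. x q $ k)"
  shows "(\<lambda>q. frame_vec E q (x q)) \<in> vfields M W"
  unfolding frame_vec_def by (intro vfield_sum vfield_scale vfield_subset[OF E_field] assms)

text \<open>Every tangent vector over \<open>U\<close> extends to a smooth field with constant
  coordinates in the frame. Identities between fields are turned into pointwise ones by this
  extension.\<close>

lemma extension_field:
  "(\<lambda>q. frame_vec E q x) \<in> vfields M U"
  by (intro frame_vec_field smooth_fun_const open_U order_refl)

lemma smooth_coords:
  assumes "X \<in> vfields M W" "open W" "p \<in> W" "p \<in> U"
  shows "vsmooth_near p (\<lambda>q. coords M E q (X q))"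
  unfolding vsmooth_near_def
proof
  fix k
  have "smooth_fun (atlas M) (W \<inter> U) (\<lambda>q. rmetric M q (X q) (E q $ k))"
    using assms open_U by (intro g_smooth vfield_subset[OF assms(1)] vfield_subset[OF E_field]) auto
  then show "smooth_near (atlas M) p (\<lambda>q. coords M E q (X q) $ k)"
    using assms open_U by (auto simp: coords_def intro!: smooth_nearI[of "W \<inter> U"])
qed

section \<open>The Levi-Civita connection and its curvature in frame coordinates\<close>

lemmas levi_civita_fields = levi_civita[unfolded levi_civita_def, THEN conjunct1, rule_format]
  and levi_civita_direction = levi_civita[unfolded levi_civita_def, THEN conjunct2, rule_format]

lemma nabla_field:
  "open W \<Longrightarrow> X \<in> vfields M W \<Longrightarrow> Y \<in> vfields M W \<Longrightarrow> (\<lambda>p. nabla M p (X p) Y) \<in> vfields M W"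
  by (rule levi_civita_fields[THEN conjunct1])

lemma torsion_free:
  "open W \<Longrightarrow> X \<in> vfields M W \<Longrightarrow> Y \<in> vfields M W \<Longrightarrow> p \<in> W \<Longrightarrow>
    bracket M X Y p = nabla M p (X p) Y - nabla M p (Y p) X"
  by (rule levi_civita_fields[THEN conjunct2, THEN conjunct1, THEN bspec, symmetric])

lemma nabla_metric:
  "open W \<Longrightarrow> X \<in> vfields M W \<Longrightarrow> Y \<in> vfields M W \<Longrightarrow> p \<in> W \<Longrightarrow> v \<in> tangent M p \<Longrightarrow>
    act v (\<lambda>q. rmetric M q (X q) (Y q))
      = rmetric M p (nabla M p v X) (Y p) + rmetric M p (X p) (nabla M p v Y)"
  by (rule levi_civita_fields[THEN conjunct2, THEN conjunct2, THEN bspec, THEN bspec, THEN conjunct2])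

lemma nabla_add:
  "open W \<Longrightarrow> X \<in> vfields M W \<Longrightarrow> p \<in> W \<Longrightarrow> v \<in> tangent M p \<Longrightarrow> w \<in> tangent M p \<Longrightarrow>
    nabla M p (v + w) X = nabla M p v X + nabla M p w X"
  by (rule levi_civita_direction[THEN conjunct1, THEN bspec])

lemma nabla_scaleR:
  "open W \<Longrightarrow> X \<in> vfields M W \<Longrightarrow> p \<in> W \<Longrightarrow> v \<in> tangent M p \<Longrightarrow>
    nabla M p (r *\<^sub>R v) X = r *\<^sub>R nabla M p v X"
  by (rule levi_civita_direction[THEN conjunct2, THEN conjunct1, THEN spec])

lemma bracket_field:
  assumes "open W" "X \<in> vfields M W" "Y \<in> vfields M W"
  shows "bracket M X Y \<in> vfields M W"
proof -
  have "(\<lambda>p. nabla M p (X p) Y + (- 1) *\<^sub>R nabla M p (Y p) X) \<in> vfields M W"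
    by (intro vfield_add vfield_scale[where f = "\<lambda>_. - 1"] nabla_field smooth_fun_const assms)
  then show ?thesis
    by (rule vfield_cong) (simp add: torsion_free[OF assms])
qed

text \<open>\<open>levi_civita\<close> grants tangency only for derivatives along fields, so
  \<open>v\<close> is first extended to one.\<close>

lemma nabla_tangent:
  assumes "X \<in> vfields M W" "open W" "p \<in> W" "p \<in> U" "v \<in> tangent M p"
  shows "nabla M p v X \<in> tangent M p"
proof -
  let ?V = "\<lambda>q. frame_vec E q (coords M E p v)"
  have "(\<lambda>q. nabla M q (?V q) X) \<in> vfields M (W \<inter> U)"
    using assms open_U
    by (intro nabla_field vfield_subset[OF extension_field] vfield_subset[OF assms(1)]) auto
  from vfield_tangent[OF this, of p] show ?thesis
    using assms frame_vec_coords by simp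
qed

lemma conn_skew:
  assumes "p \<in> U" "v \<in> tangent M p"
  shows "rmetric M p (nabla M p v (\<lambda>q. E q $ i)) (E p $ j)
    = - rmetric M p (nabla M p v (\<lambda>q. E q $ j)) (E p $ i)"
proof -
  have "act v (\<lambda>q. rmetric M q (E q $ i) (E q $ j)) = act v (\<lambda>q. if i = j then 1 else 0)"
    using open_U assms(1) E_metric
    by (intro act_cong[OF assms(2) _ open_U assms(1)] smooth_nearI[OF open_U] g_smooth E_field) auto
  then have "act v (\<lambda>q. rmetric M q (E q $ i) (E q $ j)) = 0"
    by (simp add: act_const[OF assms(2)])
  then show ?thesis
    using nabla_metric[OF open_U E_field E_field assms, of i j]
      g_sym[OF nabla_tangent[OF E_field open_U assms(1,1,2)] E_tangent[OF assms(1)]]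
    by simp
qed

lemma coords_nabla_frame:
  assumes "p \<in> U" "v \<in> tangent M p"
  shows "coords M E p (nabla M p v (\<lambda>q. E q $ k)) = conn M E p v \<times> axis k 1"
proof -
  have skew: "rmetric M p (nabla M p v (\<lambda>q. E q $ i)) (E p $ i) = 0" for i
    using conn_skew[OF assms, of i i] by simp
  show ?thesis
    using exhaust_3[of k] conn_skew[OF assms, of 1 2] conn_skew[OF assms, of 1 3]
      conn_skew[OF assms, of 2 3]
    by (auto simp: vec_eq_iff forall_3 cross_components coords_def conn_def axis_def skew)
qed

text \<open>Metric compatibility applied to \<open>X\<close> and a frame vector isolates one
  coordinate of the derivative; the connection vector then moves to the other factor by antisymmetry
  of the triple product. In coordinates the connection is thus d plus a cross product.\<close>

lemma coords_nabla:
  assumes X: "X \<in> vfields M W" "open W" "p \<in> W" and p: "p \<in> U" and v: "v \<in> tangent M p"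
  shows "coords M E p (nabla M p v X)
    = vact v (\<lambda>q. coords M E q (X q)) + conn M E p v \<times> coords M E p (X p)"
proof -
  have "rmetric M p (nabla M p v X) (E p $ k)
      = act v (\<lambda>q. rmetric M q (X q) (E q $ k)) - coords M E p (X p) \<bullet> (conn M E p v \<times> axis k 1)" for k
  proof -
    have "act v (\<lambda>q. rmetric M q (X q) (E q $ k))
        = rmetric M p (nabla M p v X) (E p $ k) + rmetric M p (X p) (nabla M p v (\<lambda>q. E q $ k))"
      using X p open_U v
      by (intro nabla_metric[of "W \<inter> U"] vfield_subset[OF X(1)] vfield_subset[OF E_field]) auto
    also have "rmetric M p (X p) (nabla M p v (\<lambda>q. E q $ k))
        = coords M E p (X p) \<bullet> (conn M E p v \<times> axis k 1)"
      using metric_coords[OF p vfield_tangent[OF X(1,3)] nabla_tangent[OF E_field open_U p p v]]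
        coords_nabla_frame[OF p v] by simp
    finally show ?thesis by simp
  qed
  moreover have "x \<bullet> (w \<times> axis k 1) = - (w \<times> x) $ k" for x w :: "real^3" and k
    using exhaust_3[of k] by (auto simp: cross_components inner_vec_def sum_3 axis_def)
  ultimately show ?thesis
    by (simp add: vec_eq_iff vact_def coords_nth)
qed

lemma coords_bracket:
  assumes X: "X \<in> vfields M W" and Y: "Y \<in> vfields M W" and W: "open W" "p \<in> W" "p \<in> U"
  shows "coords M E p (bracket M X Y p)
    = vact (X p) (\<lambda>q. coords M E q (Y q)) + conn M E p (X p) \<times> coords M E p (Y p)
      - (vact (Y p) (\<lambda>q. coords M E q (X q)) + conn M E p (Y p) \<times> coords M E p (X p))"
  using assms vfield_tangent[OF X W(2)] vfield_tangent[OF Y W(2)]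
  by (simp add: torsion_free[OF W(1) X Y W(2)] coords_diff nabla_tangent[of _ W]
      coords_nabla[of _ W])

lemma conn_add:
  "p \<in> U \<Longrightarrow> v \<in> tangent M p \<Longrightarrow> w \<in> tangent M p \<Longrightarrow>
    conn M E p (v + w) = conn M E p v + conn M E p w"
  by (simp add: vec_eq_iff forall_3 conn_def nabla_add[OF open_U E_field]
      g_add nabla_tangent[OF E_field open_U] E_tangent)

lemma conn_scaleR:
  "p \<in> U \<Longrightarrow> v \<in> tangent M p \<Longrightarrow> conn M E p (r *\<^sub>R v) = r *\<^sub>R conn M E p v"
  by (simp add: vec_eq_iff forall_3 conn_def nabla_scaleR[OF open_U E_field]
      g_scaleR nabla_tangent[OF E_field open_U] E_tangent)

lemma conn_smooth:
  assumes "X \<in> vfields M W" "open W" "p \<in> W" "p \<in> U"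
  shows "vsmooth_near p (\<lambda>q. conn M E q (X q))"
proof -
  have "smooth_near (atlas M) p (\<lambda>q. rmetric M q (nabla M q (X q) (\<lambda>q. E q $ i)) (E q $ j))" for i j
    using assms open_U
    by (intro smooth_nearI[of "W \<inter> U"] g_smooth nabla_field vfield_subset[OF E_field]
        vfield_subset[OF assms(1)]) auto
  then show ?thesis by (simp add: vsmooth_near_def forall_3 conn_def)
qed

text \<open>The curvature form of the connection form, d\<omega> plus half of its bracket with
  itself, evaluated on two fields; under so(3) = R^3 the commutator is the cross product.\<close>

definition curv_vec :: "('a \<Rightarrow> 'a tvec) \<Rightarrow> ('a \<Rightarrow> 'a tvec) \<Rightarrow> 'a \<Rightarrow> real^3" where
  "curv_vec X Y p = vact (X p) (\<lambda>q. conn M E q (Y q)) - vact (Y p) (\<lambda>q. conn M E q (X q))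
     - conn M E p (bracket M X Y p) + conn M E p (X p) \<times> conn M E p (Y p)"

lemma coords_nabla_nabla:
  assumes X: "X \<in> vfields M W" and Y: "Y \<in> vfields M W" and Z: "Z \<in> vfields M W"
    and W: "open W" "p \<in> W" "p \<in> U"
  defines "z \<equiv> \<lambda>q. coords M E q (Z q)"
  shows "coords M E p (nabla M p (X p) (\<lambda>q. nabla M q (Y q) Z))
    = vact (X p) (\<lambda>q. vact (Y q) z) + vact (X p) (\<lambda>q. conn M E q (Y q)) \<times> z p
      + conn M E p (Y p) \<times> vact (X p) z
      + conn M E p (X p) \<times> (vact (Y p) z + conn M E p (Y p) \<times> z p)"
proof -
  have Xp: "X p \<in> tangent M p" using vfield_tangent[OF X W(2)] .
  have smooth: "vsmooth_near p z" "vsmooth_near p (\<lambda>q. vact (Y q) z)"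
    "vsmooth_near p (\<lambda>q. conn M E q (Y q))"
    unfolding z_def using smooth_coords[OF Z W] vsmooth_near_vact_field[OF Y W(1,2)] conn_smooth[OF Y W]
    by auto
  have eq: "coords M E q (nabla M q (Y q) Z) = vact (Y q) z + conn M E q (Y q) \<times> z q"
    if "q \<in> W \<inter> U" for q
    unfolding z_def using that W coords_nabla[OF Z W(1) _ _ vfield_tangent[OF Y]] by auto
  have field: "(\<lambda>q. nabla M q (Y q) Z) \<in> vfields M W"
    by (rule nabla_field[OF W(1) Y Z])
  have "vact (X p) (\<lambda>q. coords M E q (nabla M q (Y q) Z))
      = vact (X p) (\<lambda>q. vact (Y q) z + conn M E q (Y q) \<times> z q)"
    using eq W open_U by (intro vact_cong[OF Xp smooth_coords[OF field W], of "W \<inter> U"]) auto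
  also have "\<dots> = vact (X p) (\<lambda>q. vact (Y q) z)
      + (vact (X p) (\<lambda>q. conn M E q (Y q)) \<times> z p + conn M E p (Y p) \<times> vact (X p) z)"
    by (simp add: vact_add[OF Xp] vact_cross[OF Xp] smooth vsmooth_near_intros)
  finally show ?thesis
    using eq[of p] W by (simp add: coords_nabla[OF field W Xp] add.assoc)
qed

lemma coords_curvature_fields_diff:
  assumes X: "X \<in> vfields M W" and Y: "Y \<in> vfields M W" and Z: "Z \<in> vfields M W"
    and W: "open W" "p \<in> W" "p \<in> U"
  shows "coords M E p (curvature_fields M X Y Z p)
      = coords M E p (nabla M p (X p) (\<lambda>q. nabla M q (Y q) Z))
        - coords M E p (nabla M p (Y p) (\<lambda>q. nabla M q (X q) Z))
        - coords M E p (nabla M p (bracket M X Y p) Z)"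
    and "curvature_fields M X Y Z p \<in> tangent M p"
proof -
  have "X p \<in> tangent M p" "Y p \<in> tangent M p" "bracket M X Y p \<in> tangent M p"
    using vfield_tangent[OF _ W(2)] X Y bracket_field[OF W(1) X Y] by auto
  then have nabla: "nabla M p (X p) (\<lambda>q. nabla M q (Y q) Z) \<in> tangent M p"
    "nabla M p (Y p) (\<lambda>q. nabla M q (X q) Z) \<in> tangent M p"
    "nabla M p (bracket M X Y p) Z \<in> tangent M p"
    by (auto intro!: nabla_tangent[OF _ W] nabla_field[OF W(1)] X Y Z)
  then show "curvature_fields M X Y Z p \<in> tangent M p"
    unfolding curvature_fields_def by (intro tangent_diff)
  show "coords M E p (curvature_fields M X Y Z p)
      = coords M E p (nabla M p (X p) (\<lambda>q. nabla M q (Y q) Z))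
        - coords M E p (nabla M p (Y p) (\<lambda>q. nabla M q (X q) Z))
        - coords M E p (nabla M p (bracket M X Y p) Z)"
    unfolding curvature_fields_def using W(3) nabla by (simp add: coords_diff tangent_diff)
qed

lemma coords_curvature_fields:
  assumes X: "X \<in> vfields M W" and Y: "Y \<in> vfields M W" and Z: "Z \<in> vfields M W"
    and W: "open W" "p \<in> W" "p \<in> U"
  shows "coords M E p (curvature_fields M X Y Z p) = curv_vec X Y p \<times> coords M E p (Z p)"
proof -
  let ?z = "\<lambda>q. coords M E q (Z q)"
  have "bracket M X Y p \<in> tangent M p"
    using vfield_tangent[OF bracket_field[OF W(1) X Y] W(2)] .
  then have "coords M E p (nabla M p (bracket M X Y p) Z) =
      vact (X p) (\<lambda>q. vact (Y q) ?z) - vact (Y p) (\<lambda>q. vact (X q) ?z)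
      + conn M E p (bracket M X Y p) \<times> ?z p"
    by (simp add: coords_nabla[OF Z W] vact_bracket smooth_coords[OF Z W])
  \<comment> \<open>The Jacobi identity of the cross product: the commutator of two infinitesimal
    rotations is the rotation by the cross product of their vectors.\<close>
  moreover have "conn M E p (X p) \<times> (conn M E p (Y p) \<times> ?z p)
      = conn M E p (Y p) \<times> (conn M E p (X p) \<times> ?z p)
        + (conn M E p (X p) \<times> conn M E p (Y p)) \<times> ?z p"
    by (simp add: cross3_simps)
  ultimately show ?thesis
    unfolding coords_curvature_fields_diff(1)[OF X Y Z W]
    by (simp add: coords_nabla_nabla[OF X Y Z W]
        coords_nabla_nabla[OF Y X Z W] curv_vec_def cross_add_left cross_add_right
        Cross3.left_diff_distrib)
qed

section \<open>Jacobi identity and first Bianchi identity\<close>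

lemma act_vfield_bracket:
  "smooth_near (atlas M) p f \<Longrightarrow> open W \<Longrightarrow> p \<in> W \<Longrightarrow> X \<in> vfields M W \<Longrightarrow> Y \<in> vfields M W \<Longrightarrow>
   Z \<in> vfields M W \<Longrightarrow> act (X p) (\<lambda>q. act (bracket M Y Z q) f)
    = act (X p) (\<lambda>q. act (Y q) (\<lambda>r. act (Z r) f)) - act (X p) (\<lambda>q. act (Z q) (\<lambda>r. act (Y r) f))"
proof -
  assume f: "smooth_near (atlas M) p f" and W: "open W" "p \<in> W"
    and X: "X \<in> vfields M W" and Y: "Y \<in> vfields M W" and Z: "Z \<in> vfields M W"
  obtain V where V: "open V" "p \<in> V" "smooth_fun (atlas M) V f"
    using f unfolding smooth_near_def by blast
  note Xp = vfield_tangent[OF X W(2)]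
  note near = smooth_near_act_field[OF _ W]
  \<comment> \<open>\<open>act_bracket\<close> is a statement at one point; to be differentiated it
    has to hold on a neighbourhood, namely where \<open>f\<close> is smooth.\<close>
  have "act (X p) (\<lambda>q. act (bracket M Y Z q) f)
      = act (X p) (\<lambda>q. act (Y q) (\<lambda>r. act (Z r) f) - act (Z q) (\<lambda>r. act (Y r) f))"
    by (rule act_cong[OF Xp near[OF bracket_field[OF W(1) Y Z] f] V(1,2)])
      (use V act_bracket smooth_nearI in blast)
  also have "\<dots> = act (X p) (\<lambda>q. act (Y q) (\<lambda>r. act (Z r) f))
      - act (X p) (\<lambda>q. act (Z q) (\<lambda>r. act (Y r) f))"
    by (intro act_diff[OF Xp] near Y Z f)
  finally show ?thesis .
qed

text \<open>Tested on chart coordinates, brackets are commutators of derivations, and the twelve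
  third-order terms cancel in pairs.\<close>

lemma lie_jacobi:
  assumes X: "X \<in> vfields M W" and Y: "Y \<in> vfields M W" and Z: "Z \<in> vfields M W"
    and W: "open W" "p \<in> W"
  shows "bracket M X (bracket M Y Z) p + bracket M Y (bracket M Z X) p
    + bracket M Z (bracket M X Y) p = 0"
proof -
  have tang: "bracket M X (bracket M Y Z) p + bracket M Y (bracket M Z X) p
    + bracket M Z (bracket M X Y) p \<in> tangent M p"
    by (intro tangent_add vfield_tangent[OF _ W(2)] bracket_field[OF W(1)] X Y Z)
  obtain V \<phi> where chart: "(V, \<phi>) \<in> atlas M" "p \<in> V"
    using chart_cover by blast
  show ?thesis
  proof (rule tangent_eqI[OF tang tangent_zero chart])
    fix j
    have f: "smooth_near (atlas M) p (\<lambda>q. \<phi> q $ j)"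
      using smooth_nearI[OF chart_open[OF chart(1)] chart(2)]
        smooth_fun_coordinate[OF chart(1) chart_open[OF chart(1)] order_refl] by blast
    note near = smooth_near_act_field[OF _ W f]
    show "act (bracket M X (bracket M Y Z) p + bracket M Y (bracket M Z X) p
        + bracket M Z (bracket M X Y) p) (\<lambda>q. \<phi> q $ j) = act 0 (\<lambda>q. \<phi> q $ j)"
      by (simp add: plus_tvec.rep_eq zero_tvec.rep_eq act_bracket[OF f]
          act_vfield_bracket[OF f W] act_bracket[OF near] X Y Z)
  qed
qed

text \<open>Torsion-freeness used twice: the first two terms combine to the derivative of
  \<open>[Y, Z]\<close> along \<open>X\<close>, and subtracting the derivative of \<open>X\<close>
  along \<open>[Y, Z]\<close> gives the double bracket. Its cyclic sum regroups into three
  curvatures.\<close>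

lemma coords_nabla_swap:
  assumes X: "X \<in> vfields M W" and Y: "Y \<in> vfields M W" and Z: "Z \<in> vfields M W"
    and W: "open W" "p \<in> W" "p \<in> U"
  shows "coords M E p (nabla M p (X p) (\<lambda>q. nabla M q (Y q) Z))
      - coords M E p (nabla M p (X p) (\<lambda>q. nabla M q (Z q) Y))
      - coords M E p (nabla M p (bracket M Y Z p) X)
    = coords M E p (bracket M X (bracket M Y Z) p)"
proof -
  note Xp = vfield_tangent[OF X W(2)]
  note br = bracket_field[OF W(1) Y Z]
  note YZ = nabla_field[OF W(1) Y Z] and ZY = nabla_field[OF W(1) Z Y]
  have eq: "coords M E q (bracket M Y Z q)
      = coords M E q (nabla M q (Y q) Z) - coords M E q (nabla M q (Z q) Y)" if "q \<in> W \<inter> U" for q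
    using that vfield_tangent[OF YZ] vfield_tangent[OF ZY] torsion_free[OF W(1) Y Z]
    by (simp add: coords_diff)
  have "vact (X p) (\<lambda>q. coords M E q (bracket M Y Z q))
      = vact (X p) (\<lambda>q. coords M E q (nabla M q (Y q) Z) - coords M E q (nabla M q (Z q) Y))"
    using eq W open_U by (intro vact_cong[OF Xp smooth_coords[OF br W], of "W \<inter> U"]) auto
  also have "\<dots> = vact (X p) (\<lambda>q. coords M E q (nabla M q (Y q) Z))
      - vact (X p) (\<lambda>q. coords M E q (nabla M q (Z q) Y))"
    by (intro vact_diff[OF Xp] smooth_coords[OF _ W] YZ ZY)
  finally have "coords M E p (nabla M p (X p) (bracket M Y Z))
      = coords M E p (nabla M p (X p) (\<lambda>q. nabla M q (Y q) Z))
      - coords M E p (nabla M p (X p) (\<lambda>q. nabla M q (Z q) Y))"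
    using eq[of p] W by (simp add: coords_nabla[OF _ W Xp] br YZ ZY Cross3.right_diff_distrib)
  moreover have "coords M E p (bracket M X (bracket M Y Z) p)
    = coords M E p (nabla M p (X p) (bracket M Y Z)) - coords M E p (nabla M p (bracket M Y Z p) X)"
    using W by (simp add: torsion_free[OF W(1) X br W(2)] coords_diff nabla_tangent[OF _ W]
        br X Xp vfield_tangent[OF br])
  ultimately show ?thesis by simp
qed

text \<open>Summing \<open>coords_nabla_swap\<close> cyclically gives the curvatures on one side and
  the Jacobi sum on the other. For a curvature of the form \<open>F (x \<times> y)\<close> with
  linear \<open>F\<close>, it expresses the symmetry of \<open>F\<close>.\<close>

lemma bianchi:
  assumes X: "X \<in> vfields M W" and Y: "Y \<in> vfields M W" and Z: "Z \<in> vfields M W"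
    and W: "open W" "p \<in> W" "p \<in> U"
  shows "curv_vec X Y p \<times> coords M E p (Z p) + curv_vec Y Z p \<times> coords M E p (X p)
    + curv_vec Z X p \<times> coords M E p (Y p) = 0"
proof -
  have br: "bracket M X (bracket M Y Z) p \<in> tangent M p"
    if "X \<in> vfields M W" "Y \<in> vfields M W" "Z \<in> vfields M W" for X Y Z
    by (intro vfield_tangent[OF _ W(2)] bracket_field[OF W(1)] that)
  have "coords M E p (bracket M X (bracket M Y Z) p) + coords M E p (bracket M Y (bracket M Z X) p)
    + coords M E p (bracket M Z (bracket M X Y) p) = 0"
    using lie_jacobi[OF X Y Z W(1,2)] W coords_zero
    by (simp add: coords_add[symmetric] tangent_add br X Y Z)
  then show ?thesis
    using coords_nabla_swap[OF X Y Z W] coords_nabla_swap[OF Y Z X W] coords_nabla_swap[OF Z X Y W]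
    by (simp add: coords_curvature_fields(1)[OF _ _ _ W, symmetric]
        coords_curvature_fields_diff(1)[OF _ _ _ W] X Y Z algebra_simps)
qed

text \<open>\<open>curvature\<close> denotes something only if \<open>curvature_fields\<close> is
  the same for all extensions. The assumption on \<open>G\<close> says just this, and the
  integrability condition of the spinor will supply it.\<close>

lemma coords_curvature:
  assumes G: "\<And>W X Y. open W \<Longrightarrow> p \<in> W \<Longrightarrow> X \<in> vfields M W \<Longrightarrow> Y \<in> vfields M W \<Longrightarrow>
      curv_vec X Y p = G (coords M E p (X p)) (coords M E p (Y p))"
    and p: "p \<in> U" and u: "u \<in> tangent M p" and v: "v \<in> tangent M p" and w: "w \<in> tangent M p"
  shows "curvature M p u v w
    = frame_vec E p (G (coords M E p u) (coords M E p v) \<times> coords M E p w)" (is "_ = ?r")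
  unfolding curvature_def
proof (rule the_equality)
  show "\<forall>U X Y Z. open U \<longrightarrow> p \<in> U \<longrightarrow> X \<in> vfields M U \<longrightarrow> Y \<in> vfields M U \<longrightarrow> Z \<in> vfields M U \<longrightarrow>
      X p = u \<longrightarrow> Y p = v \<longrightarrow> Z p = w \<longrightarrow> ?r = curvature_fields M X Y Z p"
  proof (intro allI impI)
    fix W X Y Z
    assume W: "open W" "p \<in> W" and f: "X \<in> vfields M W" "Y \<in> vfields M W" "Z \<in> vfields M W"
      and eq: "X p = u" "Y p = v" "Z p = w"
    show "?r = curvature_fields M X Y Z p"
      using coords_curvature_fields[OF f W p] coords_curvature_fields_diff(2)[OF f W p] G[OF W f(1,2)] eq frame_vec_coords[OF p] by metis
  qed
next
  fix r
  assume r: "\<forall>U X Y Z. open U \<longrightarrow> p \<in> U \<longrightarrow> X \<in> vfields M U \<longrightarrow> Y \<in> vfields M U \<longrightarrow> Z \<in> vfields M U \<longrightarrow>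
      X p = u \<longrightarrow> Y p = v \<longrightarrow> Z p = w \<longrightarrow> r = curvature_fields M X Y Z p"
  let ?X = "\<lambda>u q. frame_vec E q (coords M E p u)"
  have "r = curvature_fields M (?X u) (?X v) (?X w) p"
    using r open_U p extension_field frame_vec_coords[OF p] u v w by blast
  then show "r = ?r"
    using coords_curvature_fields[OF extension_field extension_field extension_field open_U p p]
      coords_curvature_fields_diff(2)[OF extension_field extension_field extension_field open_U p p]
      G[OF open_U p extension_field extension_field] frame_vec_coords[OF p] u v w
    by metis
qed

section \<open>Traces and adapted bases\<close>

lemma orthonormal_frame_coords:
  assumes "p \<in> U"
  shows "orthonormal_frame M p e \<longleftrightarrow> (\<forall>i. e $ i \<in> tangent M p) \<and>
    orthogonal_matrix (\<chi> i. coords M E p (e $ i))"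
proof -
  have "orthogonal_matrix Q \<longleftrightarrow> Q ** transpose Q = mat 1" for Q :: "real^3^3"
    by (auto simp: orthogonal_matrix_def matrix_left_right_inverse)
  then have "orthogonal_matrix (\<chi> i. coords M E p (e $ i)) \<longleftrightarrow>
      (\<forall>i j. coords M E p (e $ i) \<bullet> coords M E p (e $ j) = (if i = j then 1 else 0))"
    by (simp add: vec_eq_iff matrix_matrix_mult_def transpose_def mat_def
        inner_vec_def)
  then show ?thesis
    unfolding orthonormal_frame_def using assms metric_coords by auto
qed

text \<open>Passing to another orthonormal frame conjugates the matrix by an orthogonal one, so the
  sum in \<open>tangent_trace\<close> is independent of the frame.\<close>

lemma tangent_trace_coords:
  assumes p: "p \<in> U" and L: "\<And>u. u \<in> tangent M p \<Longrightarrow> L u \<in> tangent M p"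
    "\<And>u. u \<in> tangent M p \<Longrightarrow> coords M E p (L u) = B *v coords M E p u"
  shows "tangent_trace M p L = trace B"
  unfolding tangent_trace_def
proof (rule the_equality)
  have key: "(\<Sum>i\<in>UNIV. rmetric M p (L (e $ i)) (e $ i)) = trace B" if e: "orthonormal_frame M p e" for e
  proof -
    define Q where "Q = (\<chi> i. coords M E p (e $ i))"
    have tang: "\<And>i. e $ i \<in> tangent M p" and Q: "orthogonal_matrix Q"
      using e orthonormal_frame_coords[OF p] by (auto simp: Q_def)
    have "rmetric M p (L (e $ i)) (e $ i) = (Q ** (B ** transpose Q)) $ i $ i" for i
      using metric_coords[OF p L(1)[OF tang] tang, of i i] L(2)[OF tang]
      by (simp add: Q_def matrix_matrix_mult_def matrix_vector_mult_def transpose_def inner_vec_def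
          sum_distrib_left mult.commute)
    then have "(\<Sum>i\<in>UNIV. rmetric M p (L (e $ i)) (e $ i)) = trace (Q ** (B ** transpose Q))"
      by (simp add: trace_def)
    also have "\<dots> = trace ((B ** transpose Q) ** Q)" by (rule trace_mul_sym)
    also have "(B ** transpose Q) ** Q = B"
      using Q by (simp add: matrix_mul_assoc[symmetric] orthogonal_matrix)
    finally show ?thesis .
  qed
  then show "\<forall>e. orthonormal_frame M p e \<longrightarrow> trace B = (\<Sum>i\<in>UNIV. rmetric M p (L (e $ i)) (e $ i))"
    by simp
  \<comment> \<open>Uniqueness requires some orthonormal frame to exist; \<open>E p\<close> is
    one.\<close>
  show "t = trace B" if "\<forall>e. orthonormal_frame M p e \<longrightarrow> t = (\<Sum>i\<in>UNIV. rmetric M p (L (e $ i)) (e $ i))" for t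
    using that E_orthonormal[OF p] key by metis
qed

end

text \<open>Normalizing a non-zero \<open>x \<times> u\<close> and taking one more cross product
  completes the unit vector to a positive orthonormal basis. With \<xi> as first vector all later
  component computations are done in such a basis.\<close>

lemma adapted_basis:
  fixes x :: "real^3"
  assumes "norm x = 1"
  obtains y z where "norm y = 1" "norm z = 1" "x \<bullet> y = 0" "x \<bullet> z = 0" "y \<bullet> z = 0"
    "x \<times> y = z" "y \<times> z = x" "z \<times> x = y"
proof -
  have "x \<noteq> 0" using assms by auto
  then obtain u where "x \<times> u \<noteq> 0" using cross_basis_nonzero by blast
  define y where "y = (1 / norm (x \<times> u)) *\<^sub>R (x \<times> u)"
  have y: "norm y = 1" "x \<bullet> y = 0"
    using \<open>x \<times> u \<noteq> 0\<close> by (simp_all add: y_def dot_cross_self)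
  then have yy: "y \<bullet> y = 1" "x \<bullet> x = 1"
    using assms by (simp_all add: norm_eq_1)
  have "(x \<times> y) \<bullet> (x \<times> y) = 1"
    using yy y(2) by (simp add: dot_cross inner_commute)
  moreover have "y \<times> (x \<times> y) = x"
    using yy y(2) by (simp add: Lagrange inner_commute)
  moreover have "(x \<times> y) \<times> x = y"
    using yy y(2) cross_skew[of "x \<times> y" x] by (simp add: Lagrange inner_commute)
  ultimately show ?thesis
    using y by (intro that[of y "x \<times> y"]) (simp_all add: norm_eq_1 dot_cross_self)
qed

section \<open>Orientation, gradients and covariant differentiation of coordinate functions\<close>

context riem_frame
begin

text \<open>The chart matrix of \<open>e\<close> is its coordinate matrix times the chart matrix of
  \<open>E p\<close>, whose determinant is positive in every chart; so the sign is visible in the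
  coordinates alone.\<close>

lemma positive_frame_coords:
  assumes p: "p \<in> U" and e: "\<And>i. e $ i \<in> tangent M p"
  shows "positive_frame M p e \<longleftrightarrow> det (\<chi> i. coords M E p (e $ i)) > 0"
proof -
  define Q where "Q = (\<chi> i. coords M E p (e $ i))"
  have "chart_matrix \<phi> e = Q ** chart_matrix \<phi> (E p)" for \<phi>
  proof -
    have "act (e $ i) f = act (frame_vec E p (coords M E p (e $ i))) f" for i f
      using frame_vec_coords[OF p e] by simp
    then have "act (e $ i) f = (\<Sum>k\<in>UNIV. Q $ i $ k * act (E p $ k) f)" for i f
      by (simp add: frame_vec_def act_tvec_sum scaleR_tvec.rep_eq Q_def)
    then show ?thesis
      by (simp add: vec_eq_iff chart_matrix_def matrix_matrix_mult_def)
  qed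
  then have "det (chart_matrix \<phi> e) = det Q * det (chart_matrix \<phi> (E p))" for \<phi>
    by (simp add: det_mul)
  then have "det (chart_matrix \<phi> e) > 0 \<longleftrightarrow> det Q > 0" if "(V, \<phi>) \<in> atlas M" "p \<in> V" for V \<phi>
    using E_chart_det[OF p that] by (simp add: zero_less_mult_iff)
  moreover obtain V \<phi> where "(V, \<phi>) \<in> atlas M" "p \<in> V" using chart_cover by blast
  ultimately show ?thesis
    unfolding positive_frame_def chart_matrix_def Q_def by fast
qed

definition grad_coords :: "('a \<Rightarrow> real) \<Rightarrow> 'a \<Rightarrow> real^3" where
  "grad_coords f q = (\<chi> k. act (E q $ k) f)"

lemma act_grad_coords:
  assumes "p \<in> U" "v \<in> tangent M p"
  shows "act v f = grad_coords f p \<bullet> coords M E p v"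
proof -
  have "act v f = act (frame_vec E p (coords M E p v)) f"
    using frame_vec_coords[OF assms] by simp
  then show ?thesis
    by (simp add: frame_vec_def act_tvec_sum scaleR_tvec.rep_eq grad_coords_def inner_vec_def
        mult.commute)
qed

lemma gradient_coords:
  assumes p: "p \<in> U"
  shows "gradient M f p = frame_vec E p (grad_coords f p)"
  unfolding gradient_def
proof (rule the_equality)
  show "frame_vec E p (grad_coords f p) \<in> tangent M p \<and>
      (\<forall>v\<in>tangent M p. rmetric M p (frame_vec E p (grad_coords f p)) v = act v f)"
    using p by (simp add: frame_vec_tangent metric_coords coords_frame_vec act_grad_coords)
next
  fix w assume w: "w \<in> tangent M p \<and> (\<forall>v\<in>tangent M p. rmetric M p w v = act v f)"
  then have "coords M E p w = grad_coords f p"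
    using E_tangent[OF p] by (simp add: vec_eq_iff coords_nth grad_coords_def)
  then show "w = frame_vec E p (grad_coords f p)"
    using frame_vec_coords[OF p] w by metis
qed

lemma smooth_grad_coords:
  assumes "smooth_near (atlas M) p f" "p \<in> U"
  shows "vsmooth_near p (grad_coords f)"
  using smooth_near_act_field[OF E_field open_U assms(2,1)]
  by (simp add: vsmooth_near_def grad_coords_def)

text \<open>The Levi-Civita connection moved to coordinate functions. Expressions such as
  \<open>kill\<close> of a field or \<open>grad_coords b\<close> can be differentiated directly,
  with product rules for scalar, cross and inner products.\<close>

definition cov :: "'a \<Rightarrow> 'a tvec \<Rightarrow> ('a \<Rightarrow> real^3) \<Rightarrow> real^3" where
  "cov p v f = vact v f + conn M E p v \<times> f p"

lemma coords_nabla_cov: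
  "X \<in> vfields M W \<Longrightarrow> open W \<Longrightarrow> p \<in> W \<Longrightarrow> p \<in> U \<Longrightarrow> v \<in> tangent M p \<Longrightarrow>
    coords M E p (nabla M p v X) = cov p v (\<lambda>q. coords M E q (X q))"
  unfolding cov_def by (rule coords_nabla)

lemma coords_bracket_cov:
  "X \<in> vfields M W \<Longrightarrow> Y \<in> vfields M W \<Longrightarrow> open W \<Longrightarrow> p \<in> W \<Longrightarrow> p \<in> U \<Longrightarrow>
    coords M E p (bracket M X Y p)
      = cov p (X p) (\<lambda>q. coords M E q (Y q)) - cov p (Y p) (\<lambda>q. coords M E q (X q))"
  unfolding cov_def by (rule coords_bracket)

lemma cov_cong:
  assumes "v \<in> tangent M p" "vsmooth_near p f" "open W" "p \<in> W" "\<And>q. q \<in> W \<Longrightarrow> f q = g q"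
  shows "cov p v f = cov p v g"
  unfolding cov_def using vact_cong[OF assms] assms(4,5) by simp

lemma cov_add:
  "v \<in> tangent M p \<Longrightarrow> vsmooth_near p f \<Longrightarrow> vsmooth_near p g \<Longrightarrow>
    cov p v (\<lambda>q. f q + g q) = cov p v f + cov p v g"
  by (simp add: cov_def vact_add cross_add_right)

lemma cov_scale:
  "v \<in> tangent M p \<Longrightarrow> smooth_near (atlas M) p r \<Longrightarrow> vsmooth_near p f \<Longrightarrow>
    cov p v (\<lambda>q. r q *\<^sub>R f q) = act v r *\<^sub>R f p + r p *\<^sub>R cov p v f"
  by (simp add: cov_def vact_scale cross_mult_right scaleR_right_distrib)

lemma cov_cross:
  assumes "v \<in> tangent M p" "vsmooth_near p f" "vsmooth_near p g"
  shows "cov p v (\<lambda>q. f q \<times> g q) = cov p v f \<times> g p + f p \<times> cov p v g"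
proof -
  \<comment> \<open>An infinitesimal rotation is a derivation of the cross product, so the
    connection terms obey the same Leibniz rule as the plain derivatives.\<close>
  have "a \<times> (x \<times> y) = (a \<times> x) \<times> y + x \<times> (a \<times> y)" for a x y :: "real^3"
    by (simp add: cross3_simps)
  from this[of "conn M E p v" "f p" "g p"] show ?thesis
    unfolding cov_def by (simp add: vact_cross[OF assms] cross_add_left cross_add_right)
qed

lemma act_inner_cov:
  assumes "v \<in> tangent M p" "vsmooth_near p f" "vsmooth_near p g"
  shows "act v (\<lambda>q. f q \<bullet> g q) = cov p v f \<bullet> g p + f p \<bullet> cov p v g"
proof -
  have "(a \<times> x) \<bullet> y + x \<bullet> (a \<times> y) = 0" for a x y :: "real^3"
    by (simp add: cross3_simps)
  from this[of "conn M E p v" "f p" "g p"] show ?thesis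
    unfolding cov_def by (simp add: act_inner[OF assms] inner_add_left inner_add_right)
qed

text \<open>Symmetry of the Hessian: in \<open>X(Y f) - Y(X f) = [X, Y] f\<close> the terms with
  first derivatives of the fields cancel because the connection is torsion-free.\<close>

lemma cov_grad_symmetric:
  assumes X: "X \<in> vfields M W" and Y: "Y \<in> vfields M W" and W: "open W" "p \<in> W" "p \<in> U"
    and f: "smooth_near (atlas M) p f"
  shows "cov p (X p) (grad_coords f) \<bullet> coords M E p (Y p)
    = cov p (Y p) (grad_coords f) \<bullet> coords M E p (X p)"
proof -
  have second: "act (X p) (\<lambda>q. act (Y q) f) = cov p (X p) (grad_coords f) \<bullet> coords M E p (Y p)
      + grad_coords f p \<bullet> cov p (X p) (\<lambda>q. coords M E q (Y q))"
    if X: "X \<in> vfields M W" and Y: "Y \<in> vfields M W" for X Y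
  proof -
    note Xp = vfield_tangent[OF X W(2)]
    have "act (X p) (\<lambda>q. act (Y q) f) = act (X p) (\<lambda>q. grad_coords f q \<bullet> coords M E q (Y q))"
      using W open_U vfield_tangent[OF Y] act_grad_coords
      by (intro act_cong[OF Xp smooth_near_act_field[OF Y W(1,2) f], of "W \<inter> U"]) auto
    also have "\<dots> = cov p (X p) (grad_coords f) \<bullet> coords M E p (Y p)
      + grad_coords f p \<bullet> cov p (X p) (\<lambda>q. coords M E q (Y q))"
      by (intro act_inner_cov Xp smooth_grad_coords f W smooth_coords[OF Y W])
    finally show ?thesis .
  qed
  have "act (bracket M X Y p) f = grad_coords f p \<bullet> coords M E p (bracket M X Y p)"
    by (intro act_grad_coords W vfield_tangent[OF bracket_field[OF W(1) X Y] W(2)])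
  then show ?thesis
    unfolding act_bracket[OF f] coords_bracket_cov[OF X Y W] second[OF X Y] second[OF Y X]
    by (simp add: inner_diff_right)
qed

end

section \<open>Riemannian flows with geodesic leaves\<close>

locale flow_frame = riem_frame M U E
  for M :: "'a::{t2_space,second_countable_topology} flow3" and U E +
  fixes b :: "'a \<Rightarrow> real"
  assumes flow: "riemannian_flow M"
    and kappa: "\<And>p. flow_kappa M p = 0"
    and b_smooth: "smooth_fun (atlas M) UNIV b"
    and h_eq: "\<And>p z. z \<in> normal_plane M p \<Longrightarrow> flow_h M p z = b p *\<^sub>R flow_J M p z"
begin

lemma xi_field: "xi M \<in> vfields M UNIV"
  and xi_metric: "rmetric M p (xi M p) (xi M p) = 1"
  using flow unfolding riemannian_flow_def by auto

lemma xi_tangent: "xi M p \<in> tangent M p"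
  using vfield_tangent[OF xi_field] by blast

definition xv :: "'a \<Rightarrow> real^3" where
  "xv q = coords M E q (xi M q)"

lemma xv_inner: "p \<in> U \<Longrightarrow> xv p \<bullet> xv p = 1"
  unfolding xv_def using metric_coords[OF _ xi_tangent xi_tangent] xi_metric by metis

lemma xv_norm: "p \<in> U \<Longrightarrow> norm (xv p) = 1"
  using xv_inner by (simp add: norm_eq_1)

lemma xv_smooth: "p \<in> U \<Longrightarrow> vsmooth_near p xv"
  unfolding xv_def using smooth_coords[OF xi_field] by auto

lemma b_near: "smooth_near (atlas M) p b"
  using smooth_nearI[OF open_UNIV _ b_smooth] by auto

text \<open>In an adapted positive basis \<xi> is the cross product of the other two vectors, so
  Lagrange's formula turns \<open>\<xi> \<times> z\<close> into the expression that defines the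
  rotation. The formula holds for every tangent \<open>z\<close>, since both sides annihilate
  \<xi>.\<close>

lemma flow_J_frame_vec:
  assumes p: "p \<in> U" and z: "z \<in> tangent M p"
  shows "flow_J M p z = frame_vec E p (xv p \<times> coords M E p z)"
  unfolding flow_J_def
proof (rule the_equality)
  have tang: "(\<forall>i::3. vector [xi M p, e1, e2] $ i \<in> tangent M p) \<longleftrightarrow> e1 \<in> tangent M p \<and> e2 \<in> tangent M p"
    for e1 e2 :: "'a tvec"
    by (simp add: forall_3 xi_tangent)
  have rows: "(\<chi> i::3. coords M E p (vector [xi M p, e1, e2] $ i))
      = vector [xv p, coords M E p e1, coords M E p e2]" for e1 e2
    by (simp add: vec_eq_iff forall_3 xv_def)
  have key: "frame_vec E p (xv p \<times> coords M E p z)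
      = rmetric M p z e1 *\<^sub>R e2 - rmetric M p z e2 *\<^sub>R e1"
    if e: "orthonormal_frame M p (vector [xi M p, e1, e2])" "positive_frame M p (vector [xi M p, e1, e2])"
    for e1 e2
  proof -
    let ?y = "coords M E p e1" and ?w = "coords M E p e2"
    have t: "e1 \<in> tangent M p" "e2 \<in> tangent M p"
      and orth: "orthogonal_matrix (vector [xv p, ?y, ?w] :: real^3^3)"
      using e(1) unfolding orthonormal_frame_coords[OF p] rows tang by auto
    have "rmetric M p (vector [xi M p, e1, e2] $ i) (vector [xi M p, e1, e2] $ j)
        = (if i = j then 1 else 0)" for i j :: 3
      using e(1) unfolding orthonormal_frame_def by blast
    from this[of 2 2] this[of 3 3] this[of 2 3]
    have norms: "?y \<bullet> ?y = 1" "?w \<bullet> ?w = 1" "?y \<bullet> ?w = 0"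
      using t p by (simp_all add: metric_coords)
    have "det (vector [xv p, ?y, ?w] :: real^3^3) > 0"
      using e(2) positive_frame_coords[OF p, of "vector [xi M p, e1, e2]"] tang t rows by auto
    \<comment> \<open>An orthogonal determinant is 1 or -1, and positivity of the frame selects 1.
      Two unit vectors with inner product 1 coincide.\<close>
    then have "xv p \<bullet> (?y \<times> ?w) = 1"
      using det_orthogonal_matrix[OF orth] by (auto simp: dot_cross_det)
    then have "(xv p - ?y \<times> ?w) \<bullet> (xv p - ?y \<times> ?w) = 0"
      using norms xv_inner[OF p]
      by (simp add: inner_diff_left inner_diff_right dot_cross inner_commute)
    then have xv: "xv p = ?y \<times> ?w" by simp
    have "xv p \<times> coords M E p z = - (coords M E p z \<times> (?y \<times> ?w))"
      by (simp add: xv cross_skew[of "?y \<times> ?w"])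
    also have "\<dots> = rmetric M p z e1 *\<^sub>R ?w - rmetric M p z e2 *\<^sub>R ?y"
      using p z t by (simp add: Lagrange metric_coords)
    also have "\<dots> = coords M E p (rmetric M p z e1 *\<^sub>R e2 - rmetric M p z e2 *\<^sub>R e1)"
      using p t by (simp add: coords_diff coords_scaleR tangent_scaleR)
    finally show ?thesis
      using frame_vec_coords[OF p] t by (simp add: tangent_diff tangent_scaleR)
  qed
  then show "\<forall>e1 e2. orthonormal_frame M p (vector [xi M p, e1, e2]) \<longrightarrow>
     positive_frame M p (vector [xi M p, e1, e2]) \<longrightarrow>
     frame_vec E p (xv p \<times> coords M E p z) = rmetric M p z e1 *\<^sub>R e2 - rmetric M p z e2 *\<^sub>R e1"
    by blast
  \<comment> \<open>The defining property ranges over positive adapted frames, so uniqueness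
    requires one to exist.\<close>
  obtain y w where yw: "norm y = 1" "norm w = 1" "xv p \<bullet> y = 0" "xv p \<bullet> w = 0" "y \<bullet> w = 0"
    "xv p \<times> y = w" "y \<times> w = xv p" "w \<times> xv p = y"
    using adapted_basis[OF xv_norm[OF p]] by metis
  have t: "frame_vec E p y \<in> tangent M p" "frame_vec E p w \<in> tangent M p"
    using frame_vec_tangent[OF p] by auto
  have "\<forall>i j. (vector [xv p, y, w] :: real^3^3) $ i \<bullet> (vector [xv p, y, w] :: real^3^3) $ j
      = (if i = j then 1 else 0)"
    using yw xv_inner[OF p] by (simp add: forall_3 norm_eq_1 inner_commute)
  moreover have "(\<chi> i::3. coords M E p (vector [xi M p, frame_vec E p y, frame_vec E p w] $ i))
      = vector [xv p, y, w]"
    unfolding rows using p by (simp add: coords_frame_vec)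
  moreover have "coords M E p (vector [xi M p, frame_vec E p y, frame_vec E p w] $ i)
      = (vector [xv p, y, w] :: real^3^3) $ i" for i :: 3
    using p exhaust_3[of i] by (auto simp: coords_frame_vec xv_def)
  ultimately have e: "orthonormal_frame M p (vector [xi M p, frame_vec E p y, frame_vec E p w])"
    "positive_frame M p (vector [xi M p, frame_vec E p y, frame_vec E p w])"
    using p t tang[of "frame_vec E p y" "frame_vec E p w"] xv_inner[OF p]
      positive_frame_coords[OF p, of "vector [xi M p, frame_vec E p y, frame_vec E p w]"]
    by (auto simp: orthonormal_frame_def metric_coords dot_cross_det[symmetric] yw(7))
  fix r
  assume "\<forall>e1 e2. orthonormal_frame M p (vector [xi M p, e1, e2]) \<longrightarrow>
     positive_frame M p (vector [xi M p, e1, e2]) \<longrightarrow>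
     r = rmetric M p z e1 *\<^sub>R e2 - rmetric M p z e2 *\<^sub>R e1"
  then show "r = frame_vec E p (xv p \<times> coords M E p z)"
    using e key[OF e] by simp
qed

lemma flow_J_tangent: "p \<in> U \<Longrightarrow> z \<in> tangent M p \<Longrightarrow> flow_J M p z \<in> tangent M p"
  and coords_flow_J: "p \<in> U \<Longrightarrow> z \<in> tangent M p \<Longrightarrow>
    coords M E p (flow_J M p z) = xv p \<times> coords M E p z"
  by (simp_all add: flow_J_frame_vec frame_vec_tangent coords_frame_vec)

lemma proj_tangent: "v \<in> tangent M p \<Longrightarrow> proj_normal M p v \<in> tangent M p"
  unfolding proj_normal_def by (intro tangent_diff tangent_scaleR xi_tangent)

lemma coords_proj_normal:
  "p \<in> U \<Longrightarrow> v \<in> tangent M p \<Longrightarrow>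
    coords M E p (proj_normal M p v) = coords M E p v - (coords M E p v \<bullet> xv p) *\<^sub>R xv p"
  unfolding proj_normal_def
  by (simp add: coords_diff coords_scaleR tangent_scaleR xi_tangent metric_coords xv_def)

lemma proj_normal_plane:
  "p \<in> U \<Longrightarrow> v \<in> tangent M p \<Longrightarrow> proj_normal M p v \<in> normal_plane M p"
  unfolding normal_plane_def
  using xv_inner by (simp add: proj_tangent metric_coords xi_tangent coords_proj_normal
      inner_diff_left xv_def)

lemma normal_plane_coords:
  "p \<in> U \<Longrightarrow> z \<in> normal_plane M p \<Longrightarrow> z \<in> tangent M p \<and> coords M E p z \<bullet> xv p = 0"
  unfolding normal_plane_def xv_def using metric_coords[OF _ _ xi_tangent] by auto

text \<open>\<open>h_eq\<close> speaks of normal vectors. The \<xi>-part of \<open>v\<close>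
  contributes \<open>flow_kappa\<close>, which is zero, and the cross product annihilates it as
  well, so one formula covers all directions.\<close>

lemma coords_flow_h:
  assumes p: "p \<in> U" and v: "v \<in> tangent M p"
  shows "coords M E p (flow_h M p v) = b p *\<^sub>R (xv p \<times> coords M E p v)"
proof -
  let ?z = "proj_normal M p v"
  have z: "?z \<in> tangent M p" "?z \<in> normal_plane M p"
    using proj_tangent v proj_normal_plane[OF p v] by auto
  have "v = ?z + rmetric M p v (xi M p) *\<^sub>R xi M p"
    by (simp add: proj_normal_def)
  then have "flow_h M p v = flow_h M p ?z + rmetric M p v (xi M p) *\<^sub>R flow_kappa M p"
    unfolding flow_h_def flow_kappa_def
    using nabla_add[OF open_UNIV xi_field UNIV_I z(1) tangent_scaleR[OF xi_tangent]]
      nabla_scaleR[OF open_UNIV xi_field UNIV_I xi_tangent] by metis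
  then have "flow_h M p v = b p *\<^sub>R flow_J M p ?z"
    using kappa h_eq[OF z(2)] by simp
  then show ?thesis
    using p z v by (simp add: coords_scaleR flow_J_tangent coords_flow_J coords_proj_normal
        Cross3.right_diff_distrib cross_mult_right)
qed

lemma cov_xv:
  assumes "p \<in> U" "v \<in> tangent M p"
  shows "cov p v xv = b p *\<^sub>R (xv p \<times> coords M E p v)"
  using coords_flow_h[OF assms] coords_nabla_cov[OF xi_field open_UNIV UNIV_I assms]
  by (simp add: flow_h_def xv_def[abs_def])

text \<open>A second computation of the curvature, on \<xi> only and without spinors: differentiate
  \<open>b *\<^sub>R (\<xi> \<times> Y)\<close>. The derivatives of the fields cancel against the
  bracket. The comparison with the spinorial formula takes place in
  \<open>xi_b_zero\<close>.\<close>

lemma curv_vec_xi: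
  assumes X: "X \<in> vfields M W" and Y: "Y \<in> vfields M W" and W: "open W" "p \<in> W" "p \<in> U"
  defines "x \<equiv> coords M E p (X p)" and "y \<equiv> coords M E p (Y p)"
  shows "curv_vec X Y p \<times> xv p = act (X p) b *\<^sub>R (xv p \<times> y) - act (Y p) b *\<^sub>R (xv p \<times> x)
    + (b p)\<^sup>2 *\<^sub>R ((xv p \<times> x) \<times> y - (xv p \<times> y) \<times> x)"
proof -
  have xiW: "xi M \<in> vfields M W" by (rule vfield_subset[OF xi_field]) simp
  have nn: "coords M E p (nabla M p (X p) (\<lambda>q. nabla M q (Y q) (xi M)))
      = act (X p) b *\<^sub>R (xv p \<times> coords M E p (Y p))
        + b p *\<^sub>R (b p *\<^sub>R (xv p \<times> coords M E p (X p)) \<times> coords M E p (Y p)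
          + xv p \<times> cov p (X p) (\<lambda>q. coords M E q (Y q)))"
    if X: "X \<in> vfields M W" and Y: "Y \<in> vfields M W" for X Y
  proof -
    note Xp = vfield_tangent[OF X W(2)]
    have field: "(\<lambda>q. nabla M q (Y q) (xi M)) \<in> vfields M W"
      by (rule nabla_field[OF W(1) Y xiW])
    have "cov p (X p) (\<lambda>q. coords M E q (nabla M q (Y q) (xi M)))
        = cov p (X p) (\<lambda>q. b q *\<^sub>R (xv q \<times> coords M E q (Y q)))"
      using W open_U vfield_tangent[OF Y] coords_flow_h[unfolded flow_h_def]
      by (intro cov_cong[OF Xp smooth_coords[OF field W], of "W \<inter> U"]) auto
    also have "\<dots> = act (X p) b *\<^sub>R (xv p \<times> coords M E p (Y p))
        + b p *\<^sub>R (cov p (X p) xv \<times> coords M E p (Y p)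
          + xv p \<times> cov p (X p) (\<lambda>q. coords M E q (Y q)))"
      by (simp add: cov_scale[OF Xp b_near] cov_cross[OF Xp] xv_smooth W smooth_coords[OF Y W]
          vsmooth_near_intros)
    finally show ?thesis
      by (simp add: coords_nabla_cov[OF field W Xp] cov_xv[OF W(3) Xp] cross_mult_left)
  qed
  have br: "coords M E p (nabla M p (bracket M X Y p) (xi M))
      = b p *\<^sub>R (xv p \<times> coords M E p (bracket M X Y p))"
    using coords_flow_h[OF W(3) vfield_tangent[OF bracket_field[OF W(1) X Y] W(2)]]
    by (simp add: flow_h_def)
  have "curv_vec X Y p \<times> xv p = coords M E p (curvature_fields M X Y (xi M) p)"
    by (simp add: coords_curvature_fields[OF X Y xiW W] xv_def)
  also have "\<dots> = act (X p) b *\<^sub>R (xv p \<times> y) - act (Y p) b *\<^sub>R (xv p \<times> x)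
    + (b p)\<^sup>2 *\<^sub>R ((xv p \<times> x) \<times> y - (xv p \<times> y) \<times> x)"
    unfolding coords_curvature_fields_diff(1)[OF X Y xiW W] nn[OF X Y] nn[OF Y X] br
      coords_bracket_cov[OF X Y W] x_def y_def
    by (simp add: cross_mult_left Cross3.right_diff_distrib algebra_simps power2_eq_square)
  finally show ?thesis .
qed

end

section \<open>Killing spinors and curvature\<close>

lemma clifford_vec_nth:
  "(clifford x *v \<phi>) $ 1 = Complex (x$3 * Im (\<phi>$1) - x$2 * Re (\<phi>$2) + x$1 * Im (\<phi>$2))
     (- x$3 * Re (\<phi>$1) - x$2 * Im (\<phi>$2) - x$1 * Re (\<phi>$2))"
  "(clifford x *v \<phi>) $ 2 = Complex (x$2 * Re (\<phi>$1) + x$1 * Im (\<phi>$1) - x$3 * Im (\<phi>$2))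
     (x$2 * Im (\<phi>$1) - x$1 * Re (\<phi>$1) + x$3 * Re (\<phi>$2))"
  by (simp_all add: clifford_def matrix_vector_mult_def sum_2 complex_eq_iff)

lemma spinor_eq_iff:
  "\<phi> = \<theta> \<longleftrightarrow> Re (\<phi>$1) = Re (\<theta>$1) \<and> Im (\<phi>$1) = Im (\<theta>$1) \<and> Re (\<phi>$2) = Re (\<theta>$2) \<and> Im (\<phi>$2) = Im (\<theta>$2)"
  for \<phi> \<theta> :: "complex^2"
  by (auto simp: vec_eq_iff forall_2 complex_eq_iff)

lemma clifford_add: "clifford (x + y) *v \<phi> = clifford x *v \<phi> + clifford y *v \<phi>"
  and clifford_scaleR: "clifford (r *\<^sub>R x) *v \<phi> = r *\<^sub>R (clifford x *v \<phi>)"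
  and clifford_diff: "clifford (x - y) *v \<phi> = clifford x *v \<phi> - clifford y *v \<phi>"
  and clifford_minus: "clifford (- x) *v \<phi> = - (clifford x *v \<phi>)"
  by (simp_all add: spinor_eq_iff clifford_vec_nth algebra_simps)

text \<open>The choice of representation enters here: since \<open>- e1 e2 e3\<close> acts as the
  identity, \<open>e1 e2\<close> acts as \<open>e3\<close>, so the cross product appears with a plus
  sign.\<close>

lemma clifford_clifford:
  "clifford x *v (clifford y *v \<phi>) = clifford (x \<times> y) *v \<phi> - (x \<bullet> y) *\<^sub>R \<phi>"
  by (simp add: spinor_eq_iff clifford_vec_nth cross_components inner_vec_def sum_3 algebra_simps)

text \<open>Applying \<open>x\<close> twice multiplies by \<open>- (x \<bullet> x)\<close>. Hence
  equations between real vectors can be tested on a single non-zero spinor.\<close>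

lemma clifford_eq_0:
  assumes "clifford x *v \<phi> = 0" "\<phi> \<noteq> 0"
  shows "x = 0"
proof -
  have "(x \<bullet> x) *\<^sub>R \<phi> = 0"
    using clifford_clifford[of x x \<phi>] assms(1) clifford_scaleR[of 0 0 \<phi>]
    by (simp add: matrix_vector_mult_0_right)
  then show ?thesis using assms(2) by simp
qed

lemma clifford_inject: "\<phi> \<noteq> 0 \<Longrightarrow> clifford x *v \<phi> = clifford y *v \<phi> \<Longrightarrow> x = y"
  using clifford_eq_0[of "x - y" \<phi>] by (simp add: clifford_diff)

text \<open>Ordered pairs are summed, hence the factor 2. With the 1/4 of \<open>nabla_spin\<close>
  the connection acts as half its vector, as the double cover of the rotations by \<open>SU2\<close>
  requires; with the 1/2 of \<open>cmult_form\<close> a two-form acts as its dual vector.\<close>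

lemma clifford_so3:
  "(\<Sum>j\<in>UNIV. \<Sum>k\<in>UNIV. (w \<times> axis j 1) $ k *\<^sub>R
     (clifford (axis j 1) *v (clifford (axis k 1) *v \<phi>))) = 2 *\<^sub>R (clifford w *v \<phi>)"
  by (simp add: sum_3 spinor_eq_iff clifford_vec_nth cross_components axis_def algebra_simps)

text \<open>The real part of the Hermitian product of \<phi> with its image vanishes, because
  \<open>clifford x\<close> is skew-Hermitian. It makes the length of a Killing spinor
  constant.\<close>

lemma clifford_skew:
  "Re (\<phi>$1) * Re ((clifford x *v \<phi>)$1) + Im (\<phi>$1) * Im ((clifford x *v \<phi>)$1)
    + Re (\<phi>$2) * Re ((clifford x *v \<phi>)$2) + Im (\<phi>$2) * Im ((clifford x *v \<phi>)$2) = 0"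
  by (simp add: clifford_vec_nth algebra_simps)

context atlas3
begin

definition ssmooth_near :: "'a \<Rightarrow> ('a \<Rightarrow> complex^2) \<Rightarrow> bool" where
  "ssmooth_near p \<phi> \<longleftrightarrow>
    (\<forall>k. smooth_near A p (\<lambda>q. Re (\<phi> q $ k)) \<and> smooth_near A p (\<lambda>q. Im (\<phi> q $ k)))"

lemma act_spinor_nth:
  "Re (act_spinor v \<phi> $ k) = act v (\<lambda>q. Re (\<phi> q $ k))"
  "Im (act_spinor v \<phi> $ k) = act v (\<lambda>q. Im (\<phi> q $ k))"
  by (simp_all add: act_spinor_def)

lemma act_spinor_cong:
  assumes "v \<in> tangent_space A p" "ssmooth_near p \<phi>" "open W" "p \<in> W" "\<And>q. q \<in> W \<Longrightarrow> \<phi> q = \<theta> q"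
  shows "act_spinor v \<phi> = act_spinor v \<theta>"
proof -
  have "act v (\<lambda>q. Re (\<phi> q $ k)) = act v (\<lambda>q. Re (\<theta> q $ k))"
    "act v (\<lambda>q. Im (\<phi> q $ k)) = act v (\<lambda>q. Im (\<theta> q $ k))" for k
    using assms(2,5) by (auto simp: ssmooth_near_def intro!: act_cong[OF assms(1) _ assms(3,4)])
  then show ?thesis by (simp add: act_spinor_def)
qed

lemma act_spinor_clifford:
  assumes "v \<in> tangent_space A p" "vsmooth_near p a" "ssmooth_near p \<phi>"
  shows "act_spinor v (\<lambda>q. clifford (a q) *v \<phi> q)
    = clifford (vact v a) *v \<phi> p + clifford (a p) *v act_spinor v \<phi>"
  using assms(2,3)
  by (simp add: spinor_eq_iff act_spinor_nth clifford_vec_nth vact_def vsmooth_near_def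
      ssmooth_near_def act_add[OF assms(1)] act_diff[OF assms(1)] act_minus[OF assms(1)]
      act_mult[OF assms(1)] smooth_near_intros algebra_simps)

lemma act_spinor_add: "act_spinor (v + w) \<phi> = act_spinor v \<phi> + act_spinor w \<phi>"
  and act_spinor_scaleR: "act_spinor (r *\<^sub>R v) \<phi> = r *\<^sub>R act_spinor v \<phi>"
  by (simp_all add: spinor_eq_iff act_spinor_nth plus_tvec.rep_eq scaleR_tvec.rep_eq)

lemma act_spinor_bracket:
  "ssmooth_near p \<phi> \<Longrightarrow> act_spinor (lie_bracket A X Y p) \<phi>
    = act_spinor (X p) (\<lambda>q. act_spinor (Y q) \<phi>) - act_spinor (Y p) (\<lambda>q. act_spinor (X q) \<phi>)"
  by (simp add: spinor_eq_iff act_spinor_nth ssmooth_near_def act_bracket)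

lemma ssmooth_near_act_field:
  "X \<in> vector_fields A W \<Longrightarrow> open W \<Longrightarrow> p \<in> W \<Longrightarrow> ssmooth_near p \<phi> \<Longrightarrow>
    ssmooth_near p (\<lambda>q. act_spinor (X q) \<phi>)"
  by (simp add: ssmooth_near_def act_spinor_nth smooth_near_act_field)

end

section \<open>The Killing equation and its integrability condition in a trivialization\<close>

locale killing_frame = flow_frame M U E b
  for M :: "'a::{t2_space,second_countable_topology} flow3" and U E b +
  fixes S :: "('a, 'i) spin3" and i :: 'i and \<psi> :: "'i \<Rightarrow> 'a \<Rightarrow> complex^2" and \<alpha> \<beta> :: real
  assumes U_def: "U = spin_dom S i" and E_def: "E = spin_frame S i"
    and killing: "transversal_killing_spinor M S \<alpha> \<beta> \<psi>"
begin

lemma cmult_coords: "cmult M S i p v = clifford (coords M E p v)"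
  by (simp add: cmult_def coords_def E_def)

lemma coords_frame: "p \<in> U \<Longrightarrow> coords M E p (spin_frame S i p $ k) = axis k 1"
  using E_metric by (simp add: E_def[symmetric] vec_eq_iff coords_nth axis_def)

lemma psi_smooth: "p \<in> U \<Longrightarrow> ssmooth_near p (\<psi> i)"
  using killing open_U smooth_nearI[of U p]
  unfolding transversal_killing_spinor_def spinor_fields_def smooth_cfun_def ssmooth_near_def U_def
  by auto

lemma nabla_spin_clifford:
  assumes p: "p \<in> U" and v: "v \<in> tangent M p"
  shows "nabla_spin M S i p v \<psi>
    = act_spinor v (\<psi> i) + (1/2) *\<^sub>R (clifford (conn M E p v) *v \<psi> i p)"
proof -
  have "rmetric M p (nabla M p v (\<lambda>q. spin_frame S i q $ j)) (spin_frame S i p $ k)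
      = (conn M E p v \<times> axis j 1) $ k" for j k
    using coords_nabla_frame[OF p v, of j] by (simp add: vec_eq_iff coords_nth E_def)
  then show ?thesis
    unfolding nabla_spin_def by (simp add: cmult_coords coords_frame[OF p] clifford_so3)
qed

text \<open>The two-form is dual to \<open>b \<xi>\<close>: it is the triple product of
  \<open>b \<xi>\<close> with its arguments, and projecting these to the normal plane does not
  change that product.\<close>

lemma cmult_Omega:
  assumes p: "p \<in> U"
  shows "cmult_form M S i p (flow_Omega M p) \<phi> = b p *\<^sub>R (clifford (xv p) *v \<phi>)"
proof -
  have "flow_Omega M p v w = ((b p *\<^sub>R xv p) \<times> coords M E p v) \<bullet> coords M E p w"
    if v: "v \<in> tangent M p" and w: "w \<in> tangent M p" for v w
  proof -
    have "flow_h M p (proj_normal M p v) \<in> tangent M p"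
      unfolding flow_h_def
      by (intro nabla_tangent[OF xi_field open_UNIV UNIV_I p] proj_tangent v)
    then show ?thesis
      using p v w by (simp add: flow_Omega_def metric_coords proj_tangent coords_flow_h
          coords_proj_normal Cross3.right_diff_distrib cross_mult_left cross_mult_right
          inner_diff_right dot_cross_self)
  qed
  moreover have "spin_frame S i p $ k \<in> tangent M p" for k
    using E_tangent[OF p] by (simp add: E_def)
  ultimately have "flow_Omega M p (spin_frame S i p $ j) (spin_frame S i p $ k)
      = ((b p *\<^sub>R xv p) \<times> axis j 1) $ k" for j k
    by (simp add: coords_frame[OF p] cart_eq_inner_axis)
  then show ?thesis
    unfolding cmult_form_def by (simp add: cmult_coords coords_frame[OF p] clifford_so3 clifford_scaleR)
qed

text \<open>Origin of the coefficients: along \<xi> the form \<Omega> adds \<open>b / 2\<close> to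
  \<alpha>, and this is \<open>- b / 2 + (\<alpha> + b)\<close>. For normal \<open>Z\<close> the
  term with \<open>h\<close> is half of \<open>\<xi> \<cdot> (b J Z) = - b Z\<close>, and
  \<open>\<beta> \<xi> \<cdot> Z\<close> is \<open>\<beta> (\<xi> \<times> Z)\<close>.\<close>

definition kill :: "'a \<Rightarrow> real^3 \<Rightarrow> real^3" where
  "kill p x = (- b p / 2) *\<^sub>R x + (\<alpha> + b p) *\<^sub>R ((xv p \<bullet> x) *\<^sub>R xv p) + \<beta> *\<^sub>R (xv p \<times> x)"

text \<open>The Killing equation solved for the Levi-Civita derivative: it holds with Clifford
  multiplication by the single vector \<open>kill p v\<close>, since \<open>\<xi> \<cdot> Z = J Z\<close> for \<open>Z\<close> normal to \<open>\<xi>\<close>.\<close>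

lemma act_psi:
  assumes p: "p \<in> U" and v: "v \<in> tangent M p"
  shows "act_spinor v (\<psi> i)
    = clifford (kill p (coords M E p v) - (1/2) *\<^sub>R conn M E p v) *v \<psi> i p"
proof -
  let ?\<phi> = "\<psi> i p"
  have eqs: "nabla_spin_xi M S i p \<psi> = \<alpha> *\<^sub>R (cmult M S i p (xi M p) *v ?\<phi>)"
    "\<And>z. z \<in> normal_plane M p \<Longrightarrow> nabla_spin_normal M S i p z \<psi>
             = \<beta> *\<^sub>R (cmult M S i p (xi M p) *v (cmult M S i p z *v ?\<phi>))"
    using killing p unfolding transversal_killing_spinor_def U_def by auto
  have "act_spinor (xi M p) (\<psi> i) = (\<alpha> + b p / 2) *\<^sub>R (clifford (xv p) *v ?\<phi>)
      - (1/2) *\<^sub>R (clifford (conn M E p (xi M p)) *v ?\<phi>)"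
    \<comment> \<open>The instance at zero says that Clifford multiplication by the zero vector,
      here \<open>flow_kappa\<close>, vanishes.\<close>
    using eqs(1) p kappa clifford_scaleR[of 0 0 ?\<phi>]
    by (simp add: nabla_spin_xi_def nabla_spin_clifford xi_tangent cmult_Omega cmult_coords
        coords_zero xv_def[symmetric] matrix_vector_mult_0_right algebra_simps)
  also have "\<dots> = clifford (kill p (xv p) - (1/2) *\<^sub>R conn M E p (xi M p)) *v ?\<phi>"
  proof -
    have "kill p (xv p) = (\<alpha> + b p / 2) *\<^sub>R xv p"
      by (simp add: kill_def xv_inner[OF p] scaleR_left_diff_distrib[symmetric])
    then show ?thesis by (simp add: clifford_diff clifford_scaleR)
  qed
  finally have xi: "act_spinor (xi M p) (\<psi> i)
    = clifford (kill p (xv p) - (1/2) *\<^sub>R conn M E p (xi M p)) *v ?\<phi>" .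
  let ?z = "proj_normal M p v" and ?x = "coords M E p (proj_normal M p v)"
  have z: "?z \<in> normal_plane M p" "?z \<in> tangent M p" "?x \<bullet> xv p = 0"
    using proj_normal_plane[OF p v] normal_plane_coords[OF p] by auto
  have "act_spinor ?z (\<psi> i) + (1/2) *\<^sub>R (clifford (conn M E p ?z) *v ?\<phi>)
      - (1/2) *\<^sub>R (clifford (xv p) *v (clifford (b p *\<^sub>R (xv p \<times> ?x)) *v ?\<phi>))
      = \<beta> *\<^sub>R (clifford (xv p) *v (clifford ?x *v ?\<phi>))"
    using eqs(2)[OF z(1)] p z(2)
    by (simp add: nabla_spin_normal_def nabla_spin_clifford cmult_coords xv_def[symmetric] coords_flow_h)
  moreover have "clifford (xv p) *v (clifford (b p *\<^sub>R (xv p \<times> ?x)) *v ?\<phi>)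
      = - b p *\<^sub>R (clifford ?x *v ?\<phi>)"
  proof -
    have "xv p \<times> (b p *\<^sub>R (xv p \<times> ?x)) = (- b p) *\<^sub>R ?x"
      using z(3) xv_inner[OF p] by (simp add: cross_mult_right Lagrange inner_commute)
    then show ?thesis
      unfolding clifford_clifford by (simp only: clifford_scaleR) (simp add: dot_cross_self)
  qed
  ultimately have "act_spinor ?z (\<psi> i)
      = clifford (kill p ?x - (1/2) *\<^sub>R conn M E p ?z) *v ?\<phi>"
    using z(3) by (simp add: clifford_clifford dot_cross_self kill_def clifford_add clifford_diff
        clifford_scaleR inner_commute algebra_simps)
  \<comment> \<open>The equation is now known on \<xi> and on the normal plane; all its ingredients
    are linear in the direction.\<close>
  moreover have v_eq: "v = ?z + rmetric M p v (xi M p) *\<^sub>R xi M p"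
    by (simp add: proj_normal_def)
  moreover have "coords M E p v = ?x + rmetric M p v (xi M p) *\<^sub>R xv p"
    using p v by (simp add: coords_proj_normal metric_coords xi_tangent xv_def)
  moreover have "conn M E p v = conn M E p ?z + rmetric M p v (xi M p) *\<^sub>R conn M E p (xi M p)"
    by (subst v_eq) (simp add: conn_add conn_scaleR p z(2) tangent_scaleR xi_tangent)
  moreover have "act_spinor v (\<psi> i)
      = act_spinor ?z (\<psi> i) + rmetric M p v (xi M p) *\<^sub>R act_spinor (xi M p) (\<psi> i)"
    by (subst v_eq) (simp add: act_spinor_add act_spinor_scaleR)
  moreover have "kill p (x + r *\<^sub>R y) = kill p x + r *\<^sub>R kill p y" for x y r
    by (simp add: kill_def inner_add_right cross_add_right cross_mult_right algebra_simps)
  ultimately show ?thesis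
    by (simp add: xi clifford_add clifford_diff clifford_scaleR scaleR_right_distrib
        scaleR_right_diff_distrib)
qed

text \<open>Leibniz rule for \<open>kill\<close> as an endomorphism field. Besides
  \<open>kill\<close> of the derivative of \<open>Y\<close> only the derivative of the coefficients
  remains, through \<open>b\<close> and, by \<open>cov_xv\<close>, through \<xi>; these terms are
  the \<open>D\<close> of \<open>killing_curvature_algebra\<close>.\<close>

lemma cov_kill:
  assumes Y: "Y \<in> vfields M W" and W: "open W" "p \<in> W" "p \<in> U" and v: "v \<in> tangent M p"
  defines "y \<equiv> coords M E p (Y p)" and "x \<equiv> coords M E p v"
  shows "vsmooth_near p (\<lambda>q. kill q (coords M E q (Y q)))"
    and "cov p v (\<lambda>q. kill q (coords M E q (Y q)))
    = kill p (cov p v (\<lambda>q. coords M E q (Y q)))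
      - (act v b / 2) *\<^sub>R y + act v b *\<^sub>R ((xv p \<bullet> y) *\<^sub>R xv p)
      + ((\<alpha> + b p) * b p) *\<^sub>R (((xv p \<times> x) \<bullet> y) *\<^sub>R xv p + (xv p \<bullet> y) *\<^sub>R (xv p \<times> x))
      + (\<beta> * b p) *\<^sub>R ((xv p \<times> x) \<times> y)"
proof -
  have mult: "smooth_near (atlas M) p (\<lambda>q. - b q / 2)" "smooth_near (atlas M) p (\<lambda>q. \<alpha> + b q)"
    using smooth_near_mult[OF smooth_near_const b_near, of p "-1/2"] b_near
    by (auto intro: smooth_near_intros)
  have act_b: "act v (\<lambda>q. - b q / 2) = - act v b / 2" "act v (\<lambda>q. \<alpha> + b q) = act v b"
    using act_scale[OF v b_near, of "-1/2"] act_add[OF v smooth_near_const b_near, of \<alpha>] act_const[OF v]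
    by auto
  note smooth = xv_smooth[OF W(3)] smooth_coords[OF Y W]
  show "vsmooth_near p (\<lambda>q. kill q (coords M E q (Y q)))"
    unfolding kill_def by (intro vsmooth_near_intros mult smooth smooth_near_const)
  show "cov p v (\<lambda>q. kill q (coords M E q (Y q)))
    = kill p (cov p v (\<lambda>q. coords M E q (Y q)))
      - (act v b / 2) *\<^sub>R y + act v b *\<^sub>R ((xv p \<bullet> y) *\<^sub>R xv p)
      + ((\<alpha> + b p) * b p) *\<^sub>R (((xv p \<times> x) \<bullet> y) *\<^sub>R xv p + (xv p \<bullet> y) *\<^sub>R (xv p \<times> x))
      + (\<beta> * b p) *\<^sub>R ((xv p \<times> x) \<times> y)"
    unfolding kill_def
    by (simp only: cov_add[OF v] cov_scale[OF v] cov_cross[OF v] act_inner_cov[OF v] mult smooth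
        vsmooth_near_intros smooth_near_const act_const[OF v] act_b cov_xv[OF W(3) v]
        x_def[symmetric] y_def[symmetric])
      (simp add: cross_mult_left algebra_simps)
qed

text \<open>The integrability condition of the Killing equation: the spinorial curvature is Clifford
  multiplication by half the curvature vector, and Clifford multiplication by a vector is injective
  on a non-zero spinor.\<close>

lemma curv_vec_kill:
  assumes X: "X \<in> vfields M W" and Y: "Y \<in> vfields M W" and W: "open W" "p \<in> W" "p \<in> U"
    and nz: "\<psi> i p \<noteq> 0"
  defines "x \<equiv> coords M E p (X p)" and "y \<equiv> coords M E p (Y p)"
  shows "curv_vec X Y p = 2 *\<^sub>R (cov p (X p) (\<lambda>q. kill q (coords M E q (Y q)))
    - cov p (Y p) (\<lambda>q. kill q (coords M E q (X q))) - kill p (coords M E p (bracket M X Y p))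
    + 2 *\<^sub>R (kill p y \<times> kill p x))" (is "?l = ?r")
proof -
  \<comment> \<open>The connection is absorbed, so that the spinor satisfies a linear equation with
    plain derivatives, and the bracket identity for plain derivatives applies.\<close>
  define a where "a X q = kill q (coords M E q (X q)) - (1/2) *\<^sub>R conn M E q (X q)" for X q
  have a_smooth: "vsmooth_near p (a X)" if X: "X \<in> vfields M W" for X
    unfolding a_def using cov_kill(1)[OF X W vfield_tangent[OF X W(2)]] conn_smooth[OF X W]
    by (intro vsmooth_near_intros smooth_near_const)
  have second: "act_spinor (X p) (\<lambda>q. act_spinor (Y q) (\<psi> i))
      = clifford (vact (X p) (a Y)) *v \<psi> i p + clifford (a Y p) *v (clifford (a X p) *v \<psi> i p)"
    if X: "X \<in> vfields M W" and Y: "Y \<in> vfields M W" for X Y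
  proof -
    note Xp = vfield_tangent[OF X W(2)]
    have "act_spinor (X p) (\<lambda>q. act_spinor (Y q) (\<psi> i))
        = act_spinor (X p) (\<lambda>q. clifford (a Y q) *v \<psi> i q)"
      using W open_U vfield_tangent[OF Y] act_psi
      by (intro act_spinor_cong[OF Xp ssmooth_near_act_field[OF Y W(1,2) psi_smooth], of "W \<inter> U"])
        (auto simp: a_def)
    also have "\<dots> = clifford (vact (X p) (a Y)) *v \<psi> i p + clifford (a Y p) *v act_spinor (X p) (\<psi> i)"
      by (rule act_spinor_clifford[OF Xp a_smooth[OF Y] psi_smooth[OF W(3)]])
    finally show ?thesis using act_psi[OF W(3) Xp] by (simp add: a_def)
  qed
  have "clifford (kill p (coords M E p (bracket M X Y p)) - (1/2) *\<^sub>R conn M E p (bracket M X Y p)) *v \<psi> i p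
      = act_spinor (bracket M X Y p) (\<psi> i)"
    using act_psi[OF W(3) vfield_tangent[OF bracket_field[OF W(1) X Y] W(2)]] by simp
  \<comment> \<open>The commutator of two Clifford multiplications is twice the cross product, the
    inner products being symmetric. The order is \<open>Y\<close> before \<open>X\<close> because
    differentiating \<open>a Y\<close> times the spinor along \<open>X\<close> puts
    \<open>a X\<close> innermost.\<close>
  also have "\<dots> = clifford (vact (X p) (a Y) - vact (Y p) (a X) + 2 *\<^sub>R (a Y p \<times> a X p)) *v \<psi> i p"
    unfolding act_spinor_bracket[OF psi_smooth[OF W(3)]] second[OF X Y] second[OF Y X]
      clifford_clifford
    by (simp only: clifford_diff clifford_add clifford_scaleR clifford_minus inner_commute
        cross_skew[of "a X p" "a Y p"]) (simp add: scaleR_2)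
  finally have eq: "kill p (coords M E p (bracket M X Y p)) - (1/2) *\<^sub>R conn M E p (bracket M X Y p)
      = vact (X p) (a Y) - vact (Y p) (a X) + 2 *\<^sub>R (a Y p \<times> a X p)"
    by (rule clifford_inject[OF nz])
  have vact_a: "vact (X p) (a Y) = vact (X p) (\<lambda>q. kill q (coords M E q (Y q)))
      - (1/2) *\<^sub>R vact (X p) (\<lambda>q. conn M E q (Y q))"
    if X: "X \<in> vfields M W" and Y: "Y \<in> vfields M W" for X Y
  proof -
    note Xp = vfield_tangent[OF X W(2)]
    show ?thesis
      unfolding a_def
      using cov_kill(1)[OF Y W vfield_tangent[OF Y W(2)]] conn_smooth[OF Y W]
      by (simp add: vact_diff[OF Xp] vact_scale[OF Xp smooth_near_const] act_const[OF Xp]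
          vsmooth_near_scale smooth_near_const)
  qed
  \<comment> \<open>The mixed terms complete the plain derivatives of \<open>kill\<close> to
    covariant ones, and the last term completes the derivatives of \<open>conn\<close> to half of
    \<open>curv_vec\<close>.\<close>
  have aa: "a Y p \<times> a X p = kill p y \<times> kill p x
      - (1/2) *\<^sub>R (kill p y \<times> conn M E p (X p)) + (1/2) *\<^sub>R (kill p x \<times> conn M E p (Y p))
      - (1/4) *\<^sub>R (conn M E p (X p) \<times> conn M E p (Y p))"
    unfolding a_def x_def y_def
    by (simp add: Cross3.left_diff_distrib Cross3.right_diff_distrib cross_mult_left cross_mult_right
        cross_skew[of "conn M E p (Y p)"] algebra_simps)
  show "?l = ?r"
  proof (rule vec_eq_iff[THEN iffD2], rule allI)
    fix k
    note comp = arg_cong[where f = "\<lambda>u. u $ k"]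
    show "?l $ k = ?r $ k"
      using comp[OF eq] comp[OF aa] comp[OF vact_a[OF X Y]] comp[OF vact_a[OF Y X]]
      by (simp add: curv_vec_def cov_def x_def[symmetric] y_def[symmetric]
          cross_skew[of "conn M E p (X p)" "kill p y"] cross_skew[of "conn M E p (Y p)" "kill p x"])
  qed
qed

end

section \<open>The curvature operator\<close>

text \<open>With \<open>n\<close> the coordinates of \<open>\<xi>\<close> and \<open>j\<close> those of \<open>J(db)\<close>, the curvature will turn out to be
  \<open>R(X,Y)Z = curv_op (X \<times> Y) \<times> Z\<close>.\<close>

definition curv_op :: "real \<Rightarrow> real \<Rightarrow> real \<Rightarrow> real^3 \<Rightarrow> real^3 \<Rightarrow> real^3 \<Rightarrow> real^3" where
  "curv_op \<alpha> \<beta> b n j m = (- b\<^sup>2) *\<^sub>R m + (4 * \<alpha> * b + 4 * b\<^sup>2 - 4 * \<beta>\<^sup>2) *\<^sub>R ((n \<bullet> m) *\<^sub>R n)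
     - (n \<bullet> m) *\<^sub>R j - (j \<bullet> m) *\<^sub>R n"

text \<open>The remainder is orthogonal to \<open>y\<close> and \<open>z\<close>, hence by Lagrange
  parallel to \<open>n = y \<times> z\<close>, and it is also orthogonal to
  \<open>n\<close>.\<close>

lemma adapted_expansion:
  fixes n y z v :: "real^3"
  assumes "norm n = 1" "n \<bullet> y = 0" "n \<bullet> z = 0" "y \<bullet> z = 0" "norm y = 1" "norm z = 1" "y \<times> z = n"
  shows "v = (v \<bullet> n) *\<^sub>R n + (v \<bullet> y) *\<^sub>R y + (v \<bullet> z) *\<^sub>R z"
proof -
  define d where "d = v - ((v \<bullet> n) *\<^sub>R n + (v \<bullet> y) *\<^sub>R y + (v \<bullet> z) *\<^sub>R z)"
  have d: "d \<bullet> n = 0" "d \<bullet> y = 0" "d \<bullet> z = 0"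
    using assms inner_commute[of y n] inner_commute[of z n] inner_commute[of z y]
    by (simp_all add: d_def inner_diff_left inner_add_left norm_eq_1)
  then have "d \<times> n = 0"
    by (simp add: assms(7)[symmetric] Lagrange)
  then have "d = 0"
    using d(1) norm_and_cross_eq_0[of d n] assms(1) by auto
  then show ?thesis by (simp add: d_def)
qed

text \<open>Both sides are bilinear and skew in \<open>x\<close> and \<open>y\<close>, so only
  \<open>x \<times> y\<close> matters; the check is by components in an adapted basis. On the right,
  \<open>curv_op\<close> is the symmetric part of the resulting operator and the last term its
  antisymmetric part. Here \<open>w\<close> stands for the gradient of \<open>b\<close>.\<close>

lemma killing_curvature_algebra:
  fixes n w x y :: "real^3" and \<alpha> \<beta> b :: real
  assumes n: "norm n = 1"
  defines "K \<equiv> \<lambda>x. (- b / 2) *\<^sub>R x + (\<alpha> + b) *\<^sub>R ((n \<bullet> x) *\<^sub>R n) + \<beta> *\<^sub>R (n \<times> x)"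
    and "D \<equiv> \<lambda>x y. - ((w \<bullet> x) / 2) *\<^sub>R y + (w \<bullet> x) *\<^sub>R ((n \<bullet> y) *\<^sub>R n)
      + ((\<alpha> + b) * b) *\<^sub>R (((n \<times> x) \<bullet> y) *\<^sub>R n + (n \<bullet> y) *\<^sub>R (n \<times> x))
      + (\<beta> * b) *\<^sub>R ((n \<times> x) \<times> y)"
  shows "2 *\<^sub>R (D x y - D y x + 2 *\<^sub>R (K y \<times> K x))
    = curv_op \<alpha> \<beta> b n (n \<times> w) (x \<times> y) - (4 * \<alpha> * \<beta> - w \<bullet> n) *\<^sub>R (n \<times> (x \<times> y))" (is "?l = ?r")
proof -
  obtain e f where ef: "norm e = 1" "norm f = 1" "n \<bullet> e = 0" "n \<bullet> f = 0" "e \<bullet> f = 0"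
    "n \<times> e = f" "e \<times> f = n" "f \<times> n = e"
    using adapted_basis[OF n] by metis
  have tab: "n \<bullet> n = 1" "e \<bullet> e = 1" "f \<bullet> f = 1" "e \<bullet> n = 0" "f \<bullet> n = 0" "f \<bullet> e = 0"
    "e \<times> n = - f" "f \<times> e = - n" "n \<times> f = - e"
    using n ef by (simp_all add: norm_eq_1 inner_commute cross_skew[of e n] cross_skew[of f e] cross_skew[of n f])
  note expand = adapted_expansion[OF n ef(3,4,5,1,2,7)]
  define x0 x1 x2 where "x0 = x \<bullet> n" and "x1 = x \<bullet> e" and "x2 = x \<bullet> f"
  define y0 y1 y2 where "y0 = y \<bullet> n" and "y1 = y \<bullet> e" and "y2 = y \<bullet> f"
  define w0 w1 w2 where "w0 = w \<bullet> n" and "w1 = w \<bullet> e" and "w2 = w \<bullet> f"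
  have x: "x = x0 *\<^sub>R n + x1 *\<^sub>R e + x2 *\<^sub>R f" and y: "y = y0 *\<^sub>R n + y1 *\<^sub>R e + y2 *\<^sub>R f"
    and w: "w = w0 *\<^sub>R n + w1 *\<^sub>R e + w2 *\<^sub>R f"
    using expand[of x] expand[of y] expand[of w]
    unfolding x0_def x1_def x2_def y0_def y1_def y2_def w0_def w1_def w2_def by auto
  have cx: "n \<times> x = (- x2) *\<^sub>R e + x1 *\<^sub>R f" and cy: "n \<times> y = (- y2) *\<^sub>R e + y1 *\<^sub>R f"
    and cw: "n \<times> w = (- w2) *\<^sub>R e + w1 *\<^sub>R f"
    by (simp_all add: x y w cross_add_right cross_mult_right ef(3-8) tab)
  have cross: "(a0 *\<^sub>R n + a1 *\<^sub>R e + a2 *\<^sub>R f) \<times> (c0 *\<^sub>R n + c1 *\<^sub>R e + c2 *\<^sub>R f)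
      = (a1 * c2 - a2 * c1) *\<^sub>R n + (a2 * c0 - a0 * c2) *\<^sub>R e + (a0 * c1 - a1 * c0) *\<^sub>R f"
    for a0 a1 a2 c0 c1 c2
    by (simp add: cross_add_left cross_add_right cross_mult_left cross_mult_right ef(3-8) tab algebra_simps)
  have inner: "(a0 *\<^sub>R n + a1 *\<^sub>R e + a2 *\<^sub>R f) \<bullet> (c0 *\<^sub>R n + c1 *\<^sub>R e + c2 *\<^sub>R f)
      = a0 * c0 + a1 * c1 + a2 * c2" for a0 a1 a2 c0 c1 c2
    by (simp add: inner_add_left inner_add_right ef(3-8) tab)
  have add: "(a0 *\<^sub>R n + a1 *\<^sub>R e + a2 *\<^sub>R f) + (c0 *\<^sub>R n + c1 *\<^sub>R e + c2 *\<^sub>R f)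
      = (a0 + c0) *\<^sub>R n + (a1 + c1) *\<^sub>R e + (a2 + c2) *\<^sub>R f" for a0 a1 a2 c0 c1 c2
    by (simp add: algebra_simps)
  have sub: "(a0 *\<^sub>R n + a1 *\<^sub>R e + a2 *\<^sub>R f) - (c0 *\<^sub>R n + c1 *\<^sub>R e + c2 *\<^sub>R f)
      = (a0 - c0) *\<^sub>R n + (a1 - c1) *\<^sub>R e + (a2 - c2) *\<^sub>R f" for a0 a1 a2 c0 c1 c2
    by (simp add: algebra_simps)
  have scale: "r *\<^sub>R (a0 *\<^sub>R n + a1 *\<^sub>R e + a2 *\<^sub>R f)
      = (r * a0) *\<^sub>R n + (r * a1) *\<^sub>R e + (r * a2) *\<^sub>R f" for r a0 a1 a2
    by (simp add: algebra_simps)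
  \<comment> \<open>A second name for \<open>n\<close>, already in expanded form: unfolding then
    rewrites \<open>n\<close> where it is an argument and leaves it alone where it is a basis
    vector.\<close>
  define N where "N = 1 *\<^sub>R n + 0 *\<^sub>R e + 0 *\<^sub>R f"
  have eqI: "a0 = c0 \<Longrightarrow> a1 = c1 \<Longrightarrow> a2 = c2 \<Longrightarrow> a0 *\<^sub>R n + a1 *\<^sub>R e + a2 *\<^sub>R f
      = c0 *\<^sub>R n + c1 *\<^sub>R e + c2 *\<^sub>R f" for a0 a1 a2 c0 c1 c2
    by simp
  have N: "n = N" by (simp add: N_def)
  have "2 *\<^sub>R ((- ((w \<bullet> x) / 2) *\<^sub>R y + (w \<bullet> x) *\<^sub>R ((N \<bullet> y) *\<^sub>R N)
      + ((\<alpha> + b) * b) *\<^sub>R (((N \<times> x) \<bullet> y) *\<^sub>R N + (N \<bullet> y) *\<^sub>R (N \<times> x))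
      + (\<beta> * b) *\<^sub>R ((N \<times> x) \<times> y))
      - (- ((w \<bullet> y) / 2) *\<^sub>R x + (w \<bullet> y) *\<^sub>R ((N \<bullet> x) *\<^sub>R N)
      + ((\<alpha> + b) * b) *\<^sub>R (((N \<times> y) \<bullet> x) *\<^sub>R N + (N \<bullet> x) *\<^sub>R (N \<times> y))
      + (\<beta> * b) *\<^sub>R ((N \<times> y) \<times> x))
      + 2 *\<^sub>R (((- b / 2) *\<^sub>R y + (\<alpha> + b) *\<^sub>R ((N \<bullet> y) *\<^sub>R N) + \<beta> *\<^sub>R (N \<times> y))
        \<times> ((- b / 2) *\<^sub>R x + (\<alpha> + b) *\<^sub>R ((N \<bullet> x) *\<^sub>R N) + \<beta> *\<^sub>R (N \<times> x))))
    = (- b\<^sup>2) *\<^sub>R (x \<times> y) + (4 * \<alpha> * b + 4 * b\<^sup>2 - 4 * \<beta>\<^sup>2) *\<^sub>R ((N \<bullet> (x \<times> y)) *\<^sub>R N)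
     - (N \<bullet> (x \<times> y)) *\<^sub>R (N \<times> w) - ((N \<times> w) \<bullet> (x \<times> y)) *\<^sub>R N
     - (4 * \<alpha> * \<beta> - w \<bullet> N) *\<^sub>R (N \<times> (x \<times> y))"
    unfolding N_def x y w cross inner add sub scale
    by (rule eqI; simp add: field_simps power2_eq_square)
  then show ?thesis
    unfolding K_def D_def curv_op_def N[symmetric] .
qed

lemma curv_op_add: "curv_op \<alpha> \<beta> b n j (x + y) = curv_op \<alpha> \<beta> b n j x + curv_op \<alpha> \<beta> b n j y"
  and curv_op_scaleR: "curv_op \<alpha> \<beta> b n j (r *\<^sub>R x) = r *\<^sub>R curv_op \<alpha> \<beta> b n j x"
  by (simp_all add: curv_op_def inner_add_right algebra_simps)

text \<open>In dimension three the Ricci tensor is the curvature operator minus its trace.\<close>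

definition ricci_op :: "real \<Rightarrow> real \<Rightarrow> real \<Rightarrow> real^3 \<Rightarrow> real^3 \<Rightarrow> real^3 \<Rightarrow> real^3" where
  "ricci_op \<alpha> \<beta> b n j v = (4 * \<beta>\<^sup>2 - 2 * b\<^sup>2 - 4 * \<alpha> * b) *\<^sub>R v
     + (4 * \<alpha> * b + 4 * b\<^sup>2 - 4 * \<beta>\<^sup>2) *\<^sub>R ((v \<bullet> n) *\<^sub>R n) - (v \<bullet> j) *\<^sub>R n - (v \<bullet> n) *\<^sub>R j"

lemma trace_matrix: "trace (matrix f) = (\<Sum>i\<in>UNIV. f (axis i 1) $ i)" for f :: "real^3 \<Rightarrow> real^3"
  by (simp add: trace_def matrix_def)

lemma trace_curv_op:
  assumes "n \<bullet> n = 1" "n \<bullet> j = 0"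
  shows "trace (matrix (\<lambda>x. curv_op \<alpha> \<beta> b n j (x \<times> v) \<times> z)) = ricci_op \<alpha> \<beta> b n j v \<bullet> z"
proof -
  \<comment> \<open>Stated before the assumptions on \<open>n\<close> and \<open>j\<close> are used,
    this is a polynomial identity in components.\<close>
  have gen: "(\<Sum>i\<in>UNIV. ((s *\<^sub>R (axis i 1 \<times> v) + r *\<^sub>R ((n \<bullet> (axis i 1 \<times> v)) *\<^sub>R n)
      - (n \<bullet> (axis i 1 \<times> v)) *\<^sub>R j - (j \<bullet> (axis i 1 \<times> v)) *\<^sub>R n) \<times> z) $ i)
    = - 2 * s * (v \<bullet> z) + r * ((v \<bullet> n) * (n \<bullet> z) - (v \<bullet> z) * (n \<bullet> n))
      - ((v \<bullet> j) * (n \<bullet> z) - (v \<bullet> z) * (n \<bullet> j)) - ((v \<bullet> n) * (j \<bullet> z) - (v \<bullet> z) * (j \<bullet> n))" for s r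
    by (simp add: sum_3 cross_components axis_def inner_vec_def algebra_simps)
  show ?thesis
    unfolding trace_matrix curv_op_def gen
    using assms by (simp add: ricci_op_def inner_add_left inner_diff_left inner_commute algebra_simps)
qed

lemma trace_ricci_op:
  assumes "n \<bullet> n = 1" "n \<bullet> j = 0"
  shows "trace (matrix (ricci_op \<alpha> \<beta> b n j)) = 2 * (4 * \<beta>\<^sup>2 - b\<^sup>2 - 4 * \<alpha> * b)"
proof -
  have gen: "(\<Sum>i\<in>UNIV. (s *\<^sub>R axis i 1 + r *\<^sub>R ((axis i 1 \<bullet> n) *\<^sub>R n)
      - (axis i 1 \<bullet> j) *\<^sub>R n - (axis i 1 \<bullet> n) *\<^sub>R j) $ i)
    = 3 * s + r * (n \<bullet> n) - 2 * (n \<bullet> j)" for s r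
    by (simp add: sum_3 axis_def inner_vec_def algebra_simps)
  show ?thesis
    unfolding trace_matrix ricci_op_def gen using assms by (simp add: algebra_simps)
qed

lemma linear_ricci_op: "linear (ricci_op \<alpha> \<beta> b n j)"
  by (rule linearI) (simp_all add: ricci_op_def inner_add_left algebra_simps)

lemma linear_curv_op_cross: "linear (\<lambda>x. curv_op \<alpha> \<beta> b n j (x \<times> v) \<times> z)"
  by (rule linearI) (simp_all add: cross_add_left cross_mult_left curv_op_add curv_op_scaleR)

section \<open>Curvature and the function \<open>b\<close> in the presence of a Killing
  spinor\<close>

context killing_frame
begin

abbreviation "w \<equiv> grad_coords b"

text \<open>By linearity of \<open>kill\<close> and torsion-freeness the derivatives of the fields
  cancel against the bracket. What is left depends on the values at \<open>p\<close> only.\<close>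

lemma curv_vec_curv_op:
  assumes X: "X \<in> vfields M W" and Y: "Y \<in> vfields M W" and W: "open W" "p \<in> W" "p \<in> U"
    and nz: "\<psi> i p \<noteq> 0"
  defines "m \<equiv> coords M E p (X p) \<times> coords M E p (Y p)"
  shows "curv_vec X Y p = curv_op \<alpha> \<beta> (b p) (xv p) (xv p \<times> w p) m
    - (4 * \<alpha> * \<beta> - w p \<bullet> xv p) *\<^sub>R (xv p \<times> m)"
proof -
  note Xp = vfield_tangent[OF X W(2)] and Yp = vfield_tangent[OF Y W(2)]
  have lin: "kill p (x - y) = kill p x - kill p y" for x y
    by (simp add: kill_def inner_diff_right Cross3.right_diff_distrib algebra_simps)
  show ?thesis
    unfolding m_def killing_curvature_algebra[OF xv_norm[OF W(3)], symmetric]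
      curv_vec_kill[OF X Y W nz] cov_kill(2)[OF Y W Xp] cov_kill(2)[OF X W Yp]
      coords_bracket_cov[OF X Y W] lin act_grad_coords[OF W(3) Xp] act_grad_coords[OF W(3) Yp]
    by (simp add: kill_def)
qed

text \<open>Two independent constraints on the antisymmetric part: Bianchi makes its factor
  \<open>c\<close> vanish, and the curvature on \<xi> then makes \<open>\<xi>(b)\<close> vanish.
  Together they give the condition on the constants.\<close>

lemma xi_b_zero:
  assumes p: "p \<in> U" and nz: "\<psi> i p \<noteq> 0"
  shows "w p \<bullet> xv p = 0" and "\<alpha> * \<beta> = 0"
proof -
  let ?n = "xv p"
  obtain e f where ef: "norm e = 1" "norm f = 1" "?n \<bullet> e = 0" "?n \<bullet> f = 0" "e \<bullet> f = 0"
    "?n \<times> e = f" "e \<times> f = ?n" "f \<times> ?n = e"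
    using adapted_basis[OF xv_norm[OF p]] by metis
  have tab: "?n \<bullet> ?n = 1" "e \<bullet> e = 1" "f \<bullet> f = 1" "e \<bullet> ?n = 0" "f \<bullet> ?n = 0" "f \<bullet> e = 0"
    "e \<times> ?n = - f" "f \<times> e = - ?n" "?n \<times> f = - e"
    using xv_norm[OF p] ef
    by (simp_all add: norm_eq_1 inner_commute cross_skew[of e ?n] cross_skew[of f e] cross_skew[of ?n f])
  define c where "c = 4 * \<alpha> * \<beta> - w p \<bullet> ?n"
  define j where "j = ?n \<times> w p"
  have curv: "curv_vec (\<lambda>q. frame_vec E q x) (\<lambda>q. frame_vec E q y) p
      = curv_op \<alpha> \<beta> (b p) ?n j (x \<times> y) - c *\<^sub>R (?n \<times> (x \<times> y))" for x y
    using curv_vec_curv_op[OF extension_field extension_field open_U p p nz, of x y] p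
    by (simp add: coords_frame_vec c_def j_def)
  have "j \<bullet> ?n = 0" by (simp add: j_def dot_cross_self)
  \<comment> \<open>In the basis \<open>?n, e, f\<close> the Bianchi sum is the sum of
    \<open>F m \<times> m\<close>, to which a symmetric \<open>F\<close> contributes nothing; the
    antisymmetric part contributes \<open>c *\<^sub>R ?n\<close> from \<open>e\<close> and again
    from \<open>f\<close>.\<close>
  have "((curv_op \<alpha> \<beta> (b p) ?n j f - c *\<^sub>R (?n \<times> f)) \<times> f
      + (curv_op \<alpha> \<beta> (b p) ?n j ?n - c *\<^sub>R (?n \<times> ?n)) \<times> ?n
      + (curv_op \<alpha> \<beta> (b p) ?n j e - c *\<^sub>R (?n \<times> e)) \<times> e) \<bullet> ?n = 0"
    using bianchi[OF extension_field extension_field extension_field open_U p p, of ?n e f] p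
    by (simp add: coords_frame_vec curv ef)
  \<comment> \<open>Here \<open>2 * ?n\<close> is the componentwise product, that is, the sum of two
    copies of \<open>?n\<close>.\<close>
  moreover have "(2 * ?n) \<bullet> ?n = 2"
    by (simp only: mult_2 inner_add_left tab)
  ultimately have c: "c = 0"
    by (simp add: curv_op_def ef tab cross_mult_left cross_add_left Cross3.left_diff_distrib
        inner_add_left inner_diff_left dot_cross_self)
  \<comment> \<open>This is R(\<xi>, e)\<xi> computed from \<xi> alone. Its component along
    \<open>f\<close> is \<open>\<xi>(b)\<close>, whereas the operator found from the spinor has no
    such component.\<close>
  have "curv_op \<alpha> \<beta> (b p) ?n j f \<times> ?n
      = (w p \<bullet> ?n) *\<^sub>R f - (b p)\<^sup>2 *\<^sub>R e"
    using curv_vec_xi[OF extension_field extension_field open_U p p, of ?n e] p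
    by (simp add: coords_frame_vec curv c ef act_grad_coords[OF p frame_vec_tangent])
  then have "(curv_op \<alpha> \<beta> (b p) ?n j f \<times> ?n) \<bullet> f = w p \<bullet> ?n"
    by (simp add: ef tab inner_diff_left)
  moreover have "(curv_op \<alpha> \<beta> (b p) ?n j f \<times> ?n) \<bullet> f = 0"
    by (simp add: curv_op_def ef tab cross_mult_left cross_add_left Cross3.left_diff_distrib
        inner_add_left inner_diff_left)
  ultimately show "w p \<bullet> ?n = 0" by simp
  then show "\<alpha> * \<beta> = 0" using c by (simp add: c_def)
qed

text \<open>Since \<open>\<xi>(b)\<close> vanishes, the gradient of \<open>b\<close> is already
  normal, and the projection in \<open>normal_gradient\<close> has no effect.\<close>

lemma normal_gradient_coords:
  assumes "p \<in> U" "\<psi> i p \<noteq> 0"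
  shows "normal_gradient M b p = frame_vec E p (w p)"
    and "flow_J M p (normal_gradient M b p) = frame_vec E p (xv p \<times> w p)"
proof -
  show eq: "normal_gradient M b p = frame_vec E p (w p)"
    unfolding normal_gradient_def proj_normal_def gradient_coords[OF assms(1)]
    using assms xi_b_zero(1)[OF assms]
    by (simp add: metric_coords frame_vec_tangent xi_tangent coords_frame_vec xv_def[symmetric])
  show "flow_J M p (normal_gradient M b p) = frame_vec E p (xv p \<times> w p)"
    unfolding eq using assms(1) by (simp add: flow_J_frame_vec frame_vec_tangent coords_frame_vec)
qed

lemma curvature_curv_op:
  assumes p: "p \<in> U" and nz: "\<psi> i p \<noteq> 0"
    and t: "u \<in> tangent M p" "v \<in> tangent M p" "z \<in> tangent M p"
  shows "curvature M p u v z = frame_vec E p (curv_op \<alpha> \<beta> (b p) (xv p) (xv p \<times> w p)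
      (coords M E p u \<times> coords M E p v) \<times> coords M E p z)"
  using xi_b_zero[OF p nz]
  by (intro coords_curvature[OF _ p t, of "\<lambda>x y. curv_op \<alpha> \<beta> (b p) (xv p) (xv p \<times> w p) (x \<times> y)"])
    (simp add: curv_vec_curv_op[OF _ _ _ _ p nz])

lemma ricci_ricci_op:
  assumes p: "p \<in> U" and nz: "\<psi> i p \<noteq> 0" and v: "v \<in> tangent M p"
  shows "ricci M p v
    = frame_vec E p (ricci_op \<alpha> \<beta> (b p) (xv p) (xv p \<times> w p) (coords M E p v))" (is "_ = ?r")
proof -
  have tr: "tangent_trace M p (\<lambda>u. curvature M p u v z)
      = ricci_op \<alpha> \<beta> (b p) (xv p) (xv p \<times> w p) (coords M E p v) \<bullet> coords M E p z"
    if z: "z \<in> tangent M p" for z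
  proof -
    let ?l = "\<lambda>x. curv_op \<alpha> \<beta> (b p) (xv p) (xv p \<times> w p) (x \<times> coords M E p v) \<times> coords M E p z"
    have "tangent_trace M p (\<lambda>u. curvature M p u v z) = trace (matrix ?l)"
      by (intro tangent_trace_coords[OF p])
        (simp_all add: curvature_curv_op[OF p nz _ v z] frame_vec_tangent[OF p]
          coords_frame_vec[OF p] fun_cong[OF matrix_vector_mul(2)[OF linear_curv_op_cross]])
    then show ?thesis
      by (simp add: trace_curv_op xv_inner[OF p] dot_cross_self)
  qed
  show ?thesis
    unfolding ricci_def
  proof (rule the_equality)
    show "?r \<in> tangent M p \<and>
        (\<forall>z\<in>tangent M p. rmetric M p ?r z = tangent_trace M p (\<lambda>u. curvature M p u v z))"
      using p by (simp add: frame_vec_tangent metric_coords coords_frame_vec tr)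
  next
    fix r
    assume r: "r \<in> tangent M p \<and>
        (\<forall>z\<in>tangent M p. rmetric M p r z = tangent_trace M p (\<lambda>u. curvature M p u v z))"
    then have "coords M E p r \<bullet> coords M E p z
        = ricci_op \<alpha> \<beta> (b p) (xv p) (xv p \<times> w p) (coords M E p v) \<bullet> coords M E p z"
      if "z \<in> tangent M p" for z
      using that by (simp add: metric_coords[OF p, symmetric] tr[symmetric])
    from this[OF frame_vec_tangent[OF p]]
    have "\<forall>x. coords M E p r \<bullet> x
        = ricci_op \<alpha> \<beta> (b p) (xv p) (xv p \<times> w p) (coords M E p v) \<bullet> x"
      by (simp add: coords_frame_vec[OF p])
    then have "coords M E p r = ricci_op \<alpha> \<beta> (b p) (xv p) (xv p \<times> w p) (coords M E p v)"
      by (rule vector_eq_rdot[THEN iffD1])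
    then show "r = ?r" using frame_vec_coords[OF p] r by metis
  qed
qed

lemma scalar_curvature_eq:
  assumes p: "p \<in> U" and nz: "\<psi> i p \<noteq> 0"
  shows "scalar_curvature M p = 2 * (4 * \<beta>\<^sup>2 - (b p)\<^sup>2 - 4 * \<alpha> * b p)"
proof -
  have "scalar_curvature M p = trace (matrix (ricci_op \<alpha> \<beta> (b p) (xv p) (xv p \<times> w p)))"
    unfolding scalar_curvature_def
    by (intro tangent_trace_coords[OF p])
      (simp_all add: ricci_ricci_op[OF p nz] frame_vec_tangent[OF p] coords_frame_vec[OF p]
        fun_cong[OF matrix_vector_mul(2)[OF linear_ricci_op]])
  then show ?thesis by (simp add: trace_ricci_op xv_inner[OF p] dot_cross_self)
qed

lemma frame_vec_eqI:
  "p \<in> U \<Longrightarrow> v \<in> tangent M p \<Longrightarrow> coords M E p v = x \<Longrightarrow> frame_vec E p x = v"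
  using frame_vec_coords by blast

lemma ricci_xi:
  assumes p: "p \<in> U" and nz: "\<psi> i p \<noteq> 0"
  shows "ricci M p (xi M p)
    = (2 * (b p)\<^sup>2) *\<^sub>R xi M p - flow_J M p (normal_gradient M b p)"
  unfolding ricci_ricci_op[OF p nz xi_tangent] normal_gradient_coords(2)[OF p nz]
proof (rule frame_vec_eqI[OF p])
  show "coords M E p ((2 * (b p)\<^sup>2) *\<^sub>R xi M p - frame_vec E p (xv p \<times> w p))
    = ricci_op \<alpha> \<beta> (b p) (xv p) (xv p \<times> w p) (coords M E p (xi M p))"
    using p xv_inner[OF p]
    by (simp add: coords_diff coords_scaleR tangent_scaleR xi_tangent frame_vec_tangent
        coords_frame_vec xv_def[symmetric] ricci_op_def dot_cross_self)
      (simp add: vec_eq_iff algebra_simps)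
qed (intro tangent_diff tangent_scaleR xi_tangent frame_vec_tangent p)

lemma ricci_normal:
  assumes p: "p \<in> U" and nz: "\<psi> i p \<noteq> 0" and z: "z \<in> normal_plane M p"
  shows "ricci M p z = (2 * (2 * \<beta>\<^sup>2 - (b p)\<^sup>2 - 2 * \<alpha> * b p)) *\<^sub>R z
    - rmetric M p (flow_J M p (normal_gradient M b p)) z *\<^sub>R xi M p"
proof -
  have t: "z \<in> tangent M p" "coords M E p z \<bullet> xv p = 0"
    using normal_plane_coords[OF p z] by auto
  show ?thesis
    unfolding ricci_ricci_op[OF p nz t(1)] normal_gradient_coords(2)[OF p nz]
  proof (rule frame_vec_eqI[OF p])
    show "coords M E p ((2 * (2 * \<beta>\<^sup>2 - (b p)\<^sup>2 - 2 * \<alpha> * b p)) *\<^sub>R z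
        - rmetric M p (frame_vec E p (xv p \<times> w p)) z *\<^sub>R xi M p)
      = ricci_op \<alpha> \<beta> (b p) (xv p) (xv p \<times> w p) (coords M E p z)"
      using p t
      by (simp add: coords_diff coords_scaleR tangent_scaleR xi_tangent frame_vec_tangent
          coords_frame_vec metric_coords xv_def[symmetric] ricci_op_def inner_commute)
  qed (intro tangent_diff tangent_scaleR xi_tangent t)
qed

lemma grad_smooth_fun: "smooth_fun (atlas M) U (\<lambda>q. w q $ k)"
  using vfield_act[OF E_field open_U order_refl smooth_fun_subset[OF b_smooth]]
  by (simp add: grad_coords_def)

lemma normal_gradient_field:
  assumes nz: "\<And>q. q \<in> U \<Longrightarrow> \<psi> i q \<noteq> 0"
  shows "normal_gradient M b \<in> vfields M U"
  by (rule vfield_cong[OF frame_vec_field[OF order_refl grad_smooth_fun]])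
    (simp add: normal_gradient_coords nz)

lemma J_normal_gradient_field:
  assumes nz: "\<And>q. q \<in> U \<Longrightarrow> \<psi> i q \<noteq> 0"
  shows "(\<lambda>q. flow_J M q (normal_gradient M b q)) \<in> vfields M U"
proof -
  have "smooth_fun (atlas M) U (\<lambda>q. xv q $ k)" for k
    unfolding xv_def coords_nth
    by (intro g_smooth open_U vfield_subset[OF xi_field] E_field) simp
  then have "smooth_fun (atlas M) U (\<lambda>q. (xv q \<times> w q) $ k)" for k
    using exhaust_3[of k]
    by (auto simp: cross_components intro!: smooth_fun_diff smooth_fun_mult open_U grad_smooth_fun)
  then show ?thesis
    by (intro vfield_cong[OF frame_vec_field[OF order_refl]]) (auto simp: normal_gradient_coords(2) nz)
qed

lemma hessian_symmetric:
  assumes p: "p \<in> U" and t: "u \<in> tangent M p" "v \<in> tangent M p"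
  shows "cov p u w \<bullet> coords M E p v = cov p v w \<bullet> coords M E p u"
  using cov_grad_symmetric[OF extension_field extension_field open_U p p b_near,
      of "coords M E p u" "coords M E p v"] frame_vec_coords[OF p] t
  by simp

text \<open>Differentiating \<open>\<xi>(b) = 0\<close> along \<open>v\<close> and using the
  symmetry of the Hessian gives the derivative of grad b along \<xi> as
  \<open>b \<xi> \<times> grad b\<close>. This is also the derivative of \<xi> along grad b, so the
  two fields commute.\<close>

lemma nabla_xi_normal_gradient:
  assumes nz: "\<And>q. q \<in> U \<Longrightarrow> \<psi> i q \<noteq> 0" and p: "p \<in> U"
  shows "nabla_normal M p (xi M p) (normal_gradient M b) = 0"
proof -
  let ?W = "normal_gradient M b"
  have field: "?W \<in> vfields M U" by (rule normal_gradient_field[OF nz])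
  have xiU: "xi M \<in> vfields M U" by (rule vfield_subset[OF xi_field]) simp
  have Wp: "?W p \<in> tangent M p" using vfield_tangent[OF field p] .
  have covW: "cov p (xi M p) (\<lambda>q. coords M E q (?W q)) = cov p (xi M p) w"
    by (rule cov_cong[OF xi_tangent smooth_coords[OF field open_U p p] open_U p])
      (simp add: normal_gradient_coords nz coords_frame_vec)
  have "(cov p (xi M p) w - b p *\<^sub>R (xv p \<times> w p)) \<bullet> coords M E p v = 0" if v: "v \<in> tangent M p" for v
  proof -
    \<comment> \<open>Differentiation requires \<open>\<xi>(b) = 0\<close> on a whole neighbourhood,
      hence a spinor without zeros on \<open>U\<close>.\<close>
    have "act v (\<lambda>q. w q \<bullet> xv q) = act v (\<lambda>q. 0)"
      using xi_b_zero(1)[OF _ nz] smooth_grad_coords[OF b_near p] xv_smooth[OF p]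
      by (intro act_cong[OF v _ open_U p] smooth_near_inner) auto
    then have "cov p v w \<bullet> xv p + w p \<bullet> (b p *\<^sub>R (xv p \<times> coords M E p v)) = 0"
      using act_inner_cov[OF v smooth_grad_coords[OF b_near p] xv_smooth[OF p]] act_const[OF v]
      by (simp add: cov_xv[OF p v])
    moreover have "w p \<bullet> (xv p \<times> coords M E p v) = - ((xv p \<times> w p) \<bullet> coords M E p v)"
      by (simp add: cross3_simps)
    moreover have "cov p (xi M p) w \<bullet> coords M E p v = cov p v w \<bullet> xv p"
      using hessian_symmetric[OF p xi_tangent v] by (simp add: xv_def)
    ultimately show ?thesis by (simp add: inner_diff_left)
  qed
  from this[OF frame_vec_tangent[OF p]]
  have "cov p (xi M p) w - b p *\<^sub>R (xv p \<times> w p) = 0"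
    unfolding coords_frame_vec[OF p] by (rule inner_eq_zero_iff[THEN iffD1])
  then have "coords M E p (bracket M (xi M) ?W p) = coords M E p 0"
    unfolding coords_bracket_cov[OF xiU field open_U p p] covW
    using cov_xv[OF p Wp] p
    by (simp add: xv_def[abs_def, symmetric] normal_gradient_coords nz coords_frame_vec coords_zero)
  then have br: "bracket M (xi M) ?W p = 0"
    using coords_inject[OF p vfield_tangent[OF bracket_field[OF open_U xiU field] p] tangent_zero] by simp
  \<comment> \<open>In the direction \<xi> the second summand of \<open>nabla_normal\<close>
    differentiates along the zero vector, so only the bracket is left.\<close>
  have "proj_normal M p (xi M p) = 0"
    by (simp add: proj_normal_def xi_metric)
  moreover have "nabla M p 0 ?W = 0"
    using nabla_scaleR[OF open_U field p tangent_zero, of 0] by simp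
  moreover have "proj_normal M p 0 = 0"
    using metric_coords[OF p tangent_zero xi_tangent] coords_zero[OF p] by (simp add: proj_normal_def)
  ultimately show ?thesis
    by (simp add: nabla_normal_def br)
qed

text \<open>The product rule for \<open>\<xi> \<times> grad b\<close> gives two traces: the one from
  the derivative of \<xi> is a multiple of \<open>\<xi>(b)\<close>, the other pairs the skew map
  \<open>\<xi> \<times>\<close> with the Hessian.\<close>

lemma divergence_J_normal_gradient:
  assumes nz: "\<And>q. q \<in> U \<Longrightarrow> \<psi> i q \<noteq> 0" and p: "p \<in> U"
  shows "divergence M (\<lambda>q. flow_J M q (normal_gradient M b q)) p = 0"
proof -
  let ?F = "\<lambda>q. flow_J M q (normal_gradient M b q)"
  have field: "?F \<in> vfields M U" by (rule J_normal_gradient_field[OF nz])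
  define H where "H x = cov p (frame_vec E p x) w" for x
  define l where "l x = b p *\<^sub>R ((xv p \<times> x) \<times> w p) + xv p \<times> H x" for x
  have fv: "frame_vec E p (x + y) = frame_vec E p x + frame_vec E p y"
    "frame_vec E p (r *\<^sub>R x) = r *\<^sub>R frame_vec E p x" for x y r
    by (simp_all add: frame_vec_def sum.distrib scaleR_left_distrib scaleR_sum_right)
  have H: "H (x + y) = H x + H y" "H (r *\<^sub>R x) = r *\<^sub>R H x" for x y r
    using p by (simp_all add: H_def cov_def fv vact_tvec_add vact_tvec_scaleR conn_add conn_scaleR
        frame_vec_tangent cross_add_left cross_mult_left algebra_simps)
  have lin: "linear l"
    by (rule linearI) (simp_all add: l_def H cross_add_right cross_add_left cross_mult_right
        cross_mult_left algebra_simps)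
  have Hsym: "H x \<bullet> y = H y \<bullet> x" for x y
    using hessian_symmetric[OF p frame_vec_tangent[OF p] frame_vec_tangent[OF p], of x y] p
    by (simp add: H_def coords_frame_vec)
  have "coords M E p (nabla M p v ?F) = matrix l *v coords M E p v" if v: "v \<in> tangent M p" for v
  proof -
    have "coords M E p (nabla M p v ?F) = cov p v (\<lambda>q. coords M E q (?F q))"
      by (rule coords_nabla_cov[OF field open_U p p v])
    also have "\<dots> = cov p v (\<lambda>q. xv q \<times> w q)"
      by (rule cov_cong[OF v smooth_coords[OF field open_U p p] open_U p])
        (simp add: normal_gradient_coords(2) nz coords_frame_vec)
    also have "\<dots> = l (coords M E p v)"
      using cov_cross[OF v xv_smooth[OF p] smooth_grad_coords[OF b_near p]]
      by (simp add: cov_xv[OF p v] l_def H_def frame_vec_coords[OF p v] cross_mult_left)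
    finally show ?thesis by (simp add: fun_cong[OF matrix_vector_mul(2)[OF lin]])
  qed
  then have "tangent_trace M p (\<lambda>v. nabla M p v ?F) = trace (matrix l)"
    using nabla_tangent[OF field open_U p p] by (intro tangent_trace_coords[OF p]) auto
  also have "\<dots> = 0"
  proof -
    \<comment> \<open>The composition of a skew map with a symmetric one has trace zero.\<close>
    have "H (axis i 1) $ k = H (axis k 1) $ i" for i k
      using Hsym[of "axis i 1" "axis k 1"] by (simp add: cart_eq_inner_axis)
    from this[of 2 1] this[of 3 1] this[of 3 2]
    have "(\<Sum>i\<in>UNIV. (xv p \<times> H (axis i 1)) $ i) = 0"
      by (simp add: sum_3 cross_components algebra_simps)
    moreover have "(\<Sum>i\<in>UNIV. ((xv p \<times> axis i 1) \<times> w p) $ i) = 2 * (w p \<bullet> xv p)"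
      by (simp add: sum_3 cross_components axis_def inner_vec_def algebra_simps)
    ultimately show ?thesis
      using xi_b_zero(1)[OF p nz[OF p]]
      by (simp add: trace_matrix l_def sum.distrib sum_distrib_left[symmetric])
  qed
  finally show ?thesis by (simp add: divergence_def)
qed

text \<open>The length of \<open>\<psi>\<close> is locally constant, because Clifford multiplication by a real vector is
  skew-Hermitian.\<close>

lemma psi_norm_locally_constant:
  assumes p: "p \<in> U"
  shows "\<exists>W. open W \<and> p \<in> W \<and> W \<subseteq> U \<and> (\<forall>q\<in>W. \<psi> i q = 0 \<longleftrightarrow> \<psi> i p = 0)"
proof -
  let ?f = "\<lambda>q. (Re (\<psi> i q $ 1) * Re (\<psi> i q $ 1) + Im (\<psi> i q $ 1) * Im (\<psi> i q $ 1))
    + (Re (\<psi> i q $ 2) * Re (\<psi> i q $ 2) + Im (\<psi> i q $ 2) * Im (\<psi> i q $ 2))"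
  have smooth: "smooth_fun (atlas M) U (\<lambda>q. Re (\<psi> i q $ k))"
    "smooth_fun (atlas M) U (\<lambda>q. Im (\<psi> i q $ k))" for k
    using killing unfolding transversal_killing_spinor_def spinor_fields_def smooth_cfun_def U_def by auto
  have zero: "act v ?f = 0" if q: "q \<in> U" and v: "v \<in> tangent M q" for q v
  proof -
    have near: "smooth_near (atlas M) q (\<lambda>q. Re (\<psi> i q $ k))"
      "smooth_near (atlas M) q (\<lambda>q. Im (\<psi> i q $ k))" for k
      using smooth_nearI[OF open_U q] smooth by auto
    let ?d = "act_spinor v (\<psi> i)"
    have "act v ?f = 2 * (Re (\<psi> i q $ 1) * Re (?d $ 1) + Im (\<psi> i q $ 1) * Im (?d $ 1)
        + Re (\<psi> i q $ 2) * Re (?d $ 2) + Im (\<psi> i q $ 2) * Im (?d $ 2))"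
      by (simp add: act_add[OF v] act_mult[OF v] smooth_near_intros near act_spinor_nth)
    also have "\<dots> = 0"
      unfolding act_psi[OF q v] clifford_skew by simp
    finally show ?thesis .
  qed
  have "\<exists>W. open W \<and> p \<in> W \<and> W \<subseteq> U \<and> (\<forall>q\<in>W. ?f q = ?f p)"
  proof (rule locally_constant[OF open_U p])
    show "smooth_fun (atlas M) U ?f"
      by (intro smooth_fun_add smooth_fun_mult open_U smooth)
    show "\<exists>e. (\<forall>i. e $ i \<in> tangent M q \<and> act (e $ i) ?f = 0) \<and> det (chart_matrix \<phi> e) \<noteq> 0"
      if "q \<in> U" "(V, \<phi>) \<in> atlas M" "q \<in> V" for q V \<phi>
      using zero[OF that(1)] E_tangent[OF that(1)] E_chart_det[OF that]
      by (intro exI[of _ "E q"]) auto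
  qed
  moreover have "?f q = 0 \<longleftrightarrow> \<psi> i q = 0" for q
    by (simp add: spinor_eq_iff add_nonneg_eq_0_iff)
  ultimately show ?thesis by metis
qed

end

section \<open>From the trivializations to the whole connected manifold\<close>

theorem proposition6p2:
  fixes M :: "'a::{t2_space,second_countable_topology} flow3"
    and S :: "('a, 'i) spin3"
    and \<psi> :: "'i \<Rightarrow> 'a \<Rightarrow> complex^2"
    and \<alpha> \<beta> :: real
    and b :: "'a \<Rightarrow> real"
  assumes flow: "riemannian_flow M"
    and spin: "spin_structure M S"
    and killing: "transversal_killing_spinor M S \<alpha> \<beta> \<psi>"
    and nonzero: "\<exists>i. \<exists>p\<in>spin_dom S i. \<psi> i p \<noteq> 0"
    and kappa: "\<forall>p. flow_kappa M p = 0"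
    and b_smooth: "smooth_fun (atlas M) UNIV b"
    and h_eq: "\<forall>p. \<forall>z\<in>normal_plane M p. flow_h M p z = b p *\<^sub>R flow_J M p z"
  shows
    "((\<forall>p. scalar_curvature M p = 2 * (4 * \<beta>\<^sup>2 - (b p)\<^sup>2 - 4 * \<alpha> * b p)) \<and>
      (\<forall>p. ricci M p (xi M p)
             = (2 * (b p)\<^sup>2) *\<^sub>R xi M p - flow_J M p (normal_gradient M b p)) \<and>
      (\<forall>Z\<in>normal_sections M UNIV. \<forall>p.
         ricci M p (Z p)
           = (2 * (2 * \<beta>\<^sup>2 - (b p)\<^sup>2 - 2 * \<alpha> * b p)) *\<^sub>R Z p
             - rmetric M p (flow_J M p (normal_gradient M b p)) (Z p) *\<^sub>R xi M p)) \<and>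
     ((\<forall>p. nabla_normal M p (xi M p) (normal_gradient M b) = 0) \<and>
      (\<forall>p. divergence M (\<lambda>q. flow_J M q (normal_gradient M b q)) p
             = - 8 * \<alpha> * \<beta> * (3 * b p + 2 * \<alpha>))) \<and>
     (compact (UNIV :: 'a set) \<longrightarrow>
        \<alpha> * \<beta> = 0 \<and> (\<forall>p. act (xi M p) b = 0))"
proof -
  have riem: "oriented_riemannian_3manifold M"
    using flow by (simp add: riemannian_flow_def)
  have frame: "killing_frame M (spin_dom S i) (spin_frame S i) b S i \<psi> \<alpha> \<beta>" for i
    using riem flow spin killing kappa b_smooth h_eq
    by unfold_locales (auto simp: spin_structure_def)
  have cover: "\<exists>i. p \<in> spin_dom S i" for p
    using spin unfolding spin_structure_def by blast
  have lift: "\<psi> i p = spin_lift S i j p *v \<psi> j p" if "p \<in> spin_dom S i" "p \<in> spin_dom S j" for i j p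
    using killing that unfolding transversal_killing_spinor_def spinor_fields_def by blast
  have indep: "\<psi> i p = 0 \<longleftrightarrow> \<psi> j p = 0" if "p \<in> spin_dom S i" "p \<in> spin_dom S j" for i j p
    using lift[OF that] lift[OF that(2,1)] by (metis matrix_vector_mult_0_right)
  \<comment> \<open>Lifts are linear and exist in both directions, so vanishing at a point is
    independent of the trivialization. This makes \<open>P\<close> a locally constant property, to
    which connectedness applies.\<close>
  define P where "P p \<longleftrightarrow> (\<exists>i. p \<in> spin_dom S i \<and> \<psi> i p \<noteq> 0)" for p
  have P: "P p \<longleftrightarrow> \<psi> i p \<noteq> 0" if "p \<in> spin_dom S i" for i p
    using indep that unfolding P_def by blast
  have local: "\<exists>W. open W \<and> p \<in> W \<and> (\<forall>q\<in>W. P q \<longleftrightarrow> P p)" for p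
  proof -
    obtain i where i: "p \<in> spin_dom S i" using cover by blast
    obtain W where W: "open W \<and> p \<in> W \<and> W \<subseteq> spin_dom S i \<and> (\<forall>q\<in>W. \<psi> i q = 0 \<longleftrightarrow> \<psi> i p = 0)"
      using killing_frame.psi_norm_locally_constant[OF frame i] by blast
    have "P q \<longleftrightarrow> P p" if "q \<in> W" for q
    proof -
      have "q \<in> spin_dom S i" "\<psi> i q = 0 \<longleftrightarrow> \<psi> i p = 0" using W that by blast+
      then show ?thesis using P i by simp
    qed
    with W show ?thesis by blast
  qed
  have "open {p. P p}" "open {p. \<not> P p}"
    by (subst open_subopen; use local in fast)+
  moreover have "connected (UNIV :: 'a set)"
    using riem by (simp add: oriented_riemannian_3manifold_def)
  moreover have "{p. P p} \<noteq> {}" using nonzero unfolding P_def by blast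
  ultimately have "{p. \<not> P p} = {}"
    unfolding connected_def by blast
  then have nz: "\<psi> i p \<noteq> 0" if "p \<in> spin_dom S i" for i p
    using P[OF that] by blast
  \<comment> \<open>A condition on constants can be read off at any single point;
    \<open>undefined\<close> is one.\<close>
  have \<alpha>\<beta>: "\<alpha> * \<beta> = 0"
    using cover[of undefined] killing_frame.xi_b_zero(2)[OF frame] nz by blast
  have scal: "scalar_curvature M p = 2 * (4 * \<beta>\<^sup>2 - (b p)\<^sup>2 - 4 * \<alpha> * b p)" for p
    using cover[of p] killing_frame.scalar_curvature_eq[OF frame] nz by blast
  have ric_xi: "ricci M p (xi M p)
      = (2 * (b p)\<^sup>2) *\<^sub>R xi M p - flow_J M p (normal_gradient M b p)" for p
    using cover[of p] killing_frame.ricci_xi[OF frame] nz by blast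
  have ric_Z: "ricci M p (Z p) = (2 * (2 * \<beta>\<^sup>2 - (b p)\<^sup>2 - 2 * \<alpha> * b p)) *\<^sub>R Z p
      - rmetric M p (flow_J M p (normal_gradient M b p)) (Z p) *\<^sub>R xi M p"
    if "Z \<in> normal_sections M UNIV" for Z p
  proof -
    have "Z p \<in> normal_plane M p" using that unfolding normal_sections_def by auto
    then show ?thesis
      using cover[of p] killing_frame.ricci_normal[OF frame] nz by blast
  qed
  have nabla: "nabla_normal M p (xi M p) (normal_gradient M b) = 0" for p
    using cover[of p] killing_frame.nabla_xi_normal_gradient[OF frame] nz by blast
  have div: "divergence M (\<lambda>q. flow_J M q (normal_gradient M b q)) p = 0" for p
    using cover[of p] killing_frame.divergence_J_normal_gradient[OF frame] nz by blast
  have xi_b: "act (xi M p) b = 0" for p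
  proof -
    obtain i where i: "p \<in> spin_dom S i" using cover by blast
    interpret killing_frame M "spin_dom S i" "spin_frame S i" b S i \<psi> \<alpha> \<beta>
      by (rule frame)
    show ?thesis
      using act_grad_coords[OF i xi_tangent, of b] xi_b_zero(1)[OF i nz[OF i]] by (simp add: xv_def)
  qed
  have "- 8 * \<alpha> * \<beta> * (3 * b p + 2 * \<alpha>) = 0" for p
    using \<alpha>\<beta> by auto
  then show ?thesis
    using scal ric_xi ric_Z nabla div xi_b \<alpha>\<beta> by simp
qed

end
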